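(* Let $D$ be an oriented regular (possibly virtual) link diagram containing a tangle with boundary circle $\Sigma$, let $C$ be a directed Euler system for the directed universe of $D$ such that a single circuit of $C$ passes through all four points of $\Sigma\cap D$, and let $F$, $a$, $D_+$, $D_-$, $C_+$, $C_-$, $F_+=\mathcal{L}(D_+,C_+)$ and $F_-=\mathcal{L}(D_-,C_-)$ be the associated objects described in the context, the new crossings $v_+$, $v_-$ being given the weights $\alpha(v_\pm)=A$, $\beta(v_\pm)=B$. Let $\alpha(a),\beta(a),\alpha(a_m)\in R$ be universal weights for $(F,a)$. Then $$(2-d-d^{2})\,\alpha(a)=-(d+1)[F-a]+\frac{[F_+]+[F_-]}{A+B},$$ $$(2-d-d^{2})\,\beta(a)=[F-a]+\frac{(A+B+Bd)[F_+]-(A+Ad+B)[F_-]}{A^{2}-B^{2}},$$ $$(2-d-d^{2})\,\alpha(a_m)=[F-a]+\frac{(A+B+Bd)[F_-]-(A+Ad+B)[F_+]}{A^{2}-B^{2}}.$$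
   Context: Weighted bracket. A graph is finite and may have loops, multiple edges, and free loops (connected components with neither vertices nor edges). A marked graph is a graph each of whose vertices is designated marked or unmarked. A weighted, marked graph also has functions $\alpha,\beta:V(G)\to R$, where $R$ is a fixed commutative ring containing $A,B,d$, treated as independent variables; in particular $A^2-B^2$ is not a zero divisor, and the equations of the claim are read in the localization of $R$ in which $A^2-B^2$ is inverted. A vertex has standard weights if $\alpha(v)=A,\beta(v)=B$. If $V(G)=\{v_1,\dots,v_n\}$, $\mathcal{A}(G)$ is the $n\times n$ matrix over $GF(2)$ with $\mathcal{A}(G)_{ii}=1$ iff $v_i$ is looped and, for $i\ne j$, $\mathcal{A}(G)_{ij}=1$ iff $v_i,v_j$ are adjacent. For $T\subseteq V(G)$, $\mathcal{A}(G)_T$ is obtained by first changing the $i$th diagonal entry whenever $v_i\in T$, and then removing the $i$th row and column whenever $v_i$ is marked and the (new) $i$th diagonal entry is $0$. Then $$[G]=d^{\phi}\sum_{T\subseteq V(G)}\Big(\prod_{v\notin T}\alpha(v)\Big)\Big(\prod_{t\in T}\beta(t)\Big)d^{\nu(\mathcal{A}(G)_T)},$$ where $\phi$ is the number of free loops and $\nu$ is $GF(2)$-nullity. $G-v$ is obtained by removing $v$ and all edges incident on $v$. Composition and universal weights. $G=F\ast H$ if: (a) $V(F)\cap V(H)$ consists of a single unlooped, unmarked vertex $a$ with standard weights in both $F$ and $H$; (b) the elements of $V(G)=V(F)\cup V(H)-\{a\}$ inherit loops, marks and weights from $F$ and $H$; (c) $E(G)=E(F-a)\cup E(H-a)\cup\{\{v,w\}:\{v,a\}\in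 E(F),\{a,w\}\in E(H)\}$; (d) $F$ and $H$ share no free loop, and the free loops of $G$ are those of $F$ and $H$. Elements $\alpha(a),\beta(a),\alpha(a_m)\in R$ are universal weights for $(F,a)$ if every composition $F\ast H$ in which no neighbor of $a$ in $H$ is marked satisfies $[F\ast H]=[H']+[H'_m]$, where $H'$ is $H$ with the weights of $a$ changed to $\alpha(a),\beta(a)$, and $H'_m$ is $H$ with $a$ marked and its weights changed to $\alpha(a_m),0$. (Universal weights always exist. In the claim, $\alpha(a),\beta(a)$ denote these.) Diagrams. A link diagram $D$ consists of oriented closed curves in the plane meeting only in finitely many transverse crossings, each classical or virtual. A tangle is a portion of $D$ enclosed by a circle $\Sigma$ that meets $D$ transversely in precisely four points, none a crossing. The directed universe $\vec U$ is the 2-in, 2-out digraph whose vertices are the classical crossings and whose edges are the arcs of $D$ between them (virtual crossings ignored), with a free loop for each component having no classical crossing; $U$ is the undirected version. A directed Euler system $C$ contains one directed Euler circuit for each connected component of $U$, and every free loop. A classical crossing is marked if $C$ does not follow the incident link component(s) there. $\mathcal{L}(D,C)$ has a vertex for each classical crossing; marked vertices are marked crossings, looped vertices are negative crossings, and distinct $v,w$ are adjacent iff they are interlaced, i.e. appear in the order $v\dots w\dots v\dots w$ on a circuit of $C$. It has one fewer free loop than $U$ has connected components (free loops of $U$ included). Vertices carry weights assigned to the crossings (standard weights by default). The associated objects. Let the circuit of $C$ through the four points be $C_{11}p_1C_{12}p_2C_{13}p_3C_{14}p_4$, with $C_{11},C_{13}$ outside $\Sigma$ and $C_{12},C_{14}$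 inside. $F$ is the marked, weighted graph whose vertices are the classical crossings outside $\Sigma$ and one additional unlooped, unmarked vertex $a$ with standard weights; $F-a$ is the subgraph of $\mathcal{L}(D,C)$ induced by the crossings outside $\Sigma$, and $a$ is adjacent to exactly those crossings that appear on both $C_{11}$ and $C_{13}$. $F$ has one free loop for each connected component of $U$ lying entirely outside $\Sigma$. $D_+$ (respectively $D_-$) is the diagram obtained from $D$ by replacing everything inside $\Sigma$ with two arcs directed from $p_1$ to $p_2$ and from $p_3$ to $p_4$, which meet in exactly one classical crossing $v_+$ (respectively $v_-$), which is positive (respectively negative), and in addition in one virtual crossing if this is needed for the four endpoints to be connected in this way. $C_\pm$ is the Euler system of $D_\pm$ obtained from $C$ by replacing $C_{12}$ and $C_{14}$ with these two arcs and discarding circuits lying inside $\Sigma$; the new crossing $v_\pm$ is thus unmarked. *)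

theory Defs
  imports
    "HOL-Analysis.Analysis"
    "HOL-Library.Multiset"
    "HOL-Library.Sublist"
    "HOL-Library.Z2"
    "Graph_Theory.Graph_Theory"
    "Jordan_Normal_Form.Matrix_Kernel"
    "Jordan_Normal_Form.DL_Submatrix"
begin

section \<open>The coefficient ring\<close>

text \<open>
  Independence is over the prime subring of the coefficient ring. This is implied by independence
  over any larger ring of coefficients, and it does not fix the characteristic.
\<close>

definition independent_variables :: "'r::comm_ring_1 \<Rightarrow> 'r \<Rightarrow> 'r \<Rightarrow> bool" where
  "independent_variables A B d \<longleftrightarrow>
     (\<forall>f :: nat \<times> nat \<times> nat \<Rightarrow> int. finite {m. f m \<noteq> 0} \<longrightarrow>
        (\<Sum>(i, j, k)\<in>{m. f m \<noteq> 0}. of_int (f (i, j, k)) * A ^ i * B ^ j * d ^ k) = 0 \<longrightarrow>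
        (\<forall>m. (of_int (f m) :: 'r) = 0))"

definition non_zero_divisor :: "'r::comm_ring_1 \<Rightarrow> bool" where
  "non_zero_divisor s \<longleftrightarrow> (\<forall>x. s * x = 0 \<longrightarrow> x = 0)"

definition is_localization :: "('r::comm_ring_1 \<Rightarrow> 's::comm_ring_1) \<Rightarrow> 'r \<Rightarrow> bool" where
  "is_localization \<iota> s \<longleftrightarrow>
     \<iota> 1 = 1 \<and> (\<forall>x y. \<iota> (x + y) = \<iota> x + \<iota> y) \<and> (\<forall>x y. \<iota> (x * y) = \<iota> x * \<iota> y) \<and>
     (\<exists>y. \<iota> s * y = 1) \<and>
     (\<forall>z. \<exists>x n. z * \<iota> s ^ n = \<iota> x) \<and>
     (\<forall>x. \<iota> x = 0 \<longleftrightarrow> (\<exists>n. s ^ n * x = 0))"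

text \<open>Meaningful only when \<open>y\<close> is a unit, as both denominators of the theorem are.\<close>

definition quot :: "'s::comm_ring_1 \<Rightarrow> 's \<Rightarrow> 's" where
  "quot x y = (THE z. z * y = x)"


section \<open>Weighted, marked graphs and their bracket\<close>

text \<open>
  An edge is the set of its ends, so \<open>{v}\<close> is a loop at \<open>v\<close>. Free loops carry no data
  and are only counted. Weights outside the vertex set are irrelevant.
\<close>

record ('v, 'r) wgraph =
  vertices :: "'v set"
  edges :: "'v set multiset"
  marks :: "'v set"
  alpha :: "'v \<Rightarrow> 'r"
  beta :: "'v \<Rightarrow> 'r"
  free_loops :: nat

definition wf_wgraph :: "('v, 'r) wgraph \<Rightarrow> bool" where
  "wf_wgraph G \<longleftrightarrow> finite (vertices G) \<and> marks G \<subseteq> vertices G \<and>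
     (\<forall>e\<in>#edges G. \<exists>v\<in>vertices G. \<exists>w\<in>vertices G. e = {v, w})"

definition vertex_list :: "('v, 'r) wgraph \<Rightarrow> 'v list" where
  "vertex_list G = (SOME vs. distinct vs \<and> set vs = vertices G)"

definition adjacency_matrix :: "('v, 'r) wgraph \<Rightarrow> bit mat" where
  "adjacency_matrix G = (let vs = vertex_list G in
     mat (length vs) (length vs) (\<lambda>(i, j). of_bool ({vs ! i, vs ! j} \<in># edges G)))"

definition toggled_matrix :: "('v, 'r) wgraph \<Rightarrow> 'v set \<Rightarrow> bit mat" where
  "toggled_matrix G T = (let vs = vertex_list G in
     mat (length vs) (length vs)
       (\<lambda>(i, j). adjacency_matrix G $$ (i, j) + of_bool (i = j \<and> vs ! i \<in> T)))"

definition state_matrix :: "('v, 'r) wgraph \<Rightarrow> 'v set \<Rightarrow> bit mat" where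
  "state_matrix G T = (let vs = vertex_list G; M = toggled_matrix G T;
       keep = {i. i < length vs \<and> \<not> (vs ! i \<in> marks G \<and> M $$ (i, i) = 0)}
     in submatrix M keep keep)"

definition bracket :: "'r::comm_ring_1 \<Rightarrow> ('v, 'r) wgraph \<Rightarrow> 'r" where
  "bracket d G = d ^ free_loops G *
     (\<Sum>T\<in>Pow (vertices G).
        (\<Prod>v\<in>vertices G - T. alpha G v) * (\<Prod>t\<in>T. beta G t) * d ^ kernel_dim (state_matrix G T))"

definition induced :: "('v, 'r) wgraph \<Rightarrow> 'v set \<Rightarrow> ('v, 'r) wgraph" where
  "induced G S = G\<lparr>vertices := vertices G \<inter> S,
     edges := filter_mset (\<lambda>e. e \<subseteq> S) (edges G), marks := marks G \<inter> S\<rparr>"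

definition delete_vertex :: "('v, 'r) wgraph \<Rightarrow> 'v \<Rightarrow> ('v, 'r) wgraph" where
  "delete_vertex G v = induced G (- {v})"


section \<open>Composition and universal weights\<close>

definition standard_vertex :: "'r \<Rightarrow> 'r \<Rightarrow> ('v, 'r) wgraph \<Rightarrow> 'v \<Rightarrow> bool" where
  "standard_vertex A B G a \<longleftrightarrow> a \<in> vertices G \<and> {a} \<notin># edges G \<and> a \<notin> marks G \<and>
     alpha G a = A \<and> beta G a = B"

definition composable ::
    "'r \<Rightarrow> 'r \<Rightarrow> ('v, 'r) wgraph \<Rightarrow> ('v, 'r) wgraph \<Rightarrow> 'v \<Rightarrow> bool" where
  "composable A B F H a \<longleftrightarrow> wf_wgraph F \<and> wf_wgraph H \<and> vertices F \<inter> vertices H = {a} \<and>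
     standard_vertex A B F a \<and> standard_vertex A B H a"

definition compose :: "('v, 'r) wgraph \<Rightarrow> ('v, 'r) wgraph \<Rightarrow> 'v \<Rightarrow> ('v, 'r) wgraph" where
  "compose F H a =
     \<lparr>vertices = (vertices F \<union> vertices H) - {a},
      edges = edges (delete_vertex F a) + edges (delete_vertex H a) +
        mset_set {{v, w} | v w. {v, a} \<in># edges F \<and> {a, w} \<in># edges H},
      marks = (marks F \<union> marks H) - {a},
      alpha = (\<lambda>v. if v \<in> vertices F then alpha F v else alpha H v),
      beta = (\<lambda>v. if v \<in> vertices F then beta F v else beta H v),
      free_loops = free_loops F + free_loops H\<rparr>"

text \<open>
  The graphs \<open>H\<close> range over the vertex type of \<open>F\<close>; this loses nothing when that type is infinite.
\<close>

definition universal_weights ::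
    "'r::comm_ring_1 \<Rightarrow> 'r \<Rightarrow> 'r \<Rightarrow> ('v, 'r) wgraph \<Rightarrow> 'v \<Rightarrow> 'r \<Rightarrow> 'r \<Rightarrow> 'r \<Rightarrow> bool" where
  "universal_weights A B d F a \<alpha>a \<beta>a \<alpha>m \<longleftrightarrow>
     (\<forall>H. composable A B F H a \<and> (\<forall>w. {a, w} \<in># edges H \<longrightarrow> w \<notin> marks H) \<longrightarrow>
        bracket d (compose F H a) =
          bracket d (H\<lparr>alpha := (alpha H)(a := \<alpha>a), beta := (beta H)(a := \<beta>a)\<rparr>) +
          bracket d (H\<lparr>marks := insert a (marks H),
            alpha := (alpha H)(a := \<alpha>m), beta := (beta H)(a := 0)\<rparr>))"


section \<open>Virtual link diagrams\<close>

text \<open>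
  The closed curves are regular curves of period 1. \<open>over D x\<close> is the unit tangent vector
  of the overcrossing strand at the classical crossing \<open>x\<close>; all other crossings are virtual.
\<close>

record diagram =
  curves :: "(real \<Rightarrow> complex) list"
  classical :: "complex set"
  over :: "complex \<Rightarrow> complex"

definition regular_closed_curve :: "(real \<Rightarrow> complex) \<Rightarrow> bool" where
  "regular_closed_curve \<gamma> \<longleftrightarrow> \<gamma> C1_differentiable_on UNIV \<and>
     (\<forall>t. vector_derivative \<gamma> (at t) \<noteq> 0) \<and> (\<forall>t. \<gamma> (t + 1) = \<gamma> t)"

definition strand_points :: "diagram \<Rightarrow> (nat \<times> real) set" where
  "strand_points D = {(i, t). i < length (curves D) \<and> 0 \<le> t \<and> t < 1}"

definition position :: "diagram \<Rightarrow> nat \<times> real \<Rightarrow> complex" where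
  "position D = (\<lambda>(i, t). (curves D ! i) t)"

definition direction :: "diagram \<Rightarrow> nat \<times> real \<Rightarrow> complex" where
  "direction D = (\<lambda>(i, t). sgn (vector_derivative (curves D ! i) (at t)))"

definition image_of :: "diagram \<Rightarrow> complex set" where
  "image_of D = position D ` strand_points D"

definition crossings :: "diagram \<Rightarrow> complex set" where
  "crossings D = {x. \<exists>p\<in>strand_points D. \<exists>q\<in>strand_points D.
     p \<noteq> q \<and> position D p = x \<and> position D q = x}"

text \<open>\<open>Im (cnj u * v)\<close> is the determinant of the pair \<open>(u, v)\<close> of plane vectors.\<close>

definition link_diagram :: "diagram \<Rightarrow> bool" where
  "link_diagram D \<longleftrightarrow>
     (\<forall>\<gamma>\<in>set (curves D). regular_closed_curve \<gamma>) \<and>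
     finite (crossings D) \<and>
     (\<forall>x\<in>crossings D. \<exists>p q. p \<noteq> q \<and> {s \<in> strand_points D. position D s = x} = {p, q} \<and>
        Im (cnj (direction D p) * direction D q) \<noteq> 0) \<and>
     classical D \<subseteq> crossings D \<and>
     (\<forall>x\<in>classical D. over D x \<in> direction D ` {s \<in> strand_points D. position D s = x})"

text \<open>
  A crossing is positive if the overcrossing direction is turned counterclockwise, through
  less than a half-turn, to the undercrossing direction.
\<close>

definition positive_crossing :: "diagram \<Rightarrow> complex \<Rightarrow> bool" where
  "positive_crossing D x \<longleftrightarrow> x \<in> classical D \<and>
     (\<exists>s\<in>strand_points D. position D s = x \<and> Im (cnj (over D x) * direction D s) > 0)"

definition negative_crossing :: "diagram \<Rightarrow> complex \<Rightarrow> bool" where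
  "negative_crossing D x \<longleftrightarrow> x \<in> classical D \<and>
     (\<exists>s\<in>strand_points D. position D s = x \<and> Im (cnj (over D x) * direction D s) < 0)"


section \<open>The directed universe and Euler systems\<close>

text \<open>\<open>(i, s, t)\<close> stands for the \<open>i\<close>th curve, traversed from parameter \<open>s\<close> to parameter \<open>t\<close>.\<close>

type_synonym oriented_arc = "nat \<times> real \<times> real"

definition start :: "diagram \<Rightarrow> oriented_arc \<Rightarrow> complex" where
  "start D = (\<lambda>(i, s, t). (curves D ! i) s)"

definition finish :: "diagram \<Rightarrow> oriented_arc \<Rightarrow> complex" where
  "finish D = (\<lambda>(i, s, t). (curves D ! i) t)"

definition open_arc :: "diagram \<Rightarrow> oriented_arc \<Rightarrow> complex set" where
  "open_arc D = (\<lambda>(i, s, t). (curves D ! i) ` {s<..<t})"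

definition arc_path :: "diagram \<Rightarrow> oriented_arc \<Rightarrow> real \<Rightarrow> complex" where
  "arc_path D = (\<lambda>(i, s, t). subpath s t (curves D ! i))"

definition universe :: "diagram \<Rightarrow> (complex, oriented_arc) pre_digraph" where
  "universe D =
     \<lparr>verts = classical D,
      arcs = {e. (case e of (i, s, t) \<Rightarrow> i < length (curves D) \<and> 0 \<le> s \<and> s < 1 \<and> s < t) \<and>
        start D e \<in> classical D \<and> finish D e \<in> classical D \<and> open_arc D e \<inter> classical D = {}},
      tail = start D, head = finish D\<rparr>"

text \<open>
  The components of the undirected universe are the components having a vertex, given
  by their vertex sets, and the free loops, given by the indices of their curves.
\<close>

definition universe_components :: "diagram \<Rightarrow> complex set set" where
  "universe_components D = pre_digraph.sccs_verts (with_proj (mk_symmetric (universe D)))"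

definition universe_free_loops :: "diagram \<Rightarrow> nat set" where
  "universe_free_loops D =
     {i. i < length (curves D) \<and> range (curves D ! i) \<inter> classical D = {}}"

definition euler_circuit :: "diagram \<Rightarrow> complex set \<Rightarrow> oriented_arc list \<Rightarrow> bool" where
  "euler_circuit D K p \<longleftrightarrow> (\<exists>u. pre_digraph.euler_trail (universe D \<restriction> K) u p u)"

text \<open>The free loops belong to every Euler system and are left implicit.\<close>

definition euler_system :: "diagram \<Rightarrow> oriented_arc list set \<Rightarrow> bool" where
  "euler_system D C \<longleftrightarrow>
     (\<forall>p\<in>C. \<exists>K\<in>universe_components D. euler_circuit D K p) \<and>
     (\<forall>K\<in>universe_components D. \<exists>!p. p \<in> C \<and> euler_circuit D K p)"

text \<open>
  An arc ending at parameter \<open>t\<close> of curve \<open>i\<close> is followed along its link component by the arc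
  starting at parameter \<open>frac t\<close> of the same curve.
\<close>

definition follows_component :: "diagram \<Rightarrow> oriented_arc list set \<Rightarrow> complex \<Rightarrow> bool" where
  "follows_component D C x \<longleftrightarrow>
     (\<forall>p\<in>C. \<forall>k<length p. finish D (p ! k) = x \<longrightarrow>
        (case (p ! k, p ! (Suc k mod length p)) of
           ((i, s, t), (j, s', t')) \<Rightarrow> i = j \<and> frac t = s'))"

definition marked_crossing :: "diagram \<Rightarrow> oriented_arc list set \<Rightarrow> complex \<Rightarrow> bool" where
  "marked_crossing D C x \<longleftrightarrow> x \<in> classical D \<and> \<not> follows_component D C x"

definition interlaced :: "diagram \<Rightarrow> oriented_arc list set \<Rightarrow> complex \<Rightarrow> complex \<Rightarrow> bool" where
  "interlaced D C v w \<longleftrightarrow> v \<noteq> w \<and>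
     (\<exists>p\<in>C. \<exists>k. subseq [v, w, v, w] (rotate k (map (start D) p)))"

definition interlacement_graph ::
    "diagram \<Rightarrow> oriented_arc list set \<Rightarrow> (complex \<Rightarrow> 'r) \<Rightarrow> (complex \<Rightarrow> 'r) \<Rightarrow> (complex, 'r) wgraph" where
  "interlacement_graph D C \<alpha> \<beta> =
     \<lparr>vertices = classical D,
      edges = mset_set ({{v} | v. negative_crossing D v} \<union>
        {{v, w} | v w. v \<in> classical D \<and> w \<in> classical D \<and> interlaced D C v w}),
      marks = {v. marked_crossing D C v},
      alpha = \<alpha>, beta = \<beta>,
      free_loops = card (universe_components D) + card (universe_free_loops D) - 1\<rparr>"


section \<open>Tangles\<close>

text \<open>The tangle is the part of the diagram inside the circle \<open>sphere c r\<close>.\<close>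

definition tangle :: "diagram \<Rightarrow> complex \<Rightarrow> real \<Rightarrow> bool" where
  "tangle D c r \<longleftrightarrow> r > 0 \<and>
     card (sphere c r \<inter> image_of D) = 4 \<and> sphere c r \<inter> crossings D = {} \<and>
     (\<forall>s\<in>strand_points D. position D s \<in> sphere c r \<longrightarrow>
        inner (direction D s) (position D s - c) \<noteq> 0)"

definition cut_arc :: "diagram \<Rightarrow> complex set \<Rightarrow> oriented_arc \<Rightarrow> oriented_arc list" where
  "cut_arc D X = (\<lambda>(i, s, t).
     let us = sorted_list_of_set {u. s < u \<and> u < t \<and> (curves D ! i) u \<in> X}
     in map (\<lambda>(a, b). (i, a, b)) (zip (s # us) (us @ [t])))"

text \<open>
  The circuits of an Euler system, cut at the points of \<open>X\<close>. A circuit that is a free loop has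
  no vertex to begin at; it begins at a point of \<open>X\<close>.
\<close>

definition cut_circuits ::
    "diagram \<Rightarrow> oriented_arc list set \<Rightarrow> complex set \<Rightarrow> oriented_arc list set" where
  "cut_circuits D C X =
     (\<lambda>p. concat (map (cut_arc D X) p)) ` C \<union>
     {cut_arc D X (i, s, s + 1) | i s. i \<in> universe_free_loops D \<and> 0 \<le> s \<and> s < 1 \<and>
        (curves D ! i) s \<in> X}"

text \<open>A circuit reading, cyclically, \<open>C11 p1 C12 p2 C13 p3 C14 p4\<close>.\<close>

definition circuit_through_tangle ::
    "diagram \<Rightarrow> oriented_arc list set \<Rightarrow> complex \<Rightarrow> real \<Rightarrow>
     oriented_arc list \<Rightarrow> complex \<Rightarrow> oriented_arc list \<Rightarrow> complex \<Rightarrow>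
     oriented_arc list \<Rightarrow> complex \<Rightarrow> oriented_arc list \<Rightarrow> complex \<Rightarrow> bool" where
  "circuit_through_tangle D C c r C11 p1 C12 p2 C13 p3 C14 p4 \<longleftrightarrow>
     sphere c r \<inter> image_of D = {p1, p2, p3, p4} \<and>
     (\<exists>q\<in>cut_circuits D C (sphere c r). \<exists>k. rotate k q = C11 @ C12 @ C13 @ C14) \<and>
     C11 \<noteq> [] \<and> C12 \<noteq> [] \<and> C13 \<noteq> [] \<and> C14 \<noteq> [] \<and>
     finish D (last C11) = p1 \<and> finish D (last C12) = p2 \<and>
     finish D (last C13) = p3 \<and> finish D (last C14) = p4 \<and>
     (\<forall>e\<in>set C11 \<union> set C13. open_arc D e \<inter> cball c r = {}) \<and>
     (\<forall>e\<in>set C12 \<union> set C14. open_arc D e \<subseteq> ball c r)"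

definition visited :: "diagram \<Rightarrow> oriented_arc list \<Rightarrow> complex set" where
  "visited D q = {x \<in> classical D. \<exists>e\<in>set q. x = start D e \<or> x = finish D e}"

definition components_outside :: "diagram \<Rightarrow> complex \<Rightarrow> real \<Rightarrow> nat" where
  "components_outside D c r =
     card {K \<in> universe_components D.
       \<forall>e\<in>arcs (universe D \<restriction> K). arc_path D e ` {0..1} \<inter> cball c r = {}} +
     card {i \<in> universe_free_loops D. range (curves D ! i) \<inter> cball c r = {}}"

definition exterior_graph ::
    "'r \<Rightarrow> 'r \<Rightarrow> diagram \<Rightarrow> oriented_arc list set \<Rightarrow> (complex \<Rightarrow> 'r) \<Rightarrow> (complex \<Rightarrow> 'r) \<Rightarrow>
     complex \<Rightarrow> real \<Rightarrow> oriented_arc list \<Rightarrow> oriented_arc list \<Rightarrow> complex \<Rightarrow> (complex, 'r) wgraph" where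
  "exterior_graph A B D C \<alpha> \<beta> c r C11 C13 a =
     (let L = induced (interlacement_graph D C \<alpha> \<beta>) (- cball c r) in
      \<lparr>vertices = insert a (vertices L),
       edges = edges L + mset_set ((\<lambda>x. {a, x}) ` (visited D C11 \<inter> visited D C13)),
       marks = marks L,
       alpha = \<alpha>(a := A), beta = \<beta>(a := B),
       free_loops = components_outside D c r\<rparr>)"


section \<open>Replacing the tangle by a single crossing\<close>

text \<open>
  An oriented diagram is compared with another through its set of pairs of a point and a
  unit tangent vector there; this is insensitive to parametrization, to the numbering of the
  curves and to how the curves close up elsewhere.
\<close>

definition line_elements :: "diagram \<Rightarrow> (complex \<times> complex) set" where
  "line_elements D = (\<lambda>s. (position D s, direction D s)) ` strand_points D"

definition arc_inside ::
    "diagram \<Rightarrow> complex \<Rightarrow> real \<Rightarrow> complex \<Rightarrow> complex \<Rightarrow> oriented_arc \<Rightarrow> bool" where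
  "arc_inside D c r x y e \<longleftrightarrow>
     (case e of (i, s, t) \<Rightarrow> i < length (curves D) \<and> s < t) \<and>
     start D e = x \<and> finish D e = y \<and> open_arc D e \<subseteq> ball c r"

text \<open>
  \<open>D'\<close> is \<open>D\<close> with everything inside the circle replaced by an arc \<open>q1\<close> from \<open>p1\<close> to \<open>p2\<close> and an
  arc \<open>q2\<close> from \<open>p3\<close> to \<open>p4\<close>, which meet in one classical crossing \<open>v\<close> and at most one virtual
  crossing. Transversality leaves no choice about the latter: it is present exactly if the
  pairs of endpoints do not separate each other on the circle.
\<close>

definition tangle_replaced ::
    "diagram \<Rightarrow> complex \<Rightarrow> real \<Rightarrow> complex \<Rightarrow> complex \<Rightarrow> complex \<Rightarrow> complex \<Rightarrow>
     diagram \<Rightarrow> oriented_arc \<Rightarrow> oriented_arc \<Rightarrow> complex \<Rightarrow> bool" where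
  "tangle_replaced D c r p1 p2 p3 p4 D' q1 q2 v \<longleftrightarrow>
     link_diagram D' \<and>
     line_elements D' \<inter> (- ball c r) \<times> UNIV = line_elements D \<inter> (- ball c r) \<times> UNIV \<and>
     classical D' - ball c r = classical D - ball c r \<and>
     (\<forall>x\<in>classical D - ball c r. over D' x = over D x) \<and>
     arc_inside D' c r p1 p2 q1 \<and> arc_inside D' c r p3 p4 q2 \<and>
     image_of D' \<inter> ball c r = open_arc D' q1 \<union> open_arc D' q2 \<and>
     classical D' \<inter> ball c r = {v} \<and>
     crossings D' \<inter> ball c r \<subseteq> open_arc D' q1 \<inter> open_arc D' q2 \<and>
     card (crossings D' \<inter> ball c r - {v}) \<le> 1"

text \<open>Equality of oriented arcs up to reparametrization.\<close>

definition same_arc :: "(real \<Rightarrow> complex) \<Rightarrow> (real \<Rightarrow> complex) \<Rightarrow> bool" where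
  "same_arc g h \<longleftrightarrow> (\<exists>\<phi> :: real \<Rightarrow> real. strict_mono_on {0..1} \<phi> \<and> \<phi> ` {0..1} = {0..1} \<and>
     (\<forall>u\<in>{0..1}. g u = h (\<phi> u)))"

definition same_circuit :: "(real \<Rightarrow> complex) list \<Rightarrow> (real \<Rightarrow> complex) list \<Rightarrow> bool" where
  "same_circuit gs hs \<longleftrightarrow> (\<exists>k. list_all2 same_arc gs (rotate k hs))"

text \<open>
  \<open>C'\<close> is \<open>C\<close> with \<open>C12\<close> and \<open>C14\<close> replaced by \<open>q1\<close> and \<open>q2\<close>, the latter cut at the new crossing,
  and with the circuits inside the circle discarded.
\<close>

definition euler_system_replaced ::
    "diagram \<Rightarrow> oriented_arc list set \<Rightarrow> complex \<Rightarrow> real \<Rightarrow> oriented_arc list \<Rightarrow> oriented_arc list \<Rightarrow>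
     diagram \<Rightarrow> oriented_arc \<Rightarrow> oriented_arc \<Rightarrow> complex \<Rightarrow> oriented_arc list set \<Rightarrow> bool" where
  "euler_system_replaced D C c r C11 C13 D' q1 q2 v C' \<longleftrightarrow>
     euler_system D' C' \<and>
     (\<exists>p0\<in>C'.
        same_circuit
          (map (arc_path D) C11 @ map (arc_path D') (cut_arc D' {v} q1) @
           map (arc_path D) C13 @ map (arc_path D') (cut_arc D' {v} q2))
          (map (arc_path D') (concat (map (cut_arc D' (sphere c r)) p0))) \<and>
        (\<forall>p\<in>C. (\<forall>e\<in>set p. open_arc D e \<inter> cball c r = {}) \<longrightarrow>
           (\<exists>p'\<in>C' - {p0}. same_circuit (map (arc_path D) p) (map (arc_path D') p'))) \<and>
        (\<forall>p'\<in>C' - {p0}. \<exists>p\<in>C. (\<forall>e\<in>set p. open_arc D e \<inter> cball c r = {}) \<and>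
           same_circuit (map (arc_path D) p) (map (arc_path D') p')))"

end

theory Submission
  imports Defs
begin

text \<open>
  Composing \<open>F\<close> with a single vertex gives \<open>[F - a] = d \<alpha>(a) + \<beta>(a) + \<alpha>(a\<^sub>m)\<close>. Composing it with
  a single edge from \<open>a\<close> to a standard vertex, unlooped or looped, gives graphs isomorphic to \<open>F\<^sub>+\<close>
  and \<open>F\<^sub>-\<close>, hence two further linear equations; the three formulas solve this system once
  \<open>A\<^sup>2 - B\<^sup>2\<close> is invertible. The bracket is an isomorphism invariant because 2 to the nullity counts
  the vertex sets that represent kernel vectors over the field of two elements.

  To compare \<open>D\<close> with \<open>D\<^sub>+\<close> or \<open>D\<^sub>-\<close>, whose curves may be parametrised quite differently, an arc is
  replaced by its germ: its two end points together with the unit tangents there. Marks and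
  interlacement are read off the cyclic words of germs along the circuits. All circuits but the one
  that meets the tangle lie inside or outside it, and those outside occur in both diagrams; the main
  words differ only in the two pieces inside, so outside crossings keep their marks and interlacement,
  and the new crossing is interlaced with a crossing exactly if the latter lies on both outer pieces.
\<close>

text \<open>Two obstacles shape the comparison of diagrams. First, \<open>same_arc\<close> allows
  every increasing bijection of the parameter interval, differentiable or not, so derivatives cannot
  be carried across it. Only the direction of a tangent survives, as a limit of directions of
  secants. Little is lost in passing to germs: the two strands at a crossing are transverse, hence
  the initial half of a germ already determines an arc of the universe. Second, the circuit through
  the tangle may have no classical crossing at all. It is then a free loop of the universe and no
  member of \<open>C\<close>. Euler systems say nothing about free loops; these are matched between
  the diagrams by their sets of points and tangents.

  The polynomial 2 - d - d^2 comes from the elimination. With x, y, z for the weights, the sum of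
  the two edge equations is A + B times 2x + (1 + d)(y + z), and y + z is [F - a] - dx. The
  polynomial itself is not inverted, so it stays on the left.\<close>

unbundle no vec_syntax

section \<open>Nullity over the field of two elements\<close>

lemma UNIV_bit: "(UNIV :: bit set) = {0, 1}"
  using bit_not_zero_iff by blast

lemma of_nat_bit_eq_0_iff: "(of_nat n :: bit) = 0 \<longleftrightarrow> even n"
proof -
  have "even (of_nat n :: bit) \<longleftrightarrow> even n" by (rule even_of_nat_iff)
  then show ?thesis by (cases "(of_nat n :: bit) = 0") auto
qed

text \<open>Coordinates in a basis identify the kernel with the functions from the basis to a set of
  two elements.\<close>

lemma card_mat_kernel_bit:
  fixes A :: "bit mat"
  assumes A: "A \<in> carrier_mat nr nc"
  shows "card (mat_kernel A) = 2 ^ kernel_dim A"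
proof -
  interpret k: kernel nr nc A by unfold_locales (rule A)
  have "finite (carrier_vec nc :: bit vec set)"
  proof -
    have "carrier_vec nc \<subseteq> vec_of_list ` {l :: bit list. set l \<subseteq> UNIV \<and> length l = nc}"
    proof
      fix v :: "bit vec" assume "v \<in> carrier_vec nc"
      then have "v = vec_of_list (list_of_vec v)" "length (list_of_vec v) = nc"
        by (auto simp: vec_list)
      then show "v \<in> vec_of_list ` {l :: bit list. set l \<subseteq> UNIV \<and> length l = nc}" by blast
    qed
    then show ?thesis
      by (rule finite_subset) (rule finite_imageI[OF finite_lists_length_eq], simp add: UNIV_bit)
  qed
  then have fin: "finite (mat_kernel A)"
    using mat_kernel_carrier[OF A] finite_subset by blast
  \<comment> \<open>The finite kernel generates itself, so it is finite-dimensional.\<close>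
  have "k.Ker.span (mat_kernel A) = mat_kernel A"
    using k.Ker.in_own_span[of "mat_kernel A"] k.Ker.span_is_subset2[of "mat_kernel A"] by auto
  then have "k.Ker.fin_dim"
    unfolding k.Ker.fin_dim_def using fin by auto
  then obtain S where S: "finite S" "k.Ker.basis S"
    using k.Ker.finite_basis_exists by auto
  have sub: "S \<subseteq> mat_kernel A" using S(2) unfolding k.Ker.basis_def by auto
  have ex1: "\<exists>!a. a \<in> S \<rightarrow>\<^sub>E UNIV \<and> k.Ker.lincomb a S = v" if "v \<in> mat_kernel A" for v
    using k.Ker.basis_criterion[OF S(1)] sub S(2) that by auto
  have closed: "k.Ker.lincomb a S \<in> mat_kernel A" for a
    using k.Ker.lincomb_closed[of S a] sub by auto
  have "bij_betw (\<lambda>a. k.Ker.lincomb a S) (S \<rightarrow>\<^sub>E (UNIV :: bit set)) (mat_kernel A)"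
    unfolding bij_betw_def inj_on_def
    using ex1 closed by (auto simp: image_iff) metis+
  then have "card (mat_kernel A) = card (S \<rightarrow>\<^sub>E (UNIV :: bit set))"
    by (simp add: bij_betw_same_card)
  also have "\<dots> = 2 ^ card S"
    using S(1) by (simp add: card_PiE) (simp add: UNIV_bit numeral_2_eq_2)
  also have "card S = kernel_dim A"
    using k.Ker.dim_basis[OF S] by simp
  finally show ?thesis .
qed

text \<open>A vector over two elements is the indicator of its support, and an entry of its product
  with the matrix is the parity of the number of related vertices in the support. Described by such
  sets, the kernel no longer depends on the numbering chosen by \<open>vertex_list\<close>.\<close>

lemma card_kernel_of_relation:
  fixes M :: "bit mat"
  assumes M: "M \<in> carrier_mat n n" and k: "bij_betw k {..<n} K"
    and entries: "\<And>i j. i < n \<Longrightarrow> j < n \<Longrightarrow> M $$ (i, j) = of_bool (R (k i) (k j))"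
  shows "card {S. S \<subseteq> K \<and> (\<forall>v\<in>K. even (card {w\<in>S. R v w}))} = 2 ^ kernel_dim M"
proof -
  define f :: "_ \<Rightarrow> bit vec" where "f S = vec n (\<lambda>j. of_bool (k j \<in> S))" for S
  have K: "K = k ` {..<n}" and inj: "inj_on k {..<n}" using k by (auto simp: bij_betw_def)
  have ker: "(M *\<^sub>v f S) $ i = of_nat (card {w\<in>S. R (k i) w})" if "S \<subseteq> K" "i < n" for S i
  proof -
    have "(M *\<^sub>v f S) $ i = (\<Sum>j<n. M $$ (i, j) * of_bool (k j \<in> S))"
      using that M by (auto simp: f_def scalar_prod_def atLeast0LessThan)
    also have "\<dots> = (\<Sum>j<n. of_bool (R (k i) (k j) \<and> k j \<in> S))"
      using that by (intro sum.cong) (auto simp: entries)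
    also have "\<dots> = (\<Sum>w\<in>K. of_bool (R (k i) w \<and> w \<in> S))"
      unfolding K using inj by (subst sum.reindex) auto
    also have "\<dots> = of_nat (card {w\<in>K. R (k i) w \<and> w \<in> S})"
    proof -
      have "finite K" by (simp add: K)
      then show ?thesis by (subst sum_of_bool_eq) (auto simp: Int_def)
    qed
    also have "{w\<in>K. R (k i) w \<and> w \<in> S} = {w\<in>S. R (k i) w}" using that by auto
    finally show ?thesis .
  qed
  have zero: "M *\<^sub>v f S = 0\<^sub>v n \<longleftrightarrow> (\<forall>v\<in>K. even (card {w\<in>S. R v w}))" if "S \<subseteq> K" for S
  proof -
    have "M *\<^sub>v f S = 0\<^sub>v n \<longleftrightarrow> (\<forall>i<n. (M *\<^sub>v f S) $ i = 0)"
      using M by (auto simp: vec_eq_iff)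
    also have "\<dots> \<longleftrightarrow> (\<forall>i<n. even (card {w\<in>S. R (k i) w}))"
      using ker[OF that] by (simp add: of_nat_bit_eq_0_iff)
    finally show ?thesis by (auto simp: K)
  qed
  have "bij_betw f {S. S \<subseteq> K \<and> (\<forall>v\<in>K. even (card {w\<in>S. R v w}))} (mat_kernel M)"
  proof (rule bij_betw_byWitness[where f' = "\<lambda>x. k ` {j. j < n \<and> x $ j = 1}"])
    show "\<forall>S\<in>{S. S \<subseteq> K \<and> (\<forall>v\<in>K. even (card {w\<in>S. R v w}))}. k ` {j. j < n \<and> f S $ j = 1} = S"
      by (auto simp: f_def K)
    have ff: "f (k ` {j. j < n \<and> x $ j = 1}) = x" if "x \<in> mat_kernel M" for x
    proof (rule eq_vecI)
      have dim: "dim_vec x = n" using that M mat_kernelD(1)[OF M] by auto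
      then show "dim_vec (f (k ` {j. j < n \<and> x $ j = 1})) = dim_vec x" by (simp add: f_def)
      fix i assume i: "i < dim_vec x"
      have "k i \<in> k ` {j. j < n \<and> x $ j = 1} \<longleftrightarrow> x $ i = 1"
        using i dim inj by (auto simp: inj_on_def)
      then show "f (k ` {j. j < n \<and> x $ j = 1}) $ i = x $ i"
        using i dim by (auto simp: f_def)
    qed
    then show "\<forall>x\<in>mat_kernel M. f (k ` {j. j < n \<and> x $ j = 1}) = x" by blast
    show "f ` {S. S \<subseteq> K \<and> (\<forall>v\<in>K. even (card {w\<in>S. R v w}))} \<subseteq> mat_kernel M"
      using zero M by (auto simp: mat_kernel f_def)
    show "(\<lambda>x. k ` {j. j < n \<and> x $ j = 1}) ` mat_kernel M \<subseteq> {S. S \<subseteq> K \<and> (\<forall>v\<in>K. even (card {w\<in>S. R v w}))}"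
    proof (rule image_subsetI)
      fix x assume x: "x \<in> mat_kernel M"
      have sub: "k ` {j. j < n \<and> x $ j = 1} \<subseteq> K" by (auto simp: K)
      have "M *\<^sub>v f (k ` {j. j < n \<and> x $ j = 1}) = 0\<^sub>v n"
        using ff[OF x] x mat_kernelD(2)[OF M] by simp
      then show "k ` {j. j < n \<and> x $ j = 1} \<in> {S. S \<subseteq> K \<and> (\<forall>v\<in>K. even (card {w\<in>S. R v w}))}"
        using zero[OF sub] sub by simp
    qed
  qed
  then show ?thesis
    using card_mat_kernel_bit[OF M] by (simp add: bij_betw_same_card)
qed

section \<open>Nullities of state matrices through vertex sets\<close>

definition kept_vertices :: "('v, 'r) wgraph \<Rightarrow> 'v set \<Rightarrow> 'v set" where
  "kept_vertices G T = {v \<in> vertices G. v \<in> marks G \<longrightarrow> ({v} \<in># edges G) \<noteq> (v \<in> T)}"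

definition toggled_adjacent :: "('v, 'r) wgraph \<Rightarrow> 'v set \<Rightarrow> 'v \<Rightarrow> 'v \<Rightarrow> bool" where
  "toggled_adjacent G T v w \<longleftrightarrow> ({v, w} \<in># edges G) \<noteq> (v = w \<and> v \<in> T)"

text \<open>The supports of the kernel vectors of the state matrix.\<close>

definition kernel_sets :: "('v, 'r) wgraph \<Rightarrow> 'v set \<Rightarrow> 'v set set" where
  "kernel_sets G T = {S. S \<subseteq> kept_vertices G T \<and>
     (\<forall>v\<in>kept_vertices G T. even (card {w\<in>S. toggled_adjacent G T v w}))}"

lemma of_bool_add_bit: "(of_bool P + of_bool Q :: bit) = of_bool (P \<noteq> Q)"
  by (cases P; cases Q) simp_all

text \<open>\<open>submatrix\<close> numbers the kept indices by \<open>pick\<close>; followed by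
  the vertex list this numbers the kept vertices, and in that numbering the entries are given by
  \<open>toggled_adjacent\<close>.\<close>

lemma card_kernel_sets:
  assumes "finite (vertices G)"
  shows "card (kernel_sets G T) = 2 ^ kernel_dim (state_matrix G T)"
proof -
  define vs where "vs = vertex_list G"
  obtain us where "distinct us \<and> set us = vertices G"
    using finite_distinct_list[OF assms] by blast
  then have "distinct vs \<and> set vs = vertices G"
    unfolding vs_def vertex_list_def by (rule someI)
  then have vs: "distinct vs" "set vs = vertices G" by auto
  define M where "M = toggled_matrix G T"
  define keep where "keep = {i. i < length vs \<and> \<not> (vs ! i \<in> marks G \<and> M $$ (i, i) = 0)}"
  have entry: "M $$ (i, j) = of_bool (toggled_adjacent G T (vs ! i) (vs ! j))"
    if "i < length vs" "j < length vs" for i j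
    using that nth_eq_iff_index_eq[OF vs(1) that]
    by (auto simp: M_def toggled_matrix_def adjacency_matrix_def Let_def vs_def[symmetric]
        toggled_adjacent_def of_bool_add_bit simp del: add_bit_eq_xor)
  have sm: "state_matrix G T = submatrix M keep keep"
    by (simp add: state_matrix_def Let_def M_def keep_def vs_def)
  have dim: "dim_row M = length vs" "dim_col M = length vs"
    by (simp_all add: M_def toggled_matrix_def Let_def vs_def)
  have keep_eq: "{i. i < length vs \<and> i \<in> keep} = keep" by (auto simp: keep_def)
  have fin: "finite keep" by (simp add: keep_def)
  have pick_keep: "pick keep i \<in> keep" if "i < card keep" for i
    using pick_in_set_le[OF that] .
  have pick_bij: "bij_betw (pick keep) {..<card keep} keep"
  proof -
    have inj: "inj_on (pick keep) {..<card keep}"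
      by (rule inj_onI) (metis lessThan_iff linorder_neqE_nat order_less_irrefl pick_mono_le)
    moreover have "pick keep ` {..<card keep} \<subseteq> keep" using pick_keep by auto
    ultimately show ?thesis
      unfolding bij_betw_def using fin by (metis card_image card_lessThan card_subset_eq)
  qed
  have nth_bij: "bij_betw ((!) vs) keep (kept_vertices G T)"
    unfolding bij_betw_def
  proof
    show "inj_on ((!) vs) keep"
      using vs(1) by (auto simp: inj_on_def keep_def nth_eq_iff_index_eq)
    have kept_iff: "vs ! i \<in> kept_vertices G T \<longleftrightarrow> i \<in> keep" if "i < length vs" for i
      using that vs(2) nth_mem[OF that]
      by (auto simp: keep_def kept_vertices_def entry toggled_adjacent_def)
    have "kept_vertices G T \<subseteq> (!) vs ` {..<length vs}"
      using vs(2) by (auto simp: kept_vertices_def set_conv_nth)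
    then show "(!) vs ` keep = kept_vertices G T"
      using kept_iff by (auto simp: keep_def)
  qed
  show ?thesis
    unfolding kernel_sets_def
  proof (rule card_kernel_of_relation[where n = "card keep" and k = "(!) vs \<circ> pick keep"])
    show "state_matrix G T \<in> carrier_mat (card keep) (card keep)"
      unfolding sm by (rule carrier_matI) (simp_all add: dim_submatrix dim keep_eq)
    show "bij_betw ((!) vs \<circ> pick keep) {..<card keep} (kept_vertices G T)"
      using pick_bij nth_bij by (rule bij_betw_trans)
    fix i j assume ij: "i < card keep" "j < card keep"
    have lt: "pick keep i < length vs" "pick keep j < length vs"
      using pick_keep[OF ij(1)] pick_keep[OF ij(2)] unfolding keep_def by blast+
    have "submatrix M keep keep $$ (i, j) = M $$ (pick keep i, pick keep j)"
      by (rule submatrix_index) (use ij in \<open>simp_all add: dim keep_eq\<close>)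
    then show "state_matrix G T $$ (i, j) =
        of_bool (toggled_adjacent G T (((!) vs \<circ> pick keep) i) (((!) vs \<circ> pick keep) j))"
      by (simp add: sm entry lt)
  qed
qed

lemma kernel_dim_state_matrix:
  assumes "finite (vertices G)" "card (kernel_sets G T) = 2 ^ n"
  shows "kernel_dim (state_matrix G T) = n"
  using card_kernel_sets[OF assms(1), of T] assms(2) by simp

section \<open>Isomorphism invariance of the bracket\<close>

text \<open>Edges are compared by membership only, since the adjacency matrix ignores
  multiplicities; the case \<open>v = w\<close> compares loops.\<close>

definition graph_iso :: "('v \<Rightarrow> 'w) \<Rightarrow> ('v, 'r) wgraph \<Rightarrow> ('w, 'r) wgraph \<Rightarrow> bool" where
  "graph_iso f G H \<longleftrightarrow> bij_betw f (vertices G) (vertices H) \<and>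
     (\<forall>v\<in>vertices G. \<forall>w\<in>vertices G. {v, w} \<in># edges G \<longleftrightarrow> {f v, f w} \<in># edges H) \<and>
     (\<forall>v\<in>vertices G. (v \<in> marks G \<longleftrightarrow> f v \<in> marks H) \<and> alpha G v = alpha H (f v) \<and> beta G v = beta H (f v)) \<and>
     free_loops G = free_loops H"

lemma kernel_dim_graph_iso:
  assumes iso: "graph_iso f G H" and fin: "finite (vertices G)" and T: "T \<subseteq> vertices G"
  shows "kernel_dim (state_matrix G T) = kernel_dim (state_matrix H (f ` T))"
proof -
  have bij: "bij_betw f (vertices G) (vertices H)" using iso by (simp add: graph_iso_def)
  have inj: "inj_on f (vertices G)" using bij by (simp add: bij_betw_def)
  have finH: "finite (vertices H)" using bij fin bij_betw_finite by blast
  have fT: "f v \<in> f ` T \<longleftrightarrow> v \<in> T" if "v \<in> vertices G" for v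
    using that T inj by (auto simp: inj_on_def)
  have tadj: "toggled_adjacent G T v w = toggled_adjacent H (f ` T) (f v) (f w)"
    if "v \<in> vertices G" "w \<in> vertices G" for v w
  proof -
    have "f v = f w \<longleftrightarrow> v = w" using that inj by (auto simp: inj_on_def)
    then show ?thesis
      using that iso fT unfolding toggled_adjacent_def graph_iso_def by blast
  qed
  have loop: "{v} \<in># edges G \<longleftrightarrow> {f v} \<in># edges H" if "v \<in> vertices G" for v
    using iso that unfolding graph_iso_def by (metis insert_absorb2)
  have sub: "kept_vertices G T \<subseteq> vertices G" by (auto simp: kept_vertices_def)
  have kept_iff: "f v \<in> kept_vertices H (f ` T) \<longleftrightarrow> v \<in> kept_vertices G T" if "v \<in> vertices G" for v
    using iso that fT[OF that] loop[OF that] bij_betwE[OF bij]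
    unfolding kept_vertices_def graph_iso_def by auto
  have kept: "kept_vertices H (f ` T) = f ` kept_vertices G T"
  proof -
    have "kept_vertices H (f ` T) \<subseteq> f ` vertices G"
      using bij unfolding kept_vertices_def bij_betw_def by auto
    then show ?thesis
      using kept_iff sub by blast
  qed
  have injk: "inj_on f (kept_vertices G T)" using inj sub inj_on_subset by blast
  have even_iff: "even (card {w\<in>S. toggled_adjacent G T v w}) \<longleftrightarrow>
      even (card {w\<in>f ` S. toggled_adjacent H (f ` T) (f v) w})"
    if "v \<in> kept_vertices G T" "S \<subseteq> kept_vertices G T" for v S
  proof -
    have "{w\<in>f ` S. toggled_adjacent H (f ` T) (f v) w} = f ` {w\<in>S. toggled_adjacent G T v w}"
      using that sub tadj[of v] by (auto simp: subset_iff)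
    moreover have "inj_on f {w\<in>S. toggled_adjacent G T v w}"
      using inj that sub by (auto simp: inj_on_def subset_iff)
    ultimately show ?thesis by (simp add: card_image)
  qed
  have "bij_betw ((`) f) (kernel_sets G T) (kernel_sets H (f ` T))"
    unfolding bij_betw_def
  proof
    show "inj_on ((`) f) (kernel_sets G T)"
      by (rule inj_on_subset[OF inj_on_image_Pow[OF injk]]) (auto simp: kernel_sets_def)
    have mem: "f ` S \<in> kernel_sets H (f ` T) \<longleftrightarrow> S \<in> kernel_sets G T" if "S \<subseteq> kept_vertices G T" for S
      using even_iff[OF _ that] that unfolding kernel_sets_def kept by (simp add: image_mono)
    have "\<exists>S'\<in>kernel_sets G T. S = f ` S'" if S: "S \<in> kernel_sets H (f ` T)" for S
    proof -
      obtain S' where "S' \<subseteq> kept_vertices G T" "S = f ` S'"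
        using S unfolding kernel_sets_def kept by (auto simp: subset_image_iff)
      then show ?thesis using mem S by blast
    qed
    moreover have "f ` S \<in> kernel_sets H (f ` T)" if "S \<in> kernel_sets G T" for S
      using mem[of S] that by (simp add: kernel_sets_def)
    ultimately show "(`) f ` kernel_sets G T = kernel_sets H (f ` T)" by blast
  qed
  then have "card (kernel_sets G T) = card (kernel_sets H (f ` T))"
    by (rule bij_betw_same_card)
  then show ?thesis
    using card_kernel_sets[OF fin, of T] card_kernel_sets[OF finH, of "f ` T"] by simp
qed

lemma bracket_graph_iso:
  assumes iso: "graph_iso f G H" and fin: "finite (vertices G)"
  shows "bracket d G = bracket d H"
proof -
  have bij: "bij_betw f (vertices G) (vertices H)" using iso by (simp add: graph_iso_def)
  then have inj: "inj_on f (vertices G)" and im: "f ` vertices G = vertices H"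
    by (auto simp: bij_betw_def)
  have bijP: "bij_betw ((`) f) (Pow (vertices G)) (Pow (vertices H))"
    using bij by (rule bij_betw_Pow)
  have w: "alpha G v = alpha H (f v)" "beta G v = beta H (f v)" if "v \<in> vertices G" for v
    using iso that by (auto simp: graph_iso_def)
  have "(\<Sum>T\<in>Pow (vertices G). (\<Prod>v\<in>vertices G - T. alpha G v) * (\<Prod>t\<in>T. beta G t) *
        d ^ kernel_dim (state_matrix G T)) =
      (\<Sum>T\<in>Pow (vertices G). (\<Prod>v\<in>vertices H - f ` T. alpha H v) * (\<Prod>t\<in>f ` T. beta H t) *
        d ^ kernel_dim (state_matrix H (f ` T)))"
  proof (rule sum.cong[OF refl])
    fix T assume "T \<in> Pow (vertices G)"
    then have T: "T \<subseteq> vertices G" by simp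
    have "vertices H - f ` T = f ` (vertices G - T)"
      using im inj T by (metis inj_on_image_set_diff Diff_subset order_refl)
    then have "(\<Prod>v\<in>vertices H - f ` T. alpha H v) = (\<Prod>v\<in>vertices G - T. alpha H (f v))"
      using inj by (simp add: prod.reindex inj_on_subset[OF inj])
    also have "\<dots> = (\<Prod>v\<in>vertices G - T. alpha G v)"
      using w by (intro prod.cong) auto
    finally have a: "(\<Prod>v\<in>vertices H - f ` T. alpha H v) = (\<Prod>v\<in>vertices G - T. alpha G v)" .
    have "(\<Prod>t\<in>f ` T. beta H t) = (\<Prod>t\<in>T. beta H (f t))"
      using inj_on_subset[OF inj T] by (simp add: prod.reindex)
    also have "\<dots> = (\<Prod>t\<in>T. beta G t)"
      using w T by (intro prod.cong) auto
    finally show "(\<Prod>v\<in>vertices G - T. alpha G v) * (\<Prod>t\<in>T. beta G t) * d ^ kernel_dim (state_matrix G T) =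
      (\<Prod>v\<in>vertices H - f ` T. alpha H v) * (\<Prod>t\<in>f ` T. beta H t) * d ^ kernel_dim (state_matrix H (f ` T))"
      using a kernel_dim_graph_iso[OF iso fin T] by simp
  qed
  also have "\<dots> = (\<Sum>T\<in>Pow (vertices H). (\<Prod>v\<in>vertices H - T. alpha H v) * (\<Prod>t\<in>T. beta H t) *
        d ^ kernel_dim (state_matrix H T))"
    by (rule sum.reindex_bij_betw[OF bijP])
  finally show ?thesis
    using iso by (simp add: bracket_def graph_iso_def)
qed

section \<open>Brackets of graphs with one or two vertices\<close>

lemma Collect_mem_insert_conj:
  "{x \<in> insert a A. P x} = (if P a then insert a {x \<in> A. P x} else {x \<in> A. P x})"
  by auto

lemma kernel_sets_eq:
  "kernel_sets G T = {S \<in> Pow (kept_vertices G T).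
     \<forall>v\<in>kept_vertices G T. even (card {w\<in>S. toggled_adjacent G T v w})}"
  by (auto simp: kernel_sets_def)

text \<open>In the state without \<open>a\<close> the matrix is a single 0, of nullity 1, unless
  \<open>a\<close> is marked: then its row is removed and the empty matrix has nullity 0. In the
  other state the entry is 1.\<close>

lemma bracket_singleton:
  assumes V: "vertices G = {a}" and E: "{a} \<notin># edges G"
  shows "bracket d G = d ^ free_loops G *
    (if a \<in> marks G then alpha G a + beta G a else alpha G a * d + beta G a)"
proof -
  have k: "kept_vertices G T = (if a \<in> marks G \<and> a \<notin> T then {} else {a})" for T
    using E by (auto simp: kept_vertices_def V)
  have "card (kernel_sets G {}) = 2 ^ (if a \<in> marks G then 0 else 1)"
    using E by (simp add: kernel_sets_eq k Pow_insert Collect_mem_insert_conj toggled_adjacent_def del: Pow_iff insert_iff; auto)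
  then have d0: "kernel_dim (state_matrix G {}) = (if a \<in> marks G then 0 else 1)"
    by (intro kernel_dim_state_matrix) (simp_all add: V)
  have "card (kernel_sets G {a}) = 2 ^ 0"
    using E by (simp add: kernel_sets_eq k Pow_insert Collect_mem_insert_conj toggled_adjacent_def del: Pow_iff insert_iff; auto)
  then have d1: "kernel_dim (state_matrix G {a}) = 0"
    by (intro kernel_dim_state_matrix) (simp_all add: V)
  show ?thesis
    by (simp add: bracket_def V Pow_insert d0 d1 add.commute)
qed

text \<open>With both rows present the off-diagonal entries are 1, and the matrix is singular
  exactly when both diagonal entries are 1. With the row of \<open>a\<close> removed, the entry at
  \<open>v\<close> alone decides. In the marked cases \<open>beta G a = 0\<close> leaves only the
  states without \<open>a\<close>, and in these its row is removed.\<close>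

lemma bracket_edge:
  fixes G :: "('v, 'r::comm_ring_1) wgraph"
  assumes V: "vertices G = {a, v}" "a \<noteq> v" and E: "{a} \<notin># edges G" "{a, v} \<in># edges G"
    and M: "v \<notin> marks G" and L: "free_loops G = 0"
    and W: "alpha G v = A" "beta G v = B"
  shows "a \<notin> marks G \<Longrightarrow> {v} \<notin># edges G \<Longrightarrow> bracket d G = (A + B) * alpha G a + (A + B * d) * beta G a"
    and "a \<notin> marks G \<Longrightarrow> {v} \<in># edges G \<Longrightarrow> bracket d G = (A + B) * alpha G a + (A * d + B) * beta G a"
    and "a \<in> marks G \<Longrightarrow> {v} \<notin># edges G \<Longrightarrow> beta G a = 0 \<Longrightarrow> bracket d G = (A * d + B) * alpha G a"
    and "a \<in> marks G \<Longrightarrow> {v} \<in># edges G \<Longrightarrow> beta G a = 0 \<Longrightarrow> bracket d G = (A + B * d) * alpha G a"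
proof -
  have sw: "{v, a} \<in># edges G" using E(2) by (simp add: insert_commute)
  have k: "kept_vertices G T = (if a \<in> marks G \<and> a \<notin> T then {v} else {a, v})" for T
    using E M V(2) by (auto simp: kept_vertices_def V)
  \<comment> \<open>The family of kernel sets is expanded member by member; \<open>Pow_iff\<close>
    and \<open>insert_iff\<close> are switched off below because they would turn the explicit
    families back into predicates.\<close>
  note s = kernel_sets_eq k Pow_insert Collect_mem_insert_conj toggled_adjacent_def
  have dim: "kernel_dim (state_matrix G T) = n" if "card (kernel_sets G T) = 2 ^ n" for T n
    by (rule kernel_dim_state_matrix[OF _ that]) (simp add: V)
  have u: "kernel_dim (state_matrix G {}) = 0" "kernel_dim (state_matrix G {a}) = (if {v} \<in># edges G then 1 else 0)"
    "kernel_dim (state_matrix G {v}) = 0" "kernel_dim (state_matrix G {a, v}) = (if {v} \<in># edges G then 0 else 1)"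
    if "a \<notin> marks G"
    using that V(2) E sw by (intro dim; cases "{v} \<in># edges G"; simp add: s del: Pow_iff insert_iff; simp add: doubleton_eq_iff)+
  have m: "kernel_dim (state_matrix G {}) = (if {v} \<in># edges G then 0 else 1)"
    "kernel_dim (state_matrix G {v}) = (if {v} \<in># edges G then 1 else 0)"
    if "a \<in> marks G"
    using that V(2) E sw by (intro dim; cases "{v} \<in># edges G"; simp add: s del: Pow_iff insert_iff; simp add: doubleton_eq_iff)+
  have eqs: "{a, v} - {} = {a, v}" "{a, v} - {a} = {v}" "{a, v} - {v} = {a}" "{a, v} - {a, v} = {}"
    using V(2) by auto
  have sum: "bracket d G = alpha G a * A * d ^ kernel_dim (state_matrix G {}) +
      alpha G a * B * d ^ kernel_dim (state_matrix G {v}) +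
      beta G a * A * d ^ kernel_dim (state_matrix G {a}) +
      beta G a * B * d ^ kernel_dim (state_matrix G {a, v})"
    using V(2) W L unfolding bracket_def V(1)
    by (simp only: Pow_insert Pow_empty image_insert image_empty) (simp add: eqs doubleton_eq_iff insert_commute algebra_simps)
  show "a \<notin> marks G \<Longrightarrow> {v} \<notin># edges G \<Longrightarrow> bracket d G = (A + B) * alpha G a + (A + B * d) * beta G a"
    and "a \<notin> marks G \<Longrightarrow> {v} \<in># edges G \<Longrightarrow> bracket d G = (A + B) * alpha G a + (A * d + B) * beta G a"
    and "a \<in> marks G \<Longrightarrow> {v} \<notin># edges G \<Longrightarrow> beta G a = 0 \<Longrightarrow> bracket d G = (A * d + B) * alpha G a"
    and "a \<in> marks G \<Longrightarrow> {v} \<in># edges G \<Longrightarrow> beta G a = 0 \<Longrightarrow> bracket d G = (A + B * d) * alpha G a"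
    unfolding sum by (simp_all add: u m algebra_simps)
qed

section \<open>Linear equations for universal weights\<close>

text \<open>Composition with this graph puts \<open>v\<close>, with standard weights, in the place
  of \<open>a\<close>: \<open>v\<close> is joined to the neighbours of \<open>a\<close> and is
  looped on demand. The loop will record that the new crossing is negative.\<close>

definition dipole :: "'r \<Rightarrow> 'r \<Rightarrow> 'v \<Rightarrow> 'v \<Rightarrow> bool \<Rightarrow> ('v, 'r) wgraph" where
  "dipole A B a v looped = \<lparr>vertices = {a, v}, edges = {#{a, v}#} + (if looped then {#{v}#} else {#}),
     marks = {}, alpha = (\<lambda>_. A), beta = (\<lambda>_. B), free_loops = 0\<rparr>"

lemma composable_dipole:
  assumes "wf_wgraph F" "standard_vertex A B F a" "v \<notin> vertices F"
  shows "composable A B F (dipole A B a v looped) a"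
  using assms by (auto simp: composable_def wf_wgraph_def dipole_def standard_vertex_def doubleton_eq_iff)

text \<open>The only neighbour of \<open>a\<close> in the dipole is unmarked, so the defining
  property of universal weights applies. Both brackets on its right-hand side belong to graphs with
  one edge between two vertices and are linear in the unknown weights.\<close>

lemma dipole_equations:
  fixes A B d :: "'r::comm_ring_1"
  assumes U: "universal_weights A B d F a x y z" and F: "wf_wgraph F" "standard_vertex A B F a"
    and v: "v \<notin> vertices F"
  shows "bracket d (compose F (dipole A B a v False) a) = (A + B) * x + (A + B * d) * y + (A * d + B) * z"
    and "bracket d (compose F (dipole A B a v True) a) = (A + B) * x + (A * d + B) * y + (A + B * d) * z"
proof -
  have av: "a \<noteq> v" using F v by (auto simp: standard_vertex_def)
  have eq: "bracket d (compose F (dipole A B a v l) a) =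
      bracket d ((dipole A B a v l)\<lparr>alpha := (alpha (dipole A B a v l))(a := x), beta := (beta (dipole A B a v l))(a := y)\<rparr>) +
      bracket d ((dipole A B a v l)\<lparr>marks := insert a (marks (dipole A B a v l)),
            alpha := (alpha (dipole A B a v l))(a := z), beta := (beta (dipole A B a v l))(a := 0)\<rparr>)" for l
    using U composable_dipole[OF F v, of l] unfolding universal_weights_def by (auto simp: dipole_def)
  show "bracket d (compose F (dipole A B a v False) a) = (A + B) * x + (A + B * d) * y + (A * d + B) * z"
    unfolding eq by (subst bracket_edge(1)[of _ a v A B], auto simp: dipole_def av av[symmetric] doubleton_eq_iff)
      (subst bracket_edge(3)[of _ a v A B], auto simp: dipole_def av av[symmetric] doubleton_eq_iff)
  show "bracket d (compose F (dipole A B a v True) a) = (A + B) * x + (A * d + B) * y + (A + B * d) * z"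
    unfolding eq by (subst bracket_edge(2)[of _ a v A B], auto simp: dipole_def av av[symmetric] doubleton_eq_iff)
      (subst bracket_edge(4)[of _ a v A B], auto simp: dipole_def av av[symmetric] doubleton_eq_iff)
qed

lemma delete_vertex_equation:
  fixes A B d :: "'r::comm_ring_1"
  assumes U: "universal_weights A B d F a x y z" and F: "wf_wgraph F" "standard_vertex A B F a"
  shows "bracket d (delete_vertex F a) = d * x + y + z"
proof -
  \<comment> \<open>An isolated \<open>a\<close> has no neighbours to pass on, so composing with it
    merely deletes \<open>a\<close> from \<open>F\<close>.\<close>
  define H where "H = \<lparr>vertices = {a}, edges = {#}, marks = {}, alpha = (\<lambda>_. A), beta = (\<lambda>_. B), free_loops = 0\<rparr>"
  have "composable A B F H a"
    using F by (auto simp: composable_def wf_wgraph_def H_def standard_vertex_def)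
  then have "bracket d (compose F H a) =
      bracket d (H\<lparr>alpha := (alpha H)(a := x), beta := (beta H)(a := y)\<rparr>) +
      bracket d (H\<lparr>marks := insert a (marks H), alpha := (alpha H)(a := z), beta := (beta H)(a := 0)\<rparr>)"
    using U unfolding universal_weights_def by (auto simp: H_def)
  also have "\<dots> = d * x + y + z"
    by (subst (1 2) bracket_singleton[where a = a]) (auto simp: H_def mult.commute)
  finally have eq: "bracket d (compose F H a) = d * x + y + z" .
  have "graph_iso id (delete_vertex F a) (compose F H a)"
    by (auto simp: graph_iso_def delete_vertex_def induced_def compose_def H_def bij_betw_def)
  then have "bracket d (delete_vertex F a) = bracket d (compose F H a)"
    by (rule bracket_graph_iso) (use F in \<open>auto simp: wf_wgraph_def delete_vertex_def induced_def\<close>)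
  then show ?thesis using eq by simp
qed

section \<open>Solving the equations in the localization\<close>

text \<open>An inverse \<open>w\<close> of the denominator is what makes the description in
  \<open>quot\<close> have a unique solution.\<close>

lemma quot_eq:
  assumes "z * y = x" "y * w = 1"
  shows "quot x y = z"
  unfolding quot_def
proof (rule the_equality)
  show "z * y = x" by fact
  fix z' assume "z' * y = x"
  then have "z' * y * w = z * y * w" using assms by simp
  then show "z' = z" using assms(2) by (simp add: mult.assoc)
qed

text \<open>The numerators are chosen so that the denominators divide them: the first quotient is 2x
  + (1 + d)(y + z), the second is (2 - d - d^2)y - \<open>b0\<close> and the third (2 - d - d^2)z -
  \<open>b0\<close>.\<close>

lemma solve_equations:
  fixes A B d x y z :: "'r::comm_ring_1" and \<iota> :: "'r \<Rightarrow> 's::comm_ring_1"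
  assumes loc: "is_localization \<iota> (A\<^sup>2 - B\<^sup>2)"
    and b0: "b0 = d * x + y + z"
    and bp: "bp = (A + B) * x + (A + B * d) * y + (A * d + B) * z"
    and bm: "bm = (A + B) * x + (A * d + B) * y + (A + B * d) * z"
  shows
    "(2 - \<iota> d - (\<iota> d)\<^sup>2) * \<iota> x = - (\<iota> d + 1) * \<iota> b0 + quot (\<iota> bp + \<iota> bm) (\<iota> A + \<iota> B)"
    "(2 - \<iota> d - (\<iota> d)\<^sup>2) * \<iota> y = \<iota> b0 +
       quot ((\<iota> A + \<iota> B + \<iota> B * \<iota> d) * \<iota> bp - (\<iota> A + \<iota> A * \<iota> d + \<iota> B) * \<iota> bm) ((\<iota> A)\<^sup>2 - (\<iota> B)\<^sup>2)"
    "(2 - \<iota> d - (\<iota> d)\<^sup>2) * \<iota> z = \<iota> b0 +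
       quot ((\<iota> A + \<iota> B + \<iota> B * \<iota> d) * \<iota> bm - (\<iota> A + \<iota> A * \<iota> d + \<iota> B) * \<iota> bp) ((\<iota> A)\<^sup>2 - (\<iota> B)\<^sup>2)"
proof -
  have add: "\<iota> (p + q) = \<iota> p + \<iota> q" and mul: "\<iota> (p * q) = \<iota> p * \<iota> q" for p q
    using loc by (auto simp: is_localization_def)
  have "\<iota> (A\<^sup>2 - B\<^sup>2) + \<iota> (B\<^sup>2) = \<iota> (A\<^sup>2)" by (simp flip: add)
  then have sq: "\<iota> (A\<^sup>2 - B\<^sup>2) = (\<iota> A)\<^sup>2 - (\<iota> B)\<^sup>2"
    by (simp add: mul power2_eq_square algebra_simps)
  obtain w where w: "((\<iota> A)\<^sup>2 - (\<iota> B)\<^sup>2) * w = 1"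
    using loc unfolding is_localization_def sq by blast
  \<comment> \<open>A + B divides the inverted element, so it is a unit too.\<close>
  have w': "(\<iota> A + \<iota> B) * ((\<iota> A - \<iota> B) * w) = 1"
    using w by (simp add: power2_eq_square algebra_simps)
  have q1: "quot (\<iota> bp + \<iota> bm) (\<iota> A + \<iota> B) = 2 * \<iota> x + (1 + \<iota> d) * (\<iota> y + \<iota> z)"
    by (rule quot_eq[OF _ w']) (simp add: bp bm add mul algebra_simps)
  have q2: "quot ((\<iota> A + \<iota> B + \<iota> B * \<iota> d) * \<iota> bp - (\<iota> A + \<iota> A * \<iota> d + \<iota> B) * \<iota> bm) ((\<iota> A)\<^sup>2 - (\<iota> B)\<^sup>2) =
      - \<iota> d * \<iota> x + (1 - \<iota> d - (\<iota> d)\<^sup>2) * \<iota> y - \<iota> z"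
    by (rule quot_eq[OF _ w]) (simp add: bp bm add mul algebra_simps power2_eq_square)
  have q3: "quot ((\<iota> A + \<iota> B + \<iota> B * \<iota> d) * \<iota> bm - (\<iota> A + \<iota> A * \<iota> d + \<iota> B) * \<iota> bp) ((\<iota> A)\<^sup>2 - (\<iota> B)\<^sup>2) =
      - \<iota> d * \<iota> x + (1 - \<iota> d - (\<iota> d)\<^sup>2) * \<iota> z - \<iota> y"
    by (rule quot_eq[OF _ w]) (simp add: bp bm add mul algebra_simps power2_eq_square)
  show "(2 - \<iota> d - (\<iota> d)\<^sup>2) * \<iota> x = - (\<iota> d + 1) * \<iota> b0 + quot (\<iota> bp + \<iota> bm) (\<iota> A + \<iota> B)"
    "(2 - \<iota> d - (\<iota> d)\<^sup>2) * \<iota> y = \<iota> b0 +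
       quot ((\<iota> A + \<iota> B + \<iota> B * \<iota> d) * \<iota> bp - (\<iota> A + \<iota> A * \<iota> d + \<iota> B) * \<iota> bm) ((\<iota> A)\<^sup>2 - (\<iota> B)\<^sup>2)"
    "(2 - \<iota> d - (\<iota> d)\<^sup>2) * \<iota> z = \<iota> b0 +
       quot ((\<iota> A + \<iota> B + \<iota> B * \<iota> d) * \<iota> bm - (\<iota> A + \<iota> A * \<iota> d + \<iota> B) * \<iota> bp) ((\<iota> A)\<^sup>2 - (\<iota> B)\<^sup>2)"
    unfolding q1 q2 q3 by (simp_all add: b0 add mul algebra_simps power2_eq_square)
qed

section \<open>Cyclic words\<close>

definition adjacent_pairs :: "'a list \<Rightarrow> ('a \<times> 'a) set" where
  "adjacent_pairs xs = set (zip xs (tl xs))"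

text \<open>A word of one letter gets the pair of that letter with itself, in agreement with the
  indices modulo the length in \<open>follows_component\<close>.\<close>

definition cyclic_pairs :: "'a list \<Rightarrow> ('a \<times> 'a) set" where
  "cyclic_pairs xs = (if xs = [] then {} else insert (last xs, hd xs) (adjacent_pairs xs))"

lemma adjacent_pairs_simps [simp]:
  "adjacent_pairs [] = {}" "adjacent_pairs [x] = {}"
  "adjacent_pairs (x # y # xs) = insert (x, y) (adjacent_pairs (y # xs))"
  by (simp_all add: adjacent_pairs_def)

lemma adjacent_pairs_Cons:
  "adjacent_pairs (x # xs) = (if xs = [] then {} else insert (x, hd xs) (adjacent_pairs xs))"
  by (cases xs) auto

lemma adjacent_pairs_append:
  "adjacent_pairs (xs @ ys) = adjacent_pairs xs \<union> adjacent_pairs ys \<union>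
     (if xs = [] \<or> ys = [] then {} else {(last xs, hd ys)})"
  by (induction xs) (auto simp: adjacent_pairs_Cons)

lemma adjacent_pairs_mem: "(x, y) \<in> adjacent_pairs xs \<Longrightarrow> x \<in> set xs \<and> y \<in> set xs"
  by (induction xs) (auto simp: adjacent_pairs_Cons split: if_splits)

lemma cyclic_pairs_mem: "(x, y) \<in> cyclic_pairs xs \<Longrightarrow> x \<in> set xs \<and> y \<in> set xs"
  using adjacent_pairs_mem[of x y xs] by (auto simp: cyclic_pairs_def split: if_splits)

lemma cyclic_pairs_append_commute: "cyclic_pairs (xs @ ys) = cyclic_pairs (ys @ xs)"
  by (auto simp: cyclic_pairs_def adjacent_pairs_append)

lemma cyclic_pairs_rotate [simp]: "cyclic_pairs (rotate k xs) = cyclic_pairs xs"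
  by (metis append_take_drop_id cyclic_pairs_append_commute rotate_drop_take)

lemma cyclic_pairs_nth:
  "cyclic_pairs xs = {(xs ! k, xs ! (Suc k mod length xs)) | k. k < length xs}"
proof (cases "xs = []")
  case False
  have adj: "adjacent_pairs xs = {(xs ! k, xs ! Suc k) | k. Suc k < length xs}"
    unfolding adjacent_pairs_def set_zip by (auto simp: nth_tl)
  have len: "Suc (length xs - 1) = length xs" using False by (simp add: Suc_pred)
  have "(xs ! k, xs ! (Suc k mod length xs)) \<in> cyclic_pairs xs" if "k < length xs" for k
  proof (cases "Suc k = length xs")
    case True
    then have "k = length xs - 1" by simp
    then show ?thesis using False len by (simp add: cyclic_pairs_def last_conv_nth hd_conv_nth)
  next
    case False
    then have "Suc k < length xs" using that by simp
    then show ?thesis by (auto simp: cyclic_pairs_def adj)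
  qed
  moreover have "\<exists>k<length xs. p = (xs ! k, xs ! (Suc k mod length xs))" if p: "p \<in> cyclic_pairs xs" for p
  proof -
    have "cyclic_pairs xs = insert (last xs, hd xs) {(xs ! k, xs ! Suc k) | k. Suc k < length xs}"
      using False by (simp add: cyclic_pairs_def adj)
    then consider "p = (last xs, hd xs)" | k where "Suc k < length xs" "p = (xs ! k, xs ! Suc k)"
      using p by blast
    then show ?thesis
    proof cases
      case 1
      then show ?thesis using False len
        by (intro exI[of _ "length xs - 1"]) (simp add: last_conv_nth hd_conv_nth)
    next
      case 2
      then show ?thesis by (intro exI[of _ k]) simp
    qed
  qed
  ultimately show ?thesis by (intro subset_antisym subsetI) blast+
qed (simp add: cyclic_pairs_def)

lemma adjacent_pairs_map: "adjacent_pairs (map f xs) = map_prod f f ` adjacent_pairs xs"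
  by (induction xs) (auto simp: adjacent_pairs_Cons hd_map)

lemma cyclic_pairs_map: "cyclic_pairs (map f xs) = map_prod f f ` cyclic_pairs xs"
  by (auto simp: cyclic_pairs_def adjacent_pairs_map hd_map last_map)

text \<open>An empty block would make its two neighbours adjacent, hence the assumption. The pairs
  at the seams come from pairs of consecutive blocks.\<close>

lemma adjacent_pairs_concat:
  assumes "\<And>xs. xs \<in> set xss \<Longrightarrow> xs \<noteq> []"
  shows "adjacent_pairs (concat xss) =
    (\<Union>xs\<in>set xss. adjacent_pairs xs) \<union> (\<lambda>(xs, ys). (last xs, hd ys)) ` adjacent_pairs xss"
  using assms
proof (induction xss)
  case (Cons xs xss)
  have "concat xss = [] \<longleftrightarrow> xss = []" using Cons.prems by (cases xss) auto
  moreover have "hd (concat xss) = hd (hd xss)" if "xss \<noteq> []"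
    using that Cons.prems by (cases xss) auto
  ultimately show ?case
    using Cons by (auto simp: adjacent_pairs_append adjacent_pairs_Cons)
qed simp

lemma cyclic_pairs_concat:
  assumes "\<And>xs. xs \<in> set xss \<Longrightarrow> xs \<noteq> []"
  shows "cyclic_pairs (concat xss) =
    (\<Union>xs\<in>set xss. adjacent_pairs xs) \<union> (\<lambda>(xs, ys). (last xs, hd ys)) ` cyclic_pairs xss"
proof (cases "xss = []")
  case False
  then have "concat xss \<noteq> []" "hd (concat xss) = hd (hd xss)"
    using assms by (cases xss; auto)+
  moreover have "last (concat xss) = last (last xss)"
    using False assms by (cases xss rule: rev_cases) auto
  ultimately show ?thesis
    using False by (auto simp: cyclic_pairs_def adjacent_pairs_concat[OF assms])
qed (simp add: cyclic_pairs_def)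

section \<open>Alternation of two letters in a cyclic word\<close>

definition alternate :: "'a \<Rightarrow> 'a \<Rightarrow> 'a list \<Rightarrow> bool" where
  "alternate v w xs \<longleftrightarrow> (\<exists>k. subseq [v, w, v, w] (rotate k xs))"

lemma alternate_iff: "alternate v w xs \<longleftrightarrow> (\<exists>a b. xs = a @ b \<and> subseq [v, w, v, w] (b @ a))"
  unfolding alternate_def
  by (metis append_take_drop_id rotate_append rotate_drop_take)

lemma alternate_rotate [simp]: "alternate v w (rotate k xs) \<longleftrightarrow> alternate v w xs"
proof
  show "alternate v w (rotate k xs) \<Longrightarrow> alternate v w xs"
    unfolding alternate_def by (auto simp: rotate_rotate)
  assume "alternate v w xs"
  then obtain j where j: "subseq [v, w, v, w] (rotate j xs)" by (auto simp: alternate_def)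
  \<comment> \<open>\<open>length xs * k\<close> is a whole number of turns and at least
    \<open>k\<close> for a nonempty word, so the rotation by \<open>k\<close> can be completed to
    the identity.\<close>
  have "xs = rotate (length xs * k) xs" by (simp add: rotate_id)
  also have "\<dots> = rotate (length xs * k - k) (rotate k xs)"
    by (cases xs) (auto simp: rotate_rotate add.commute)
  finally show "alternate v w (rotate k xs)"
    using j unfolding alternate_def
    by (intro exI[of _ "j + (length xs * k - k)"]) (simp flip: rotate_rotate)
qed

lemma filter_eq_append_split:
  "filter P xs = a @ b \<Longrightarrow> \<exists>a' b'. xs = a' @ b' \<and> filter P a' = a \<and> filter P b' = b"
proof (induction xs arbitrary: a)
  case (Cons x xs)
  show ?case
  proof (cases "P x \<and> a \<noteq> []")
    case True
    then obtain a2 where a: "a = x # a2" "filter P xs = a2 @ b"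
      using Cons.prems by (cases a) auto
    from Cons.IH[OF a(2)] obtain a' b' where "xs = a' @ b'" "filter P a' = a2" "filter P b' = b" by blast
    then show ?thesis using a True by (intro exI[of _ "x # a'"] exI[of _ b']) simp
  next
    case False
    show ?thesis
    proof (cases "a = []")
      case True
      then show ?thesis using Cons.prems by (intro exI[of _ "[]"] exI[of _ "x # xs"]) simp
    next
      case a: False
      then have "filter P xs = a @ b" "\<not> P x" using False Cons.prems by auto
      with Cons.IH[of a] obtain a' b' where "xs = a' @ b'" "filter P a' = a" "filter P b' = b" by blast
      then show ?thesis using \<open>\<not> P x\<close> by (intro exI[of _ "x # a'"] exI[of _ b']) simp
    qed
  qed
qed simp

text \<open>A cut of the filtered word lifts to a cut of the word itself, and the pattern consists
  of kept letters. Hence points on the circle and crossings inside it can be inserted or dropped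
  without affecting two outside crossings.\<close>

lemma alternate_filter:
  assumes "P v" "P w"
  shows "alternate v w (filter P xs) \<longleftrightarrow> alternate v w xs"
proof
  assume "alternate v w (filter P xs)"
  then obtain a b where "filter P xs = a @ b" and s: "subseq [v, w, v, w] (b @ a)"
    by (auto simp: alternate_iff)
  then obtain a' b' where xs: "xs = a' @ b'" "filter P a' = a" "filter P b' = b"
    using filter_eq_append_split by metis
  have "subseq (b @ a) (b' @ a')"
    using xs by (metis filter_append subseq_filter_left)
  then show "alternate v w xs"
    unfolding alternate_iff xs(1) using subseq_order.order_trans[OF s] by (intro exI[of _ a'] exI[of _ b']) simp
next
  assume "alternate v w xs"
  then obtain a b where xs: "xs = a @ b" and s: "subseq [v, w, v, w] (b @ a)"
    by (auto simp: alternate_iff)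
  have "subseq (filter P [v, w, v, w]) (filter P (b @ a))" using s by (rule subseq_filter)
  then show "alternate v w (filter P xs)"
    using assms unfolding alternate_iff xs by (intro exI[of _ "filter P a"] exI[of _ "filter P b"]) simp
qed

lemma alternate_sym: "alternate v w xs \<longleftrightarrow> alternate w v xs"
proof -
  have "alternate w v xs" if alt: "alternate v w xs" for v w
  proof -
    obtain a b where xs: "xs = a @ b" and s: "subseq [v, w, v, w] (b @ a)"
      using alt alternate_iff[of v w xs] by blast
    from list_emb_ConsD[OF s] obtain us vs where uv: "b @ a = us @ v # vs" "subseq [w, v, w] vs"
      by auto
    \<comment> \<open>The first \<open>v\<close> is carried round to the far end, which turns the
      pattern v w v w into w v w v.\<close>
    have "subseq ([w, v, w] @ [v]) (vs @ (us @ [v]))"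
      using uv(2) by (intro list_emb_append_mono) (auto simp: subseq_singleton_left)
    then have "alternate w v (b @ a)"
      unfolding alternate_iff uv(1) by (intro exI[of _ "us @ [v]"] exI[of _ vs]) simp
    moreover have "b @ a = rotate (length a) xs" by (simp add: xs rotate_append)
    ultimately show ?thesis by simp
  qed
  then show ?thesis by (intro iffI)
qed

text \<open>The pattern uses up both occurrences of \<open>v\<close>, so its first \<open>w\<close>
  lies between them and its second \<open>w\<close> behind them.\<close>

lemma subseq_alternating_two:
  assumes "v \<notin> set x0" "v \<notin> set x1" "v \<notin> set x2" "v \<noteq> w"
  shows "subseq [v, w, v, w] (x0 @ v # x1 @ v # x2) \<longleftrightarrow> w \<in> set x1 \<and> w \<in> set x2"
proof -
  have skip: "subseq (v # ys) (xs @ zs) \<longleftrightarrow> subseq (v # ys) zs" if "v \<notin> set xs" for xs ys zs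
    using that by (induction xs) auto
  have absent: "\<not> subseq [w, v, w] zs" if "v \<notin> set zs" for zs
    using that skip[of _ "[w]" "[]"] by (induction zs) auto
  have "subseq [w, v, w] (x1 @ v # x2) \<longleftrightarrow> w \<in> set x1 \<and> w \<in> set x2"
    using assms(2)
  proof (induction x1)
    case Nil
    then show ?case using absent[OF assms(3)] assms(4) by auto
  next
    case (Cons y x1)
    show ?case
    proof (cases "y = w")
      case True
      then show ?thesis using Cons.prems skip[of x1 "[w]" "v # x2"] by (simp add: subseq_singleton_left)
    next
      case False
      then show ?thesis using Cons by auto
    qed
  qed
  then show ?thesis using skip[OF assms(1)] by simp
qed

text \<open>Two occurrences of \<open>v\<close> divide the circle into the arcs \<open>x1\<close>
  and \<open>x2 @ x0\<close>; alternation means that \<open>w\<close> lies on both. The new crossing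
  is interlaced with others in exactly this way.\<close>

lemma alternate_two_occurrences:
  assumes "v \<notin> set x0" "v \<notin> set x1" "v \<notin> set x2" "v \<noteq> w"
  shows "alternate v w (x0 @ v # x1 @ v # x2) \<longleftrightarrow> w \<in> set x1 \<and> w \<in> set x0 \<union> set x2"
proof -
  have "rotate (length x0) (x0 @ v # x1 @ v # x2) = v # x1 @ v # x2 @ x0"
    by (simp add: rotate_append)
  then have "alternate v w (x0 @ v # x1 @ v # x2) \<longleftrightarrow> alternate v w (v # x1 @ v # x2 @ x0)"
    by (metis alternate_rotate)
  also have "\<dots> \<longleftrightarrow> w \<in> set x1 \<and> w \<in> set (x2 @ x0)"
  proof
    assume "w \<in> set x1 \<and> w \<in> set (x2 @ x0)"
    then have "subseq [v, w, v, w] ([] @ v # x1 @ v # (x2 @ x0))"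
      using assms by (subst subseq_alternating_two) auto
    then show "alternate v w (v # x1 @ v # x2 @ x0)"
      unfolding alternate_def by (intro exI[of _ 0]) simp
  next
    assume "alternate v w (v # x1 @ v # x2 @ x0)"
    then obtain a b where ab: "v # x1 @ v # x2 @ x0 = a @ b" and s: "subseq [v, w, v, w] (b @ a)"
      by (auto simp: alternate_iff)
    show "w \<in> set x1 \<and> w \<in> set (x2 @ x0)"
    proof (cases a)
      case Nil
      then have "subseq [v, w, v, w] ([] @ v # x1 @ v # (x2 @ x0))" using s ab by simp
      then show ?thesis using assms by (subst (asm) subseq_alternating_two) auto
    next
      case (Cons y a')
      then have y: "y = v" "a' @ b = x1 @ v # (x2 @ x0)" using ab by auto
      \<comment> \<open>The cut falls before or after the second \<open>v\<close>; either way the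
        word read from the cut is of the linear form already treated.\<close>
      have "(\<exists>u. x1 = a' @ u \<and> b = u @ v # x2 @ x0) \<or> (\<exists>u. a' = x1 @ v # u \<and> x2 @ x0 = u @ b)"
      proof -
        obtain us where "a' = x1 @ us \<and> us @ b = v # x2 @ x0 \<or> a' @ us = x1 \<and> b = us @ v # x2 @ x0"
          using y(2) unfolding append_eq_append_conv2 by blast
        then show ?thesis by (cases us) auto
      qed
      then consider u where "x1 = a' @ u" "b = u @ v # x2 @ x0"
        | u where "a' = x1 @ v # u" "x2 @ x0 = u @ b" by blast
      then show ?thesis
      proof cases
        case 1
        then have "subseq [v, w, v, w] (u @ v # (x2 @ x0) @ v # a')" using s Cons y by simp
        then show ?thesis using assms 1 by (subst (asm) subseq_alternating_two) auto
      next
        case 2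
        have sub: "set b \<subseteq> set (x2 @ x0)" "set u \<subseteq> set (x2 @ x0)" unfolding 2(2) by auto
        have "subseq [v, w, v, w] (b @ v # x1 @ v # u)" using s Cons y 2 by simp
        then show ?thesis using assms sub by (subst (asm) subseq_alternating_two) auto
      qed
    qed
  qed
  finally show ?thesis by auto
qed

section \<open>Curves, arcs and germs\<close>

lemma regular_closed_curve_shift:
  assumes "regular_closed_curve \<gamma>"
  shows "\<gamma> (t + of_int n) = \<gamma> t"
proof -
  have per: "\<gamma> (t + 1) = \<gamma> t" for t using assms by (simp add: regular_closed_curve_def)
  have nat: "\<gamma> (t + of_nat k) = \<gamma> t" for k t
  proof (induction k)
    case (Suc k)
    have "\<gamma> (t + of_nat (Suc k)) = \<gamma> ((t + of_nat k) + 1)" by (simp add: algebra_simps)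
    then show ?case using Suc per by simp
  qed simp
  show ?thesis
  proof (cases "n \<ge> 0")
    case True
    then show ?thesis using nat[of t "nat n"] by simp
  next
    case False
    then show ?thesis using nat[of "t + of_int n" "nat (- n)"] by simp
  qed
qed

lemma regular_closed_curve_frac: "regular_closed_curve \<gamma> \<Longrightarrow> \<gamma> (frac t) = \<gamma> t"
  using regular_closed_curve_shift[of \<gamma> t "- \<lfloor>t\<rfloor>"] by (simp add: frac_def)

lemma regular_closed_curve_has_vector_derivative:
  assumes "regular_closed_curve \<gamma>"
  shows "(\<gamma> has_vector_derivative vector_derivative \<gamma> (at t)) (at t)"
  using assms by (auto simp: regular_closed_curve_def C1_differentiable_on_eq vector_derivative_works)

lemma regular_closed_curve_vector_derivative_shift:
  assumes "regular_closed_curve \<gamma>"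
  shows "vector_derivative \<gamma> (at (t + of_int n)) = vector_derivative \<gamma> (at t)"
proof -
  have "((\<lambda>x. \<gamma> (x + of_int n)) has_vector_derivative vector_derivative \<gamma> (at (t + of_int n))) (at t)"
  proof -
    have "((\<lambda>x. x + of_int n) has_vector_derivative 1) (at t)"
      by (auto simp flip: has_real_derivative_iff_has_vector_derivative intro!: derivative_eq_intros)
    from vector_diff_chain_at[OF this regular_closed_curve_has_vector_derivative[OF assms]]
    show ?thesis by (simp add: o_def)
  qed
  then show ?thesis
    using regular_closed_curve_shift[OF assms] by (simp add: vector_derivative_at)
qed

lemma regular_closed_curve_continuous:
  assumes "regular_closed_curve \<gamma>"
  shows "continuous_on S \<gamma>" "continuous_on S (\<lambda>t. sgn (vector_derivative \<gamma> (at t)))"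
proof -
  have "continuous_on UNIV \<gamma>"
    using regular_closed_curve_has_vector_derivative[OF assms]
    by (meson continuous_at_imp_continuous_on has_vector_derivative_continuous)
  then show "continuous_on S \<gamma>" by (rule continuous_on_subset) simp
  have "continuous_on UNIV (\<lambda>t. sgn (vector_derivative \<gamma> (at t)))"
    using assms by (intro continuous_on_sgn) (auto simp: regular_closed_curve_def C1_differentiable_on_eq)
  then show "continuous_on S (\<lambda>t. sgn (vector_derivative \<gamma> (at t)))" by (rule continuous_on_subset) simp
qed

text \<open>The difference quotient tends to \<open>v\<close>, and \<open>sgn\<close> is continuous
  away from 0 and blind to the positive factor 1/u. The tangent direction is thus expressed by
  values of the curve alone.\<close>

lemma has_vector_derivative_imp_sgn_tendsto:
  fixes f :: "real \<Rightarrow> complex"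
  assumes "(f has_vector_derivative v) (at 0)" "v \<noteq> 0"
  shows "((\<lambda>u. sgn (f u - f 0)) \<longlongrightarrow> sgn v) (at_right 0)"
proof -
  have "((\<lambda>u. (f u - f 0) /\<^sub>R u) \<longlongrightarrow> v) (at_right 0)"
  proof -
    have "((\<lambda>u. (1 / norm (u - 0)) *\<^sub>R (f u - (f 0 + (u - 0) *\<^sub>R v))) \<longlongrightarrow> 0) (at_right 0)"
      using has_vector_derivative_at_within[OF assms(1), of "{0<..}"]
      unfolding has_vector_derivative_def has_derivative_within by blast
    then have "((\<lambda>u. (f u - f 0) /\<^sub>R u - v) \<longlongrightarrow> 0) (at_right 0)"
    proof (rule Lim_transform_eventually)
      show "\<forall>\<^sub>F u in at_right 0. (1 / norm (u - 0)) *\<^sub>R (f u - (f 0 + (u - 0) *\<^sub>R v)) = (f u - f 0) /\<^sub>R u - v"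
        unfolding eventually_at_right_field
        by (intro exI[of _ 1]) (auto simp: algebra_simps divide_inverse)
    qed
    then show ?thesis by (rule LIM_zero_cancel)
  qed
  then have "((\<lambda>u. sgn ((f u - f 0) /\<^sub>R u)) \<longlongrightarrow> sgn v) (at_right 0)"
    using assms(2) by (intro tendsto_sgn)
  then show ?thesis
  proof (rule Lim_transform_eventually)
    show "\<forall>\<^sub>F u in at_right 0. sgn ((f u - f 0) /\<^sub>R u) = sgn (f u - f 0)"
      unfolding eventually_at_right_field by (intro exI[of _ 1]) (auto simp: sgn_scaleR)
  qed
qed

text \<open>No continuity is assumed: an increasing map cannot jump at 0 if it takes every value of
  the interval.\<close>

lemma increasing_bijection_at_0:
  fixes \<phi> :: "real \<Rightarrow> real"
  assumes mono: "strict_mono_on {0..1} \<phi>" and im: "\<phi> ` {0..1} = {0..1}"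
  shows "\<phi> 0 = 0" "\<phi> 1 = 1" "filterlim \<phi> (at_right 0) (at_right 0)" "\<phi> ` {0<..<1} = {0<..<1}"
proof -
  have less: "\<phi> x < \<phi> y" if "0 \<le> x" "x < y" "y \<le> 1" for x y
    using strict_mono_onD[OF mono] that by auto
  have rng: "0 \<le> \<phi> x" "\<phi> x \<le> 1" if "0 \<le> x" "x \<le> 1" for x using im that by force+
  obtain x y where xy: "x \<in> {0..1}" "\<phi> x = 0" "y \<in> {0..1}" "\<phi> y = 1"
  proof -
    have "0 \<in> \<phi> ` {0..1}" "1 \<in> \<phi> ` {0..1}" by (simp_all add: im)
    then obtain x y where "x \<in> {0..1}" "0 = \<phi> x" "y \<in> {0..1}" "1 = \<phi> y" by blast
    then show ?thesis using that[of x y] by simp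
  qed
  show 0: "\<phi> 0 = 0" using less[of 0 x] rng[of 0] xy by (cases "x = 0") auto
  show 1: "\<phi> 1 = 1" using less[of y 1] rng[of 1] xy by (cases "y = 1") auto
  show "filterlim \<phi> (at_right 0) (at_right 0)"
    unfolding filterlim_at
  proof
    show "\<forall>\<^sub>F x in at_right 0. \<phi> x \<in> {0<..} \<and> \<phi> x \<noteq> 0"
      unfolding eventually_at_right_field
      by (rule exI[of _ 1]) (use less[of 0] 0 in \<open>auto simp: less_imp_neq[THEN not_sym]\<close>)
    show "(\<phi> \<longlongrightarrow> 0) (at_right 0)"
    proof (rule tendstoI)
      fix e :: real assume e: "e > 0"
      \<comment> \<open>Everything to the left of a preimage of this value is mapped below
        \<open>e\<close>; capping by 1 keeps the value in the range of
        \<open>\<phi>\<close>.\<close>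
      have "min (e/2) 1 \<in> \<phi> ` {0..1}" using e by (simp add: im)
      then obtain x where x: "x \<in> {0..1}" "min (e/2) 1 = \<phi> x" by blast
      then have x0: "x > 0" using 0 e by (cases "x = 0") auto
      have "\<phi> u < e" "- \<phi> u < e" if "0 < u" "u < x" for u
        using less[of u x] less[of 0 u] that x 0 e by auto
      then show "\<forall>\<^sub>F x in at_right 0. dist (\<phi> x) 0 < e"
        unfolding eventually_at_right_field using x0 by (intro exI[of _ x]) (auto simp: abs_less_iff)
    qed
  qed
  show "\<phi> ` {0<..<1} = {0<..<1}"
  proof
    show "\<phi> ` {0<..<1} \<subseteq> {0<..<1}" using less[of 0] less[of _ 1] 0 1 by auto
    show "{0<..<1} \<subseteq> \<phi> ` {0<..<1}"
    proof
      fix z :: real assume z: "z \<in> {0<..<1}"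
      then have "z \<in> \<phi> ` {0..1}" using im by auto
      then obtain u where u: "u \<in> {0..1}" "z = \<phi> u" by blast
      then have "u \<noteq> 0" "u \<noteq> 1" using z 0 1 by auto
      then show "z \<in> \<phi> ` {0<..<1}" using u by (intro image_eqI[of _ _ u]) auto
    qed
  qed
qed

text \<open>The chain rule does not apply, as \<open>\<phi>\<close> may fail to be differentiable.
  Instead both directions are limits of the same secant directions.\<close>

lemma same_arc_start:
  assumes sa: "same_arc g h"
    and g: "(g has_vector_derivative v) (at 0)" "v \<noteq> 0"
    and h: "(h has_vector_derivative w) (at 0)" "w \<noteq> 0"
  shows "sgn v = sgn w"
proof -
  obtain \<phi> :: "real \<Rightarrow> real" where \<phi>: "strict_mono_on {0..1} \<phi>" "\<phi> ` {0..1} = {0..1}"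
      "\<And>u. u \<in> {0..1} \<Longrightarrow> g u = h (\<phi> u)"
    using sa unfolding same_arc_def by blast
  note p = increasing_bijection_at_0[OF \<phi>(1,2)]
  have "((\<lambda>u. sgn (h (\<phi> u) - h 0)) \<longlongrightarrow> sgn w) (at_right 0)"
    by (rule filterlim_compose[OF has_vector_derivative_imp_sgn_tendsto[OF h] p(3)])
  then have "((\<lambda>u. sgn (g u - g 0)) \<longlongrightarrow> sgn w) (at_right 0)"
  proof (rule Lim_transform_eventually)
    show "\<forall>\<^sub>F u in at_right 0. sgn (h (\<phi> u) - h 0) = sgn (g u - g 0)"
      unfolding eventually_at_right_field using \<phi>(3) p(1) by (intro exI[of _ 1]) auto
  qed
  then show ?thesis
    using tendsto_unique[OF _ has_vector_derivative_imp_sgn_tendsto[OF g]]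
    by (metis trivial_limit_at_right_real)
qed

lemma same_arc_reverse:
  assumes "same_arc g h"
  shows "same_arc (\<lambda>u. g (1 - u)) (\<lambda>u. h (1 - u))"
proof -
  obtain \<phi> :: "real \<Rightarrow> real" where \<phi>: "strict_mono_on {0..1} \<phi>" "\<phi> ` {0..1} = {0..1}"
      "\<And>u. u \<in> {0..1} \<Longrightarrow> g u = h (\<phi> u)"
    using assms unfolding same_arc_def by blast
  define \<psi> where "\<psi> = (\<lambda>u. 1 - \<phi> (1 - u))"
  have "strict_mono_on {0..1} \<psi>"
    using \<phi>(1) by (auto simp: strict_mono_on_def \<psi>_def)
  moreover have "\<psi> ` {0..1} = {0..1}"
  proof -
    have flip: "(\<lambda>u. 1 - u) ` {0..1::real} = {0..1}" by (auto simp: image_iff intro!: bexI[of _ "1 - _"])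
    have "\<psi> ` {0..1} = (\<lambda>u. 1 - u) ` \<phi> ` (\<lambda>u. 1 - u) ` {0..1}" by (simp only: \<psi>_def image_image)
    then show ?thesis by (simp add: flip \<phi>(2))
  qed
  ultimately show ?thesis
    unfolding same_arc_def using \<phi>(3) by (intro exI[of _ \<psi>]) (auto simp: \<psi>_def)
qed

text \<open>Running both arcs backwards turns ends into starts and changes the sign of both
  tangents.\<close>

lemma same_arc_finish:
  assumes sa: "same_arc g h"
    and g: "(g has_vector_derivative v) (at 1)" "v \<noteq> 0"
    and h: "(h has_vector_derivative w) (at 1)" "w \<noteq> 0"
  shows "sgn v = sgn w"
proof -
  have rev: "((\<lambda>u. f (1 - u)) has_vector_derivative - v) (at 0)"
    if "(f has_vector_derivative v) (at 1)" for f :: "real \<Rightarrow> complex" and v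
  proof -
    have "((\<lambda>u. 1 - u) has_vector_derivative - 1) (at (0::real))"
      by (auto simp flip: has_real_derivative_iff_has_vector_derivative intro!: derivative_eq_intros)
    from vector_diff_chain_at[OF this, of f v] that show ?thesis by (simp add: o_def)
  qed
  have "sgn (- v) = sgn (- w)"
    using same_arc_start[OF same_arc_reverse[OF sa] rev[OF g(1)] _ rev[OF h(1)]] g(2) h(2) by simp
  then show ?thesis by (simp add: sgn_minus)
qed

lemma same_arc_ends:
  assumes "same_arc g h"
  shows "g 0 = h 0" "g 1 = h 1" "g ` {0<..<1} = h ` {0<..<1}"
proof -
  obtain \<phi> :: "real \<Rightarrow> real" where \<phi>: "strict_mono_on {0..1} \<phi>" "\<phi> ` {0..1} = {0..1}"
      "\<And>u. u \<in> {0..1} \<Longrightarrow> g u = h (\<phi> u)"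
    using assms unfolding same_arc_def by blast
  note p = increasing_bijection_at_0[OF \<phi>(1,2)]
  show "g 0 = h 0" "g 1 = h 1" using \<phi>(3) p by auto
  have "g ` {0<..<1} = h ` \<phi> ` {0<..<1}" unfolding image_image using \<phi>(3) by (intro image_cong) auto
  then show "g ` {0<..<1} = h ` {0<..<1}" by (simp add: p(4))
qed

section \<open>Germs of arcs\<close>

definition germ :: "diagram \<Rightarrow> oriented_arc \<Rightarrow> (complex \<times> complex) \<times> (complex \<times> complex)" where
  "germ D = (\<lambda>(i, s, t). ((start D (i, s, t), direction D (i, s)), (finish D (i, s, t), direction D (i, t))))"

definition arc_of :: "diagram \<Rightarrow> oriented_arc \<Rightarrow> bool" where
  "arc_of D = (\<lambda>(i, s, t). i < length (curves D) \<and> s < t)"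

lemma regular_curve: "link_diagram D \<Longrightarrow> i < length (curves D) \<Longrightarrow> regular_closed_curve (curves D ! i)"
  by (simp add: link_diagram_def)

lemma arc_path_derivative:
  assumes "regular_closed_curve (curves D ! i)"
  shows "(arc_path D (i, s, t) has_vector_derivative
      (t - s) *\<^sub>R vector_derivative (curves D ! i) (at ((t - s) * x + s))) (at x)"
proof -
  have "((\<lambda>x. (t - s) * x + s) has_vector_derivative (t - s)) (at x)"
    by (auto simp flip: has_real_derivative_iff_has_vector_derivative intro!: derivative_eq_intros)
  from vector_diff_chain_at[OF this regular_closed_curve_has_vector_derivative[OF assms]]
  show ?thesis by (simp add: o_def arc_path_def subpath_def)
qed

lemma open_arc_arc_path: "s < t \<Longrightarrow> open_arc D (i, s, t) = arc_path D (i, s, t) ` {0<..<1}"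
proof -
  assume st: "s < t"
  have "(\<lambda>x. (t - s) * x + s) ` {0<..<1} = {s<..<t}"
  proof
    show "(\<lambda>x. (t - s) * x + s) ` {0<..<1} \<subseteq> {s<..<t}"
    proof clarsimp
      fix x :: real assume "0 < x" "x < 1"
      then show "0 < (t - s) * x \<and> (t - s) * x + s < t"
        using st mult_strict_left_mono[of x 1 "t - s"] unfolding mult_1_right by (intro conjI mult_pos_pos) linarith+
    qed
    show "{s<..<t} \<subseteq> (\<lambda>x. (t - s) * x + s) ` {0<..<1}"
    proof
      fix u assume "u \<in> {s<..<t}"
      then show "u \<in> (\<lambda>x. (t - s) * x + s) ` {0<..<1}"
        using st by (intro image_eqI[of _ _ "(u - s) / (t - s)"]) (auto simp: divide_simps)
    qed
  qed
  then have "(curves D ! i) ` {s<..<t} = (curves D ! i) ` (\<lambda>x. (t - s) * x + s) ` {0<..<1}" by simp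
  then show ?thesis
    by (simp add: open_arc_def arc_path_def subpath_def image_image)
qed

lemma same_arc_germ:
  assumes D: "link_diagram D" "link_diagram D'" and e: "arc_of D e" "arc_of D' e'"
    and sa: "same_arc (arc_path D e) (arc_path D' e')"
  shows "germ D e = germ D' e'" "open_arc D e = open_arc D' e'"
proof -
  obtain i s t where e': "e = (i, s, t)" by (cases e)
  obtain j a b where f': "e' = (j, a, b)" by (cases e')
  have il: "i < length (curves D)" "s < t" "j < length (curves D')" "a < b"
    using e by (auto simp: arc_of_def e' f')
  note r = regular_curve[OF D(1) il(1)] regular_curve[OF D(2) il(3)]
  have nz: "vector_derivative (curves D ! i) (at x) \<noteq> 0" "vector_derivative (curves D' ! j) (at x) \<noteq> 0" for x
    using r by (auto simp: regular_closed_curve_def)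
  have s0: "direction D (i, s) = direction D' (j, a)"
    using same_arc_start[OF sa[unfolded e' f'] arc_path_derivative[OF r(1)] _ arc_path_derivative[OF r(2)]] nz il
    by (simp add: direction_def sgn_scaleR)
  have s1: "direction D (i, t) = direction D' (j, b)"
    using same_arc_finish[OF sa[unfolded e' f'] arc_path_derivative[OF r(1)] _ arc_path_derivative[OF r(2)]] nz il
    by (simp add: direction_def sgn_scaleR)
  note ends = same_arc_ends[OF sa[unfolded e' f']]
  show "germ D e = germ D' e'"
    using ends(1,2) s0 s1 by (simp add: germ_def e' f' start_def finish_def arc_path_def subpath_def)
  show "open_arc D e = open_arc D' e'"
    using ends(3) il by (simp add: e' f' open_arc_arc_path)
qed

section \<open>Strands through a point\<close>

lemma strand_point_frac: "i < length (curves D) \<Longrightarrow> (i, frac t) \<in> strand_points D"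
  by (simp add: strand_points_def frac_lt_1)

lemma position_frac:
  assumes "link_diagram D" "i < length (curves D)"
  shows "position D (i, frac t) = (curves D ! i) t" "direction D (i, frac t) = direction D (i, t)"
proof -
  note r = regular_curve[OF assms]
  show "position D (i, frac t) = (curves D ! i) t"
    by (simp add: position_def regular_closed_curve_frac[OF r])
  have "frac t = t + of_int (- \<lfloor>t\<rfloor>)" by (simp add: frac_def)
  then show "direction D (i, frac t) = direction D (i, t)"
    using regular_closed_curve_vector_derivative_shift[OF r, of t "- \<lfloor>t\<rfloor>"]
    by (simp add: direction_def)
qed

lemma transverse_strands:
  assumes "link_diagram D" "p \<in> strand_points D" "q \<in> strand_points D" "p \<noteq> q" "position D p = position D q"
  shows "position D p \<in> crossings D"
    "{s \<in> strand_points D. position D s = position D p} = {p, q}"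
    "Im (cnj (direction D p) * direction D q) \<noteq> 0"
proof -
  show x: "position D p \<in> crossings D" using assms by (auto simp: crossings_def)
  then obtain p' q' where pq: "p' \<noteq> q'" "{s \<in> strand_points D. position D s = position D p} = {p', q'}"
     "Im (cnj (direction D p') * direction D q') \<noteq> 0"
    using assms(1) unfolding link_diagram_def by meson
  have "p \<in> {p', q'}" "q \<in> {p', q'}" using assms unfolding pq(2)[symmetric] by auto
  then consider "p = p'" "q = q'" | "p = q'" "q = p'" using assms(4) by auto
  then show "{s \<in> strand_points D. position D s = position D p} = {p, q}"
    "Im (cnj (direction D p) * direction D q) \<noteq> 0"
    using pq by (cases; auto simp: algebra_simps)+
qed

text \<open>Two different strands at a point are transverse, whereas the determinant of a vector
  with itself vanishes.\<close>

lemma strand_unique_direction: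
  assumes "link_diagram D" "p \<in> strand_points D" "q \<in> strand_points D"
    and "position D p = position D q" "direction D p = direction D q"
  shows "p = q"
  using transverse_strands(3)[OF assms(1-3) _ assms(4)] assms(5) by (auto simp: mult.commute)

text \<open>Since strands at a common point differ in direction, crossings can be seen in the set of
  line elements. So two diagrams have the same crossings wherever these sets agree.\<close>

lemma crossing_iff_line_elements:
  assumes "link_diagram D"
  shows "x \<in> crossings D \<longleftrightarrow> (\<exists>u w. u \<noteq> w \<and> (x, u) \<in> line_elements D \<and> (x, w) \<in> line_elements D)"
proof
  assume "x \<in> crossings D"
  then obtain p q where "p \<in> strand_points D" "q \<in> strand_points D" "p \<noteq> q" "position D p = x" "position D q = x"
    by (auto simp: crossings_def)
  then show "\<exists>u w. u \<noteq> w \<and> (x, u) \<in> line_elements D \<and> (x, w) \<in> line_elements D"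
    using strand_unique_direction[OF assms] unfolding line_elements_def by (metis (mono_tags, lifting) image_eqI)
next
  assume "\<exists>u w. u \<noteq> w \<and> (x, u) \<in> line_elements D \<and> (x, w) \<in> line_elements D"
  then obtain p q where "p \<in> strand_points D" "q \<in> strand_points D" "position D p = x" "position D q = x"
    "direction D p \<noteq> direction D q" by (auto simp: line_elements_def)
  then show "x \<in> crossings D" using transverse_strands(1)[OF assms, of p q] by auto
qed

text \<open>Either alternative excludes a second strand: at a crossing the directions differ, and
  elsewhere only one strand passes.\<close>

lemma curve_strand_unique:
  assumes D: "link_diagram D" and ij: "i < length (curves D)" "j < length (curves D)"
    and eq: "(curves D ! i) t = (curves D ! j) u"
    and or: "direction D (i, t) = direction D (j, u) \<or> (curves D ! i) t \<notin> crossings D"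
  shows "i = j \<and> frac t = frac u"
proof (rule ccontr)
  assume "\<not> (i = j \<and> frac t = frac u)"
  then have ne: "(i, frac t) \<noteq> (j, frac u)" by simp
  have pos: "position D (i, frac t) = position D (j, frac u)"
    using eq position_frac(1)[OF D] ij by simp
  note t = transverse_strands[OF D strand_point_frac[OF ij(1)] strand_point_frac[OF ij(2)] ne pos]
  then have "direction D (i, t) = direction D (j, u)"
    using or position_frac(1)[OF D ij(1), of t] by auto
  then show False
    using strand_unique_direction[OF D strand_point_frac[OF ij(1)] strand_point_frac[OF ij(2)] pos] ne
      position_frac(2)[OF D] ij by simp
qed

lemma finite_strands_at:
  assumes "link_diagram D"
  shows "finite {p \<in> strand_points D. position D p = x}"
proof (cases "x \<in> crossings D")
  case True
  then obtain p q where "{s \<in> strand_points D. position D s = x} = {p, q}"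
    using assms unfolding link_diagram_def by meson
  then show ?thesis by simp
next
  case False
  show ?thesis
  proof (cases "{p \<in> strand_points D. position D p = x} = {}")
    case nonempty: False
    then obtain p where "p \<in> strand_points D" "position D p = x" by blast
    then have "{p \<in> strand_points D. position D p = x} \<subseteq> {p}"
      using False by (auto simp: crossings_def)
    then show ?thesis by (rule finite_subset) simp
  qed (simp only: finite.emptyI)
qed

text \<open>\<open>cut_arc\<close> sorts this set, and \<open>sorted_list_of_set\<close> yields the
  empty list on infinite sets. Only finitely many strands meet \<open>X\<close>, and in an open
  interval of length at most 1 a parameter is determined by its fractional part.\<close>

lemma finite_parameters:
  assumes D: "link_diagram D" and i: "i < length (curves D)" and t: "t \<le> s + 1"
    and X: "finite (X \<inter> image_of D)"
  shows "finite {u. s < u \<and> u < t \<and> (curves D ! i) u \<in> X}"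
proof -
  have "{p \<in> strand_points D. position D p \<in> X} = (\<Union>x\<in>X \<inter> image_of D. {p \<in> strand_points D. position D p = x})"
    by (auto simp: image_of_def)
  then have fin: "finite {p \<in> strand_points D. position D p \<in> X}"
    using X finite_strands_at[OF D] by simp
  have "inj_on (\<lambda>u. (i, frac u)) {u. s < u \<and> u < t \<and> (curves D ! i) u \<in> X}"
  proof (rule inj_onI)
    fix u u' assume u: "u \<in> {u. s < u \<and> u < t \<and> (curves D ! i) u \<in> X}" "u' \<in> {u. s < u \<and> u < t \<and> (curves D ! i) u \<in> X}"
      and "(i, frac u) = (i, frac u')"
    then have "u - u' = of_int (\<lfloor>u\<rfloor> - \<lfloor>u'\<rfloor>)" by (simp add: frac_def)
    moreover have "\<bar>u - u'\<bar> < 1" using u t by auto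
    ultimately have "\<bar>\<lfloor>u\<rfloor> - \<lfloor>u'\<rfloor>\<bar> < 1" by linarith
    with \<open>u - u' = _\<close> show "u = u'" by simp
  qed
  moreover have "(\<lambda>u. (i, frac u)) ` {u. s < u \<and> u < t \<and> (curves D ! i) u \<in> X} \<subseteq> {p \<in> strand_points D. position D p \<in> X}"
    using strand_point_frac[OF i] position_frac(1)[OF D i] by auto
  ultimately show ?thesis using fin by (meson inj_on_finite)
qed

section \<open>The universe and its Euler circuits\<close>

lemma arcs_universeD:
  assumes "(i, s, t) \<in> arcs (universe D)"
  shows "i < length (curves D)" "0 \<le> s" "s < 1" "s < t"
    "(curves D ! i) s \<in> classical D" "(curves D ! i) t \<in> classical D"
    "\<And>u. s < u \<Longrightarrow> u < t \<Longrightarrow> (curves D ! i) u \<notin> classical D"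
proof -
  have *: "i < length (curves D) \<and> 0 \<le> s \<and> s < 1 \<and> s < t \<and> (curves D ! i) s \<in> classical D \<and>
      (curves D ! i) t \<in> classical D \<and> (curves D ! i) ` {s<..<t} \<inter> classical D = {}"
    using assms by (simp add: universe_def start_def finish_def open_arc_def)
  then show "i < length (curves D)" "0 \<le> s" "s < 1" "s < t"
    "(curves D ! i) s \<in> classical D" "(curves D ! i) t \<in> classical D" by simp_all
  fix u assume "s < u" "u < t"
  then have "(curves D ! i) u \<in> (curves D ! i) ` {s<..<t}" by simp
  then show "(curves D ! i) u \<notin> classical D" using * by blast
qed

lemma universe_arc_of: "e \<in> arcs (universe D) \<Longrightarrow> arc_of D e"
  by (cases e) (auto simp: arc_of_def dest: arcs_universeD)

text \<open>After a full period the curve is back at its classical starting point, which an arc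
  cannot pass.\<close>

lemma universe_arc_length:
  assumes D: "link_diagram D" and e: "(i, s, t) \<in> arcs (universe D)"
  shows "t \<le> s + 1"
proof (rule ccontr)
  assume "\<not> t \<le> s + 1"
  then have "(curves D ! i) (s + of_int 1) \<notin> classical D" using arcs_universeD(7)[OF e, of "s + 1"] by simp
  then show False
    using arcs_universeD(1,5)[OF e] regular_closed_curve_shift[OF regular_curve[OF D], of i s 1] by simp
qed

lemma universe_arc_finish_unique:
  assumes "(i, s, t) \<in> arcs (universe D)" "(i, s, t') \<in> arcs (universe D)"
  shows "t = t'"
  using arcs_universeD(4,6,7)[OF assms(1)] arcs_universeD(4,6,7)[OF assms(2)]
  by (metis linorder_neqE_linordered_idom)

text \<open>An integer shift makes the two parameter intervals overlap. If they began at different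
  parameters, the classical start of one arc would lie inside the other. Both starts lie in the
  half-open unit interval, so the shift is 0.\<close>

lemma universe_arc_overlap:
  assumes D: "link_diagram D"
    and e: "(i, s, t) \<in> arcs (universe D)" and e': "(i, s', t') \<in> arcs (universe D)"
    and u: "s < u" "u < t" "s' < u'" "u' < t'" "frac u = frac u'"
  shows "s = s'" "t = t'"
proof -
  define k where "k = \<lfloor>u'\<rfloor> - \<lfloor>u\<rfloor>"
  have uk: "u' = u + of_int k" using u(5) by (simp add: k_def frac_def)
  note shift = regular_closed_curve_shift[OF regular_curve[OF D arcs_universeD(1)[OF e]]]
  have "\<not> s < s' - of_int k"
    using arcs_universeD(7)[OF e, of "s' - of_int k"] arcs_universeD(5)[OF e'] shift[of s' "- k"] u uk by auto
  moreover have "\<not> s' - of_int k < s"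
    using arcs_universeD(7)[OF e', of "s + of_int k"] arcs_universeD(5)[OF e] shift[of s k] u uk by auto
  ultimately have eq: "s' = s + of_int k" by simp
  then have "\<bar>real_of_int k\<bar> < 1"
    using arcs_universeD(2,3)[OF e] arcs_universeD(2,3)[OF e'] by linarith
  then have "k = 0" by simp
  then show s: "s = s'" using eq by simp
  show "t = t'" using universe_arc_finish_unique e e' s by blast
qed

text \<open>Point and tangent at the start determine the curve and the starting parameter, and the
  arc ends at the next classical point.\<close>

lemma universe_arc_germ_unique:
  assumes D: "link_diagram D" and e: "e \<in> arcs (universe D)" "e' \<in> arcs (universe D)"
    and g: "fst (germ D e) = fst (germ D e')"
  shows "e = e'"
proof -
  obtain i s t j s' t' where ee: "e = (i, s, t)" "e' = (j, s', t')" by (cases e, cases e')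
  note a = arcs_universeD[OF e(1)[unfolded ee]] and a' = arcs_universeD[OF e(2)[unfolded ee]]
  have "i = j \<and> frac s = frac s'"
    using g by (intro curve_strand_unique[OF D a(1) a'(1)]) (auto simp: germ_def ee start_def)
  then have "i = j" "s = s'" using a a' by (auto simp: frac_eq)
  then show ?thesis using universe_arc_finish_unique e unfolding ee by blast
qed

lemma classical_subset_crossings: "link_diagram D \<Longrightarrow> classical D \<subseteq> crossings D"
  by (simp add: link_diagram_def)

lemma finite_classical: "link_diagram D \<Longrightarrow> finite (classical D)"
  by (meson finite_subset link_diagram_def)

lemma universe_arc_exists:
  assumes D: "link_diagram D" and x: "x \<in> classical D"
  shows "\<exists>e\<in>arcs (universe D). start D e = x"
proof -
  have "x \<in> crossings D" using classical_subset_crossings[OF D] x by blast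
  then obtain p where "p \<in> strand_points D" "position D p = x" unfolding crossings_def by blast
  then obtain i s where i: "i < length (curves D)" and s: "0 \<le> s" "s < 1" and ix: "(curves D ! i) s = x"
    by (auto simp: strand_points_def position_def)
  define T where "T = {u. s < u \<and> u < s + 1 \<and> (curves D ! i) u \<in> classical D}"
  have fin: "finite T"
    unfolding T_def using finite_classical[OF D] by (intro finite_parameters[OF D i]) auto
  \<comment> \<open>The candidate \<open>s + 1\<close>, where the curve is back at \<open>x\<close>,
    keeps the set nonempty when no classical point comes earlier.\<close>
  define t where "t = Min (insert (s + 1) T)"
  have "t \<in> insert (s + 1) T" unfolding t_def using fin by (intro Min_in) auto
  moreover have "(curves D ! i) (s + 1) = x"
    using regular_closed_curve_shift[OF regular_curve[OF D i], of s 1] ix by simp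
  ultimately have t: "s < t" "t \<le> s + 1" "(curves D ! i) t \<in> classical D"
    using x by (auto simp: T_def)
  have min: "t \<le> u" if "u \<in> T" for u unfolding t_def using fin that by (intro Min_le) auto
  have "(curves D ! i) u \<notin> classical D" if "s < u" "u < t" for u
    using min[of u] that t by (auto simp: T_def)
  then have "(i, s, t) \<in> arcs (universe D)"
    using i s t x ix by (auto simp: universe_def start_def finish_def open_arc_def)
  then show ?thesis using ix by (intro bexI[of _ "(i, s, t)"]) (auto simp: start_def)
qed

lemma universe_wf: "wf_digraph (universe D)"
  by unfold_locales (auto simp: universe_def)

section \<open>Components of the universe and their circuits\<close>

lemma universe_components_disjoint:
  assumes "K \<in> universe_components D" "K' \<in> universe_components D" "x \<in> K" "x \<in> K'"
  shows "K = K'"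
proof -
  interpret u: wf_digraph "universe D" by (rule universe_wf)
  interpret s: pair_wf_digraph "mk_symmetric (universe D)" by (rule u.wellformed_mk_symmetric)
  show ?thesis
    using s.sccs_verts_disjoint[of K K'] assms unfolding universe_components_def by (cases "K = K'") auto
qed

lemma universe_component_classical:
  assumes "K \<in> universe_components D"
  shows "K \<noteq> {}" "K \<subseteq> classical D"
proof -
  interpret u: wf_digraph "universe D" by (rule universe_wf)
  interpret s: pair_wf_digraph "mk_symmetric (universe D)" by (rule u.wellformed_mk_symmetric)
  show "K \<noteq> {}" "K \<subseteq> classical D"
  proof -
    have K: "K \<noteq> {}" "\<And>u. u \<in> K \<Longrightarrow> u \<rightarrow>\<^sup>*\<^bsub>mk_symmetric (universe D)\<^esub> u"
      using assms unfolding universe_components_def s.in_sccs_verts_conv_reachable by simp_all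
    then show "K \<noteq> {}" by simp
    show "K \<subseteq> classical D"
      using s.reachable_in_verts(1)[OF K(2)] by (auto simp: universe_def)
  qed
qed

lemma universe_component_closed:
  assumes K: "K \<in> universe_components D" and e: "e \<in> arcs (universe D)" "start D e \<in> K"
  shows "finish D e \<in> K"
proof -
  interpret u: wf_digraph "universe D" by (rule universe_wf)
  interpret s: pair_wf_digraph "mk_symmetric (universe D)" by (rule u.wellformed_mk_symmetric)
  have "(start D e, finish D e) \<in> parcs (mk_symmetric (universe D))"
    "(finish D e, start D e) \<in> parcs (mk_symmetric (universe D))"
    using e by (auto simp: parcs_mk_symmetric universe_def)
  then have "start D e \<rightarrow>\<^sup>*\<^bsub>mk_symmetric (universe D)\<^esub> finish D e" "finish D e \<rightarrow>\<^sup>*\<^bsub>mk_symmetric (universe D)\<^esub> start D e"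
    by (auto intro: s.reachable_adjI)
  then show ?thesis
    using K e(2) unfolding universe_components_def s.in_sccs_verts_conv_reachable by metis
qed

lemma cas_adjacent_pairs:
  assumes "pre_digraph.cas G u p v"
  shows "p \<noteq> [] \<Longrightarrow> tail G (hd p) = u \<and> head G (last p) = v"
    "(e, e') \<in> adjacent_pairs p \<Longrightarrow> head G e = tail G e'"
proof -
  have "(p \<noteq> [] \<longrightarrow> tail G (hd p) = u \<and> head G (last p) = v) \<and>
    (\<forall>e e'. (e, e') \<in> adjacent_pairs p \<longrightarrow> head G e = tail G e')"
    using assms
  proof (induction p arbitrary: u)
    case (Cons a p)
    then have "tail G a = u" "pre_digraph.cas G (head G a) p v"
      by (simp_all only: pre_digraph.cas.simps(2) simp_thms)
    note IH = Cons.IH[OF this(2)]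
    show ?case
    proof (cases p)
      case Nil
      then show ?thesis
        using \<open>tail G a = u\<close> \<open>pre_digraph.cas G (head G a) p v\<close> by (simp add: pre_digraph.cas.simps(1))
    next
      case (Cons b q)
      then have "tail G b = head G a" "head G (last (b # q)) = v" using IH by simp_all
      moreover have "\<forall>e e'. (e, e') \<in> adjacent_pairs (b # q) \<longrightarrow> head G e = tail G e'" using IH Cons by blast
      ultimately show ?thesis using \<open>tail G a = u\<close> Cons by (auto simp: adjacent_pairs_Cons)
    qed
  qed simp
  then show "p \<noteq> [] \<Longrightarrow> tail G (hd p) = u \<and> head G (last p) = v"
    "(e, e') \<in> adjacent_pairs p \<Longrightarrow> head G e = tail G e'" by blast+
qed

lemma euler_circuitD:
  assumes D: "link_diagram D" and K: "K \<in> universe_components D" and p: "euler_circuit D K p"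
  shows "p \<noteq> []" "set p = {e \<in> arcs (universe D). start D e \<in> K}"
    "(e, e') \<in> cyclic_pairs p \<Longrightarrow> finish D e = start D e'"
proof -
  let ?G = "universe D \<restriction> K"
  have heads: "tail ?G = start D" "head ?G = finish D" by (simp_all add: universe_def)
  obtain u where u: "pre_digraph.euler_trail ?G u p u" using p by (auto simp: euler_circuit_def)
  then have cas: "pre_digraph.cas ?G u p u" and "set p = arcs ?G"
    by (auto simp: pre_digraph.euler_trail_def pre_digraph.trail_def pre_digraph.awalk_def)
  then show set: "set p = {e \<in> arcs (universe D). start D e \<in> K}"
    using universe_component_closed[OF K] by (auto simp: universe_def)
  obtain x where "x \<in> K" "x \<in> classical D" using universe_component_classical[OF K] by blast
  then show ne: "p \<noteq> []" using universe_arc_exists[OF D, of x] set by auto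
  show "(e, e') \<in> cyclic_pairs p \<Longrightarrow> finish D e = start D e'"
  proof -
    assume "(e, e') \<in> cyclic_pairs p"
    then consider "e = last p" "e' = hd p" | "(e, e') \<in> adjacent_pairs p"
      using ne by (auto simp: cyclic_pairs_def simp del: split_paired_All)
    then show ?thesis
      using cas_adjacent_pairs(1)[OF cas ne] cas_adjacent_pairs(2)[OF cas, of e e'] unfolding heads
      by cases simp_all
  qed
qed

lemma euler_system_component:
  assumes "euler_system D C" "p \<in> C"
  obtains K where "K \<in> universe_components D" "euler_circuit D K p"
  using assms unfolding euler_system_def by meson

lemma euler_system_unique:
  assumes "euler_system D C" "K \<in> universe_components D"
    and "p \<in> C" "euler_circuit D K p" "p' \<in> C" "euler_circuit D K p'"
  shows "p = p'"
proof -
  have "\<exists>!q. q \<in> C \<and> euler_circuit D K q" using assms(1,2) by (simp add: euler_system_def)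
  then obtain q where "q \<in> C \<and> euler_circuit D K q"
    and q: "\<forall>y. y \<in> C \<and> euler_circuit D K y \<longrightarrow> y = q" by (rule ex1E)
  have "p = q" "p' = q" using q assms(3-6) by iprover+
  then show ?thesis by simp
qed

lemma euler_system_arc:
  assumes "link_diagram D" "euler_system D C" "p \<in> C"
  shows "p \<noteq> []" "set p \<subseteq> arcs (universe D)" "(e, e') \<in> cyclic_pairs p \<Longrightarrow> finish D e = start D e'"
proof -
  obtain K where K: "K \<in> universe_components D" "euler_circuit D K p"
    using euler_system_component[OF assms(2,3)] .
  note c = euler_circuitD[OF assms(1) K]
  show "p \<noteq> []" by (rule c(1))
  show "set p \<subseteq> arcs (universe D)" unfolding c(2) by (rule Collect_restrict)
  show "(e, e') \<in> cyclic_pairs p \<Longrightarrow> finish D e = start D e'" by (rule c(3))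
qed

text \<open>The start of an arc lies in a single component, and each component carries a single
  circuit.\<close>

lemma euler_system_circuit_unique:
  assumes D: "link_diagram D" and C: "euler_system D C" and p: "p \<in> C" "p' \<in> C" "e \<in> set p" "e \<in> set p'"
  shows "p = p'"
proof -
  obtain K K' where K: "K \<in> universe_components D" "euler_circuit D K p"
    "K' \<in> universe_components D" "euler_circuit D K' p'"
    using euler_system_component[OF C p(1)] euler_system_component[OF C p(2)] by metis
  then have "start D e \<in> K" "start D e \<in> K'"
    using euler_circuitD(2)[OF D K(1,2)] euler_circuitD(2)[OF D K(3,4)] p(3,4) by simp_all
  then have "K = K'" using universe_components_disjoint[OF K(1,3)] by simp
  then show ?thesis using euler_system_unique[OF C K(1) p(1) K(2) p(2)] K(4) by simp
qed

text \<open>The unique circuit of a component runs through all of its arcs. Free loops of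
  interlacement graphs are counted by components, whereas the two diagrams are compared by circuits;
  this translates between them.\<close>

lemma euler_system_card:
  assumes D: "link_diagram D" and C: "euler_system D C"
  shows "card {K \<in> universe_components D. \<forall>e\<in>arcs (universe D \<restriction> K). P e} = card {p \<in> C. \<forall>e\<in>set p. P e}"
proof -
  define f where "f K = (THE p. p \<in> C \<and> euler_circuit D K p)" for K
  have f: "f K \<in> C" "euler_circuit D K (f K)" if "K \<in> universe_components D" for K
  proof -
    have "\<exists>!p. p \<in> C \<and> euler_circuit D K p" using C that by (simp add: euler_system_def)
    from theI'[OF this] show "f K \<in> C" "euler_circuit D K (f K)" unfolding f_def by simp_all
  qed
  have f_eq: "f K = p" if "K \<in> universe_components D" "p \<in> C" "euler_circuit D K p" for K p
    using euler_system_unique[OF C that(1) f[OF that(1)] that(2,3)] .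
  have arcs: "arcs (universe D \<restriction> K) = set (f K)" if "K \<in> universe_components D" for K
    using euler_circuitD(2)[OF D that f(2)[OF that]] universe_component_closed[OF that]
    by (auto simp: universe_def)
  have "bij_betw f {K \<in> universe_components D. \<forall>e\<in>arcs (universe D \<restriction> K). P e} {p \<in> C. \<forall>e\<in>set p. P e}"
    unfolding bij_betw_def
  proof
    have "K = K'" if K: "K \<in> universe_components D" "K' \<in> universe_components D" "f K = f K'" for K K'
    proof -
      obtain e where "e \<in> set (f K)" using euler_circuitD(1)[OF D K(1) f(2)[OF K(1)]] by (meson list.set_sel(1))
      then have "start D e \<in> K" "start D e \<in> K'"
        using euler_circuitD(2)[OF D K(1) f(2)[OF K(1)]] euler_circuitD(2)[OF D K(2) f(2)[OF K(2)]] K(3) by auto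
      then show ?thesis using universe_components_disjoint[OF K(1,2)] by simp
    qed
    then show "inj_on f {K \<in> universe_components D. \<forall>e\<in>arcs (universe D \<restriction> K). P e}"
      by (auto simp: inj_on_def)
    have "p \<in> f ` {K \<in> universe_components D. \<forall>e\<in>arcs (universe D \<restriction> K). P e}"
      if p: "p \<in> C" "\<forall>e\<in>set p. P e" for p
    proof -
      obtain K where K: "K \<in> universe_components D" "euler_circuit D K p"
        using euler_system_component[OF C p(1)] .
      then show ?thesis
        using f_eq[OF K(1) p(1) K(2)] arcs[OF K(1)] p by (intro image_eqI[of _ _ K]) auto
    qed
    then show "f ` {K \<in> universe_components D. \<forall>e\<in>arcs (universe D \<restriction> K). P e} = {p \<in> C. \<forall>e\<in>set p. P e}"
    proof (intro subset_antisym subsetI)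
      fix p assume "p \<in> f ` {K \<in> universe_components D. \<forall>e\<in>arcs (universe D \<restriction> K). P e}"
      then obtain K where "K \<in> universe_components D" "\<forall>e\<in>arcs (universe D \<restriction> K). P e" "p = f K" by blast
      then have "\<forall>e\<in>set (f K). P e" "f K \<in> C" "p = f K" using f(1) arcs by metis+
      then show "p \<in> {p \<in> C. \<forall>e\<in>set p. P e}" by simp
    qed blast
  qed
  then show ?thesis by (rule bij_betw_same_card)
qed

section \<open>Cutting arcs and circuits\<close>

text \<open>\<open>Q\<close> lists the intervals between consecutive points of the chain from
  \<open>s\<close> to \<open>t\<close>. By the last claim only the first of them can begin at a
  point that is not a cut point.\<close>

lemma zip_chain:
  assumes "sorted_wrt (<) (s # us @ [t :: real])"
  defines "Q \<equiv> zip (s # us) (us @ [t])"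
  shows "fst (hd Q) = s" "snd (last Q) = t" "Q \<noteq> []"
    "(a, b) \<in> set Q \<Longrightarrow> s \<le> a \<and> a < b \<and> b \<le> t \<and> (a = s \<or> a \<in> set us) \<and> (b = t \<or> b \<in> set us) \<and>
        (\<forall>u. a < u \<and> u < b \<longrightarrow> u \<notin> set us)"
    "((a, b), (a', b')) \<in> adjacent_pairs Q \<Longrightarrow> b = a' \<and> b \<in> set us"
    "(a, b) \<in> set (tl Q) \<Longrightarrow> a \<in> set us"
proof -
  have *: "fst (hd Q) = s \<and> snd (last Q) = t \<and> Q \<noteq> [] \<and>
    (\<forall>a b. (a, b) \<in> set Q \<longrightarrow> s \<le> a \<and> a < b \<and> b \<le> t \<and> (a = s \<or> a \<in> set us) \<and> (b = t \<or> b \<in> set us) \<and>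
        (\<forall>u. a < u \<and> u < b \<longrightarrow> u \<notin> set us)) \<and>
    (\<forall>a b a' b'. ((a, b), (a', b')) \<in> adjacent_pairs Q \<longrightarrow> b = a' \<and> b \<in> set us) \<and>
    (\<forall>a b. (a, b) \<in> set (tl Q) \<longrightarrow> a \<in> set us)"
    using assms(1) unfolding Q_def
  proof (induction us arbitrary: s)
    case (Cons u us)
    define R where "R = zip (u # us) (us @ [t])"
    have su: "s < u" "u < t" "\<forall>x\<in>set us. u < x \<and> s < x" and sorted: "sorted_wrt (<) (u # us @ [t])"
      using Cons.prems by auto
    note IH = Cons.IH[OF sorted, folded R_def]
    have Z: "zip (s # u # us) ((u # us) @ [t]) = (s, u) # R" by (simp add: R_def)
    have tlR: "set (tl R) \<subseteq> set R" by (cases R) auto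
    show ?case
      unfolding Z
    proof (intro conjI allI impI ballI)
      show "fst (hd ((s, u) # R)) = s" "(s, u) # R \<noteq> []" by simp_all
      show "snd (last ((s, u) # R)) = t" using IH by simp
      fix a b assume "(a, b) \<in> set ((s, u) # R)"
      then consider "a = s" "b = u" | "(a, b) \<in> set R" by auto
      then have "s \<le> a \<and> a < b \<and> b \<le> t \<and> (a = s \<or> a \<in> set (u # us)) \<and> (b = t \<or> b \<in> set (u # us)) \<and>
        (\<forall>v. a < v \<and> v < b \<longrightarrow> v \<notin> set (u # us))"
      proof cases
        case 1
        then show ?thesis using su by force
      next
        case 2
        then have "u \<le> a" "a < b" "b \<le> t" "a = u \<or> a \<in> set us" "b = t \<or> b \<in> set us"
          "\<forall>v. a < v \<and> v < b \<longrightarrow> v \<notin> set us"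
          using IH by blast+
        then show ?thesis using su by auto
      qed
      then show "s \<le> a" "a < b" "b \<le> t" "a = s \<or> a \<in> set (u # us)" "b = t \<or> b \<in> set (u # us)"
        "\<And>v. a < v \<and> v < b \<Longrightarrow> v \<notin> set (u # us)" by blast+
    next
      fix a b a' b' assume "((a, b), (a', b')) \<in> adjacent_pairs ((s, u) # R)"
      then consider "a = s" "b = u" "(a', b') = hd R" | "((a, b), (a', b')) \<in> adjacent_pairs R"
        by (auto simp: adjacent_pairs_Cons split: if_splits)
      then have "b = a' \<and> b \<in> set (u # us)"
      proof cases
        case 1
        then have "a' = u" using IH by (metis fst_conv)
        then show ?thesis using 1 by simp
      next
        case 2
        then have "b = a'" "b \<in> set us" using IH by blast+
        then show ?thesis by simp
      qed
      then show "b = a'" "b \<in> set (u # us)" by auto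
    next
      fix a b assume "(a, b) \<in> set (tl ((s, u) # R))"
      then have "(a, b) \<in> set R" by simp
      then show "a \<in> set (u # us)" using IH by auto
    qed
  qed simp
  show "fst (hd Q) = s" "snd (last Q) = t" "Q \<noteq> []"
    "(a, b) \<in> set Q \<Longrightarrow> s \<le> a \<and> a < b \<and> b \<le> t \<and> (a = s \<or> a \<in> set us) \<and> (b = t \<or> b \<in> set us) \<and>
        (\<forall>u. a < u \<and> u < b \<longrightarrow> u \<notin> set us)"
    "((a, b), (a', b')) \<in> adjacent_pairs Q \<Longrightarrow> b = a' \<and> b \<in> set us"
    "(a, b) \<in> set (tl Q) \<Longrightarrow> a \<in> set us"
    using * by blast+
qed

context
  fixes D :: diagram and X :: "complex set" and i :: nat and s t :: real
  assumes D: "link_diagram D" and i: "i < length (curves D)" and st: "s < t" "t \<le> s + 1"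
    and X: "finite (X \<inter> image_of D)"
begin

lemma cut_arc_nonempty: "cut_arc D X (i, s, t) \<noteq> []"
  and cut_arc_hd: "\<exists>b. hd (cut_arc D X (i, s, t)) = (i, s, b)"
  and cut_arc_last: "\<exists>a. last (cut_arc D X (i, s, t)) = (i, a, t)"
  and cut_arc_mem: "(j, a, b) \<in> set (cut_arc D X (i, s, t)) \<Longrightarrow>
      j = i \<and> s \<le> a \<and> a < b \<and> b \<le> t \<and> (a = s \<or> (curves D ! i) a \<in> X) \<and>
      (b = t \<or> (curves D ! i) b \<in> X) \<and> (\<forall>u. a < u \<and> u < b \<longrightarrow> (curves D ! i) u \<notin> X)"
  and cut_arc_adjacent: "(e, e') \<in> adjacent_pairs (cut_arc D X (i, s, t)) \<Longrightarrow>
      \<exists>a b c. e = (i, a, b) \<and> e' = (i, b, c) \<and> (curves D ! i) b \<in> X \<and> s < b \<and> b < t"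
  and cut_arc_tl: "(j, a, b) \<in> set (tl (cut_arc D X (i, s, t))) \<Longrightarrow> j = i \<and> (curves D ! i) a \<in> X"
proof -
  define U where "U = {u. s < u \<and> u < t \<and> (curves D ! i) u \<in> X}"
  define us where "us = sorted_list_of_set U"
  define Q where "Q = zip (s # us) (us @ [t])"
  have fin: "finite U" unfolding U_def by (rule finite_parameters[OF D i st(2) X])
  then have us: "set us = U" "sorted_wrt (<) us"
    by (simp_all add: us_def strict_sorted_list_of_set)
  have "sorted_wrt (<) (s # us @ [t])"
    using us st by (auto simp: sorted_wrt_append U_def)
  note z = zip_chain[OF this, folded Q_def]
  have cut: "cut_arc D X (i, s, t) = map (\<lambda>(a, b). (i, a, b)) Q"
    by (simp add: cut_arc_def Let_def Q_def us_def U_def)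
  show "cut_arc D X (i, s, t) \<noteq> []" by (simp add: cut z(3))
  show "\<exists>b. hd (cut_arc D X (i, s, t)) = (i, s, b)"
    using z(1,3) by (cases "hd Q") (simp add: cut hd_map)
  show "\<exists>a. last (cut_arc D X (i, s, t)) = (i, a, t)"
    using z(2,3) by (cases "last Q") (simp add: cut last_map)
  show "(j, a, b) \<in> set (cut_arc D X (i, s, t)) \<Longrightarrow>
      j = i \<and> s \<le> a \<and> a < b \<and> b \<le> t \<and> (a = s \<or> (curves D ! i) a \<in> X) \<and>
      (b = t \<or> (curves D ! i) b \<in> X) \<and> (\<forall>u. a < u \<and> u < b \<longrightarrow> (curves D ! i) u \<notin> X)"
  proof -
    assume "(j, a, b) \<in> set (cut_arc D X (i, s, t))"
    then have "j = i" "(a, b) \<in> set Q" by (auto simp: cut)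
    then show ?thesis using z(4)[of a b] unfolding us(1) U_def by auto
  qed
  show "(e, e') \<in> adjacent_pairs (cut_arc D X (i, s, t)) \<Longrightarrow>
      \<exists>a b c. e = (i, a, b) \<and> e' = (i, b, c) \<and> (curves D ! i) b \<in> X \<and> s < b \<and> b < t"
  proof -
    assume "(e, e') \<in> adjacent_pairs (cut_arc D X (i, s, t))"
    then obtain a b a' b' where ab: "e = (i, a, b)" "e' = (i, a', b')" "((a, b), (a', b')) \<in> adjacent_pairs Q"
      by (auto simp: cut adjacent_pairs_map)
    then show ?thesis using z(5)[OF ab(3)] unfolding us(1) U_def by auto
  qed
  show "(j, a, b) \<in> set (tl (cut_arc D X (i, s, t))) \<Longrightarrow> j = i \<and> (curves D ! i) a \<in> X"
    using z(6)[of a b] unfolding us(1) U_def by (auto simp: cut simp flip: map_tl)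
qed

end

text \<open>To follow the link component at \<open>x\<close> is to leave \<open>x\<close> with the
  tangent of arrival. In this form the condition refers to germs only and can be moved between
  diagrams.\<close>

definition straight :: "complex \<Rightarrow> ((complex \<times> complex) \<times> (complex \<times> complex)) list \<Rightarrow> bool" where
  "straight x gs \<longleftrightarrow> (\<forall>gg\<in>cyclic_pairs gs. fst (snd (fst gg)) = x \<longrightarrow> snd (fst gg) = fst (snd gg))"

lemma straight_rotate [simp]: "straight x (rotate k gs) = straight x gs"
  by (simp add: straight_def)

lemma straight_map_germ:
  "straight x (map (germ D) p) \<longleftrightarrow>
     (\<forall>ee\<in>cyclic_pairs p. finish D (fst ee) = x \<longrightarrow> snd (germ D (fst ee)) = fst (germ D (snd ee)))"
proof -
  have "fst (snd (germ D e)) = finish D e" for e by (cases e) (simp add: germ_def)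
  then show ?thesis by (simp add: straight_def cyclic_pairs_map)
qed

text \<open>Consecutive arcs of a circuit share a point, and there equal directions amount to the
  same curve and the same parameter modulo 1.\<close>

lemma follows_component_iff_straight:
  assumes D: "link_diagram D" and C: "euler_system D C"
  shows "follows_component D C x \<longleftrightarrow> (\<forall>p\<in>C. straight x (map (germ D) p))"
proof -
  have "(case (e, e') of ((i, s, t), (j, s', t')) \<Rightarrow> i = j \<and> frac t = s') \<longleftrightarrow> snd (germ D e) = fst (germ D e')"
    if p: "p \<in> C" and ee: "(e, e') \<in> cyclic_pairs p" for p e e'
  proof -
    obtain i s t j s' t' where e: "e = (i, s, t)" and e': "e' = (j, s', t')" by (cases e, cases e')
    have mem: "(i, s, t) \<in> arcs (universe D)" "(j, s', t') \<in> arcs (universe D)"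
      using euler_system_arc(2)[OF D C p] cyclic_pairs_mem[OF ee] e e' by auto
    note a = arcs_universeD[OF mem(1)] and a' = arcs_universeD[OF mem(2)]
    have eq: "(curves D ! i) t = (curves D ! j) s'"
      using euler_system_arc(3)[OF D C p ee] by (simp add: e e' start_def finish_def)
    have "snd (germ D e) = fst (germ D e') \<longleftrightarrow> direction D (i, t) = direction D (j, s')"
      using eq by (auto simp: germ_def e e' start_def finish_def)
    also have "\<dots> \<longleftrightarrow> i = j \<and> frac t = s'"
    proof
      assume "direction D (i, t) = direction D (j, s')"
      then have "i = j \<and> frac t = frac s'" using curve_strand_unique[OF D a(1) a'(1) eq] by blast
      then show "i = j \<and> frac t = s'" using a'(2,3) by (simp add: frac_eq)
    next
      assume "i = j \<and> frac t = s'"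
      then show "direction D (i, t) = direction D (j, s')" using position_frac(2)[OF D a(1), of t] by auto
    qed
    finally show ?thesis by (simp add: e e')
  qed
  then have eq: "(finish D e = x \<longrightarrow> (case (e, e') of ((i, s, t), (j, s', t')) \<Rightarrow> i = j \<and> frac t = s')) \<longleftrightarrow>
      (finish D e = x \<longrightarrow> snd (germ D e) = fst (germ D e'))"
    if "p \<in> C" "(e, e') \<in> cyclic_pairs p" for p e e'
    using that by simp
  have nth: "(p ! k, p ! (Suc k mod length p)) \<in> cyclic_pairs p" if "k < length p" for p :: "oriented_arc list" and k
    unfolding cyclic_pairs_nth using that by blast
  have "follows_component D C x \<longleftrightarrow> (\<forall>p\<in>C. \<forall>k<length p. finish D (p ! k) = x \<longrightarrow>
      snd (germ D (p ! k)) = fst (germ D (p ! (Suc k mod length p))))"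
    unfolding follows_component_def by (intro ball_cong refl all_cong, rule eq, assumption, rule nth)
  also have "\<dots> \<longleftrightarrow> (\<forall>p\<in>C. \<forall>ee\<in>cyclic_pairs p. finish D (fst ee) = x \<longrightarrow>
      snd (germ D (fst ee)) = fst (germ D (snd ee)))"
    proof (intro ball_cong refl iffI ballI allI impI)
    fix p ee assume *: "\<forall>k<length p. finish D (p ! k) = x \<longrightarrow>
        snd (germ D (p ! k)) = fst (germ D (p ! (Suc k mod length p)))"
      and ee: "ee \<in> cyclic_pairs p" "finish D (fst ee) = x"
    obtain k where "ee = (p ! k, p ! (Suc k mod length p))" "k < length p"
      using ee(1) unfolding cyclic_pairs_nth by blast
    then show "snd (germ D (fst ee)) = fst (germ D (snd ee))" using * ee(2) by simp
  next
    fix p k assume *: "\<forall>ee\<in>cyclic_pairs p. finish D (fst ee) = x \<longrightarrow> snd (germ D (fst ee)) = fst (germ D (snd ee))"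
      and k: "k < length p" "finish D (p ! k) = x"
    show "snd (germ D (p ! k)) = fst (germ D (p ! (Suc k mod length p)))"
      using *[rule_format, OF nth[OF k(1)]] k(2) by simp
  qed
  also have "\<dots> \<longleftrightarrow> (\<forall>p\<in>C. straight x (map (germ D) p))"
    unfolding straight_map_germ by (rule refl)
  finally show ?thesis .
qed

context
  fixes D :: diagram and C :: "oriented_arc list set" and X :: "complex set" and p :: "oriented_arc list"
  assumes D: "link_diagram D" and C: "euler_system D C" and p: "p \<in> C"
    and X: "finite (X \<inter> image_of D)"
begin

lemma cut_circuit_arc:
  assumes "e \<in> set p"
  shows "cut_arc D X e \<noteq> []" "snd (germ D (last (cut_arc D X e))) = snd (germ D e)"
    "finish D (last (cut_arc D X e)) = finish D e"
    "fst (germ D (hd (cut_arc D X e))) = fst (germ D e)"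
    "start D (hd (cut_arc D X e)) = start D e"
    "\<And>f f'. (f, f') \<in> adjacent_pairs (cut_arc D X e) \<Longrightarrow> finish D f \<in> X"
    "\<And>f. f \<in> set (tl (cut_arc D X e)) \<Longrightarrow> start D f \<in> X"
proof -
  obtain i s t where e: "e = (i, s, t)" by (cases e)
  have mem: "(i, s, t) \<in> arcs (universe D)" using euler_system_arc(2)[OF D C p] assms e by auto
  note c = D arcs_universeD(1)[OF mem] arcs_universeD(4)[OF mem] universe_arc_length[OF D mem] X
  obtain a b where ab: "hd (cut_arc D X e) = (i, s, b)" "last (cut_arc D X e) = (i, a, t)"
    using cut_arc_hd[OF c] cut_arc_last[OF c] unfolding e by blast
  show "cut_arc D X e \<noteq> []" using cut_arc_nonempty[OF c] by (simp add: e)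
  show "snd (germ D (last (cut_arc D X e))) = snd (germ D e)"
    "finish D (last (cut_arc D X e)) = finish D e"
    "fst (germ D (hd (cut_arc D X e))) = fst (germ D e)"
    "start D (hd (cut_arc D X e)) = start D e"
    unfolding ab by (simp_all add: e germ_def start_def finish_def)
  show "finish D f \<in> X" if "(f, f') \<in> adjacent_pairs (cut_arc D X e)" for f f'
    using cut_arc_adjacent[OF c that[unfolded e]] by (auto simp: finish_def)
  show "start D f \<in> X" if "f \<in> set (tl (cut_arc D X e))" for f
    using cut_arc_tl[OF c] that by (cases f) (auto simp: e start_def)
qed

lemma cut_circuit_pairs:
  "cyclic_pairs (concat (map (cut_arc D X) p)) =
    (\<Union>e\<in>set p. adjacent_pairs (cut_arc D X e)) \<union>
    (\<lambda>(e, e'). (last (cut_arc D X e), hd (cut_arc D X e'))) ` cyclic_pairs p"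
  by (subst cyclic_pairs_concat)
    (use cut_circuit_arc(1) in \<open>auto simp: cyclic_pairs_map image_image case_prod_unfold map_prod_def\<close>)

text \<open>The junctions added by cutting lie in \<open>X\<close>, hence not at \<open>x\<close>;
  the old junctions keep their germs because the outer ends of an arc are unchanged.\<close>

lemma straight_cut_circuit:
  assumes "x \<notin> X"
  shows "straight x (map (germ D) (concat (map (cut_arc D X) p))) \<longleftrightarrow> straight x (map (germ D) p)"
  unfolding straight_map_germ cut_circuit_pairs
proof (intro iffI ballI impI)
  fix ee
  assume *: "\<forall>ff\<in>(\<Union>e\<in>set p. adjacent_pairs (cut_arc D X e)) \<union>
      (\<lambda>(e, e'). (last (cut_arc D X e), hd (cut_arc D X e'))) ` cyclic_pairs p.
      finish D (fst ff) = x \<longrightarrow> snd (germ D (fst ff)) = fst (germ D (snd ff))"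
    and ee: "ee \<in> cyclic_pairs p" "finish D (fst ee) = x"
  obtain e e' where e: "ee = (e, e')" by (cases ee)
  have mem: "e \<in> set p" "e' \<in> set p" using cyclic_pairs_mem[of e e' p] ee e by simp_all
  have "(last (cut_arc D X e), hd (cut_arc D X e')) \<in>
      (\<lambda>(e, e'). (last (cut_arc D X e), hd (cut_arc D X e'))) ` cyclic_pairs p"
    using ee(1) e by (intro image_eqI[of _ _ ee]) auto
  from *[rule_format, OF UnI2, OF this] show "snd (germ D (fst ee)) = fst (germ D (snd ee))"
    using ee(2) cut_circuit_arc(2,3)[OF mem(1)] cut_circuit_arc(4)[OF mem(2)] by (simp add: e)
next
  fix ff
  assume *: "\<forall>ee\<in>cyclic_pairs p. finish D (fst ee) = x \<longrightarrow> snd (germ D (fst ee)) = fst (germ D (snd ee))"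
    and f: "ff \<in> (\<Union>e\<in>set p. adjacent_pairs (cut_arc D X e)) \<union>
      (\<lambda>(e, e'). (last (cut_arc D X e), hd (cut_arc D X e'))) ` cyclic_pairs p" "finish D (fst ff) = x"
  have "ff \<notin> adjacent_pairs (cut_arc D X e)" if "e \<in> set p" for e
    using cut_circuit_arc(6)[OF that, of "fst ff" "snd ff"] f(2) assms by auto
  then obtain e e' where e: "(e, e') \<in> cyclic_pairs p" "ff = (last (cut_arc D X e), hd (cut_arc D X e'))"
    using f(1) by auto
  have mem: "e \<in> set p" "e' \<in> set p" using cyclic_pairs_mem[OF e(1)] by simp_all
  show "snd (germ D (fst ff)) = fst (germ D (snd ff))"
    using *[rule_format, OF e(1)] f(2) cut_circuit_arc(2,3)[OF mem(1)] cut_circuit_arc(4)[OF mem(2)]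
    by (simp add: e(2))
qed

text \<open>Cutting an arc leaves its start in place and inserts only points of \<open>X\<close>
  behind it.\<close>

lemma filter_cut_circuit:
  "filter (\<lambda>x. x \<notin> X) (map (start D) (concat (map (cut_arc D X) p))) = filter (\<lambda>x. x \<notin> X) (map (start D) p)"
proof -
  have one: "filter (\<lambda>x. x \<notin> X) (map (start D) (cut_arc D X e)) = filter (\<lambda>x. x \<notin> X) [start D e]"
    if "e \<in> set p" for e
  proof -
    note c = cut_circuit_arc[OF that]
    show ?thesis
    proof (cases "cut_arc D X e")
      case (Cons f fs)
      then have "filter (\<lambda>x. x \<notin> X) (map (start D) fs) = []"
        using c(7) by (simp add: filter_empty_conv)
      then show ?thesis using c(5) Cons by simp
    qed (use c(1) in simp)
  qed
  have "filter (\<lambda>x. x \<notin> X) (map (start D) (concat (map (cut_arc D X) q))) = filter (\<lambda>x. x \<notin> X) (map (start D) q)"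
    if "set q \<subseteq> set p" for q
    using that
  proof (induction q)
    case (Cons e q)
    then show ?case using one[of e] by (auto simp del: filter.simps(2)) (auto)
  qed simp
  then show ?thesis by blast
qed

lemma alternate_cut_circuit:
  assumes "v \<notin> X" "w \<notin> X"
  shows "alternate v w (map (start D) (concat (map (cut_arc D X) p))) \<longleftrightarrow> alternate v w (map (start D) p)"
  using alternate_filter[of "\<lambda>x. x \<notin> X" v w] assms filter_cut_circuit by metis

end

text \<open>Every arc is paired with its diagram, since the exchanged circuit mixes arcs of both
  diagrams.\<close>

lemma list_all2_same_arc_germs:
  assumes "list_all2 same_arc (map (\<lambda>z. arc_path (fst z) (snd z)) zs) (map (\<lambda>z. arc_path (fst z) (snd z)) ws)"
    and "\<forall>z\<in>set zs \<union> set ws. link_diagram (fst z) \<and> arc_of (fst z) (snd z)"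
  shows "map (\<lambda>z. germ (fst z) (snd z)) zs = map (\<lambda>z. germ (fst z) (snd z)) ws"
  using assms
proof (induction zs arbitrary: ws)
  case (Cons z zs)
  then obtain w ws' where ws: "ws = w # ws'" by (cases ws) auto
  have "germ (fst z) (snd z) = germ (fst w) (snd w)"
    using Cons.prems by (intro same_arc_germ(1)) (auto simp: ws)
  moreover have "map (\<lambda>z. germ (fst z) (snd z)) zs = map (\<lambda>z. germ (fst z) (snd z)) ws'"
    using Cons.prems by (intro Cons.IH) (auto simp: ws)
  ultimately show ?case by (simp add: ws)
qed simp

lemma same_circuit_germs:
  assumes "same_circuit (map (arc_path D) p) (map (arc_path D') p')"
    and "link_diagram D" "link_diagram D'" "\<And>e. e \<in> set p \<Longrightarrow> arc_of D e" "\<And>e. e \<in> set p' \<Longrightarrow> arc_of D' e"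
  obtains k where "map (germ D) p = rotate k (map (germ D') p')"
proof -
  obtain k where k: "list_all2 same_arc (map (arc_path D) p) (rotate k (map (arc_path D') p'))"
    using assms(1) by (auto simp: same_circuit_def)
  have "list_all2 same_arc (map (\<lambda>z. arc_path (fst z) (snd z)) (map (Pair D) p))
      (map (\<lambda>z. arc_path (fst z) (snd z)) (map (Pair D') (rotate k p')))"
    using k by (simp add: rotate_map o_def)
  moreover have "\<forall>z\<in>set (map (Pair D) p) \<union> set (map (Pair D') (rotate k p')).
      link_diagram (fst z) \<and> arc_of (fst z) (snd z)"
    using assms(2-5) by (auto simp del: split_paired_All)
  ultimately have "map (\<lambda>z. germ (fst z) (snd z)) (map (Pair D) p) =
      map (\<lambda>z. germ (fst z) (snd z)) (map (Pair D') (rotate k p'))"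
    by (rule list_all2_same_arc_germs)
  then have "map (germ D) p = rotate k (map (germ D') p')"
    by (simp add: rotate_map o_def)
  then show ?thesis by (rule that)
qed

section \<open>Arcs and the circle\<close>

lemma arc_ends_in_closure:
  assumes D: "link_diagram D" and e: "arc_of D e"
  shows "start D e \<in> closure (open_arc D e)" "finish D e \<in> closure (open_arc D e)"
proof -
  obtain i s t where e': "e = (i, s, t)" by (cases e)
  have i: "i < length (curves D)" "s < t" using e by (auto simp: arc_of_def e')
  have "(curves D ! i) ` closure {s<..<t} \<subseteq> closure ((curves D ! i) ` {s<..<t})"
    using regular_closed_curve_continuous(1)[OF regular_curve[OF D i(1)]]
    by (rule image_closure_subset[OF _ closed_closure closure_subset])
  then have "(curves D ! i) ` {s..t} \<subseteq> closure (open_arc D e)"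
    using i(2) by (simp add: open_arc_def e')
  then show "start D e \<in> closure (open_arc D e)" "finish D e \<in> closure (open_arc D e)"
    using i(2) by (auto simp: start_def finish_def e')
qed

text \<open>The complement of the open disc is closed. The closed disc could not be excluded here,
  for an end may lie on the circle.\<close>

lemma arc_outside_ends:
  assumes "link_diagram D" "arc_of D e" "open_arc D e \<inter> cball c r = {}"
  shows "start D e \<notin> ball c r" "finish D e \<notin> ball c r"
proof -
  have "closure (open_arc D e) \<subseteq> - ball c r"
    using assms(3) by (intro closure_minimal) auto
  then show "start D e \<notin> ball c r" "finish D e \<notin> ball c r"
    using arc_ends_in_closure[OF assms(1,2)] by blast+
qed

lemma arc_inside_ends:
  assumes "link_diagram D" "arc_of D e" "open_arc D e \<subseteq> ball c r"
  shows "start D e \<in> cball c r" "finish D e \<in> cball c r"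
proof -
  have "closure (open_arc D e) \<subseteq> cball c r"
    using assms(3) by (intro closure_minimal) auto
  then show "start D e \<in> cball c r" "finish D e \<in> cball c r"
    using arc_ends_in_closure[OF assms(1,2)] by blast+
qed

text \<open>The arc together with its ends is connected and misses the frontier of the disc.\<close>

lemma arc_avoiding_sphere:
  assumes D: "link_diagram D" and e: "arc_of D e" and r: "r > 0"
    and sphere: "open_arc D e \<inter> sphere c r = {}" "start D e \<notin> sphere c r" "finish D e \<notin> sphere c r"
  shows "start D e \<in> ball c r \<longleftrightarrow> finish D e \<in> ball c r"
    "start D e \<notin> ball c r \<Longrightarrow> open_arc D e \<inter> cball c r = {}"
proof -
  obtain i s t where e': "e = (i, s, t)" by (cases e)
  have i: "i < length (curves D)" "s < t" using e by (auto simp: arc_of_def e')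
  define S where "S = (curves D ! i) ` {s..t}"
  have "topological_space_class.connected S"
    unfolding S_def using regular_closed_curve_continuous(1)[OF regular_curve[OF D i(1)]]
    by (intro connected_continuous_image) auto
  have S: "S = open_arc D e \<union> {start D e, finish D e}"
  proof -
    have "{s..t} = {s<..<t} \<union> {s, t}" using i(2) by auto
    then show ?thesis by (simp add: S_def open_arc_def start_def finish_def e' image_Un)
  qed
  have "frontier (ball c r) = sphere c r" using r by (simp add: frontier_ball)
  then have "S \<inter> frontier (ball c r) = {}" using S sphere by auto
  then have or: "S \<inter> ball c r = {} \<or> S \<subseteq> ball c r"
    using connected_Int_frontier[OF \<open>topological_space_class.connected S\<close>, of "ball c r"] by blast
  then show "start D e \<in> ball c r \<longleftrightarrow> finish D e \<in> ball c r" using S by blast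
  assume "start D e \<notin> ball c r"
  then have "open_arc D e \<inter> ball c r = {}" using or S by blast
  then show "open_arc D e \<inter> cball c r = {}" using sphere(1)
    by (simp add: disjoint_iff) (metis dual_order.order_iff_strict)
qed

lemma cyclic_pairs_invariant:
  assumes "x \<in> set xs" "P x" and step: "\<And>a b. (a, b) \<in> cyclic_pairs xs \<Longrightarrow> P a \<Longrightarrow> P b"
    and "y \<in> set xs"
  shows "P y"
proof -
  obtain k where k: "k < length xs" "xs ! k = x" using assms(1) by (auto simp: in_set_conv_nth)
  obtain j where j: "j < length xs" "xs ! j = y" using assms(4) by (auto simp: in_set_conv_nth)
  have "P (xs ! ((k + n) mod length xs))" for n
  proof (induction n)
    case 0
    then show ?case using k assms(2) by simp
  next
    case (Suc n)
    have lt: "(k + n) mod length xs < length xs" using k by (intro mod_less_divisor) auto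
    have "(xs ! ((k + n) mod length xs), xs ! (Suc ((k + n) mod length xs) mod length xs)) \<in> cyclic_pairs xs"
      unfolding cyclic_pairs_nth using lt by blast
    from step[OF this Suc] show ?case by (simp add: mod_Suc_eq)
  qed
  \<comment> \<open>Adding a full turn avoids a negative number of steps from position
    \<open>k\<close> to position \<open>j\<close>.\<close>
  from this[of "j + length xs - k"] show ?thesis using k j by simp
qed

section \<open>Signs of crossings\<close>

lemma negative_crossing_iff:
  "negative_crossing D x \<longleftrightarrow> x \<in> classical D \<and> (\<exists>u. (x, u) \<in> line_elements D \<and> Im (cnj (over D x) * u) < 0)"
  unfolding negative_crossing_def line_elements_def by auto

text \<open>Of the two strands at \<open>x\<close>, the upper one has determinant 0 with itself, so
  one and the same strand would have to provide both signs.\<close>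

lemma positive_not_negative_crossing:
  assumes D: "link_diagram D" and "positive_crossing D x"
  shows "\<not> negative_crossing D x"
proof
  assume "negative_crossing D x"
  have x: "x \<in> classical D" using assms(2) by (simp add: positive_crossing_def)
  obtain ov where ov: "ov \<in> strand_points D" "position D ov = x" "over D x = direction D ov"
    using D x unfolding link_diagram_def by blast
  obtain p where p: "p \<in> strand_points D" "position D p = x" "Im (cnj (over D x) * direction D p) > 0"
    using assms(2) by (auto simp: positive_crossing_def)
  obtain q where q: "q \<in> strand_points D" "position D q = x" "Im (cnj (over D x) * direction D q) < 0"
    using \<open>negative_crossing D x\<close> by (auto simp: negative_crossing_def)
  have "p \<noteq> ov" using p(3) ov(3) by (auto simp: mult.commute)
  then have "{s \<in> strand_points D. position D s = x} = {ov, p}"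
    using transverse_strands(2)[OF D ov(1) p(1)] ov(2) p(2) by auto
  then have "q = ov \<or> q = p" using q(1,2) by auto
  then show False using q(3) p(3) ov(3) by (auto simp: mult.commute)
qed

section \<open>Curves as sets of points with tangents\<close>

text \<open>Unlike the images of the curves, these sets are disjoint for different curves even where
  the curves cross.\<close>

definition curve_elements :: "diagram \<Rightarrow> nat \<Rightarrow> (complex \<times> complex) set" where
  "curve_elements D i = range (\<lambda>t. ((curves D ! i) t, direction D (i, t)))"

lemma continuous_curve_element:
  assumes "link_diagram D" "i < length (curves D)"
  shows "continuous_on S (\<lambda>t. ((curves D ! i) t, direction D (i, t)))"
  using regular_closed_curve_continuous[OF regular_curve[OF assms]]
  by (auto simp: direction_def intro!: continuous_on_Pair)

lemma curve_elements_eq: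
  assumes "link_diagram D" "i < length (curves D)"
  shows "curve_elements D i = (\<lambda>t. ((curves D ! i) t, direction D (i, t))) ` {0..1}"
proof -
  have "((curves D ! i) t, direction D (i, t)) = ((curves D ! i) (frac t), direction D (i, frac t))" for t
    using position_frac[OF assms] by (simp add: position_def)
  moreover have "frac t \<in> {0..1}" for t :: real using frac_lt_1[of t] by simp
  ultimately show ?thesis unfolding curve_elements_def by blast
qed

lemma closed_curve_elements:
  assumes "link_diagram D" "i < length (curves D)"
  shows "closed (curve_elements D i)"
  unfolding curve_elements_eq[OF assms]
  by (intro compact_imp_closed compact_continuous_image continuous_curve_element assms compact_Icc)

lemma line_elements_Union:
  assumes "link_diagram D"
  shows "line_elements D = (\<Union>i<length (curves D). curve_elements D i)"
proof (intro subset_antisym subsetI)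
  fix y assume "y \<in> line_elements D"
  then show "y \<in> (\<Union>i<length (curves D). curve_elements D i)"
    by (auto simp: line_elements_def strand_points_def curve_elements_def position_def)
next
  fix y assume "y \<in> (\<Union>i<length (curves D). curve_elements D i)"
  then obtain i t where i: "i < length (curves D)" and y: "y = ((curves D ! i) t, direction D (i, t))"
    by (auto simp: curve_elements_def)
  show "y \<in> line_elements D"
    using strand_point_frac[OF i, of t] position_frac[OF assms i, of t] y
    unfolding line_elements_def by (intro image_eqI[of _ _ "(i, frac t)"]) auto
qed

lemma curve_elements_disjoint:
  assumes "link_diagram D" "i < length (curves D)" "j < length (curves D)"
    and "y \<in> curve_elements D i" "y \<in> curve_elements D j"
  shows "i = j"
proof -
  obtain t u where "y = ((curves D ! i) t, direction D (i, t))" "y = ((curves D ! j) u, direction D (j, u))"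
    using assms(4,5) unfolding curve_elements_def by blast
  then show ?thesis using curve_strand_unique[OF assms(1-3), of t u] by simp
qed

lemma fst_curve_elements: "fst ` curve_elements D i = range (curves D ! i)"
  by (simp add: curve_elements_def image_image)

lemma line_elements_outside:
  assumes "line_elements D' \<inter> (- ball c r) \<times> UNIV = line_elements D \<inter> (- ball c r) \<times> UNIV"
    and "x \<notin> ball c r"
  shows "(x, u) \<in> line_elements D' \<longleftrightarrow> (x, u) \<in> line_elements D"
proof -
  have "(x, u) \<in> line_elements D' \<inter> (- ball c r) \<times> UNIV \<longleftrightarrow> (x, u) \<in> line_elements D \<inter> (- ball c r) \<times> UNIV"
    by (simp only: assms(1))
  then show ?thesis using assms(2) by (simp del: mem_ball)
qed

text \<open>
  The curves of one diagram partition the parameter line of a curve of the other into finitely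
  many closed sets; since the line is connected, only one of them is nonempty.
\<close>

lemma outside_curve_correspondence:
  assumes D: "link_diagram D" "link_diagram D'"
    and le: "line_elements D' \<inter> (- ball c r) \<times> UNIV = line_elements D \<inter> (- ball c r) \<times> UNIV"
    and i: "i < length (curves D)" "range (curves D ! i) \<inter> cball c r = {}"
  shows "\<exists>j<length (curves D'). curve_elements D' j = curve_elements D i"
proof -
  have clopen_UNIV: "S = UNIV" if "closed S" "closed (- S)" "S \<noteq> {}" for S :: "real set"
    using that clopen[of S] by (auto simp: closed_def)
  let ?f = "\<lambda>t. ((curves D ! i) t, direction D (i, t))"
  define S where "S j = ?f -` curve_elements D' j" for j
  have closed_S: "closed (S j)" if "j < length (curves D')" for j
    unfolding S_def by (intro continuous_closed_vimage closed_curve_elements D that)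
      (use continuous_curve_element[OF D(1) i(1), of UNIV] in \<open>auto simp: continuous_on_eq_continuous_at\<close>)
  have S_covers: "\<exists>j<length (curves D'). t \<in> S j" for t
  proof -
    have "(curves D ! i) t \<in> range (curves D ! i)" by simp
    then have "(curves D ! i) t \<notin> cball c r" using i(2) by blast
    then have nb: "(curves D ! i) t \<notin> ball c r" by simp
    have "?f t \<in> line_elements D"
      unfolding line_elements_Union[OF D(1)] curve_elements_def using i(1) by (intro UN_I[of i]) simp_all
    then have "?f t \<in> line_elements D'" by (rule iffD2[OF line_elements_outside[OF le nb]])
    then show ?thesis by (simp add: line_elements_Union[OF D(2)] S_def Bex_def)
  qed
  have S_disjoint: "j = k" if "j < length (curves D')" "k < length (curves D')" "t \<in> S j" "t \<in> S k" for j k t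
    using curve_elements_disjoint[OF D(2) that(1,2)] that(3,4) by (simp add: S_def)
  obtain j where j: "j < length (curves D')" "0 \<in> S j" using S_covers by blast
  have "- S j = (\<Union>k\<in>{..<length (curves D')} - {j}. S k)"
    using S_covers S_disjoint[OF j(1)] by blast
  then have "closed (- S j)" using closed_S by auto
  then have "S j = UNIV" using j(2) by (intro clopen_UNIV closed_S[OF j(1)]) auto
  then have sub: "curve_elements D i \<subseteq> curve_elements D' j" by (auto simp: S_def curve_elements_def)
  let ?g = "\<lambda>t. ((curves D' ! j) t, direction D' (j, t))"
  define T where "T k = ?g -` curve_elements D k" for k
  have cont: "continuous_on UNIV ?g" by (rule continuous_curve_element[OF D(2) j(1)])
  have closed_T: "closed (T k)" if "k < length (curves D)" for k
    unfolding T_def by (intro continuous_closed_vimage closed_curve_elements D that)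
      (use cont in \<open>auto simp: continuous_on_eq_continuous_at\<close>)
  \<comment> \<open>Inside the disc the diagrams are unrelated, so the parameters at which the curve
    of \<open>D'\<close> lies in it form a closed class of their own. It is disjoint from
    \<open>T i\<close> because curve \<open>i\<close> of \<open>D\<close> misses the disc.\<close>
  define I where "I = (curves D' ! j) -` cball c r"
  have closed_I: "closed I"
    unfolding I_def using regular_closed_curve_continuous(1)[OF regular_curve[OF D(2) j(1)], of UNIV]
    by (intro continuous_closed_vimage) (auto simp: continuous_on_eq_continuous_at)
  have T_disjoint: "k = l" if "k < length (curves D)" "l < length (curves D)" "t \<in> T k" "t \<in> T l" for k l t
    using curve_elements_disjoint[OF D(1) that(1,2)] that(3,4) by (simp add: T_def)
  have "T i \<inter> I = {}"
    using i(2) by (auto simp: T_def I_def curve_elements_def)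
  moreover have "t \<in> I \<or> (\<exists>k<length (curves D). t \<in> T k)" for t
  proof (cases "t \<in> I")
    case False
    then have nb: "(curves D' ! j) t \<notin> ball c r" by (auto simp: I_def)
    have "?g t \<in> line_elements D'"
      unfolding line_elements_Union[OF D(2)] curve_elements_def using j(1) by (intro UN_I[of j]) simp_all
    then have "?g t \<in> line_elements D" by (rule iffD1[OF line_elements_outside[OF le nb]])
    then show ?thesis by (simp add: line_elements_Union[OF D(1)] T_def Bex_def)
  qed simp
  ultimately have "- T i = I \<union> (\<Union>k\<in>{..<length (curves D)} - {i}. T k)"
    using T_disjoint[OF i(1)] by blast
  moreover have "closed (\<Union>k\<in>{..<length (curves D)} - {i}. T k)"
    by (intro closed_UN ballI closed_T) auto
  ultimately have "closed (- T i)" using closed_I by (simp only: closed_Un)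
  moreover have "T i \<noteq> {}"
  proof -
    have "?f 0 \<in> curve_elements D' j" using sub by (auto simp: curve_elements_def)
    then obtain t where "?f 0 = ?g t" by (auto simp: curve_elements_def)
    then have "t \<in> T i" unfolding T_def curve_elements_def by (auto intro: range_eqI[of _ _ 0])
    then show ?thesis by blast
  qed
  ultimately have Ti: "T i = UNIV" by (intro clopen_UNIV closed_T[OF i(1)])
  have "?g t \<in> curve_elements D i" for t
  proof -
    have "t \<in> T i" by (simp only: Ti UNIV_I)
    then show ?thesis by (simp only: T_def vimage_eq)
  qed
  then have "curve_elements D' j \<subseteq> curve_elements D i"
    unfolding curve_elements_def[of D' j] by (intro image_subsetI)
  then show ?thesis using sub j(1) by blast
qed

text \<open>
  A second parameter of \<open>q1\<close> at \<open>v\<close>, or a common one with \<open>q2\<close>, would make the two arcs overlap,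
  as only two strands pass through \<open>v\<close>; then they would coincide.
\<close>

lemma cut_crossing_arc:
  assumes D: "link_diagram D" and q1: "arc_inside D c r x1 y1 (i, s, t)" and q2: "arc_inside D c r x2 y2 (j, a, b)"
    and ends: "x1 \<notin> ball c r" "x2 \<notin> ball c r" "x1 \<noteq> x2"
    and v: "v \<in> open_arc D (i, s, t)" "v \<in> open_arc D (j, a, b)"
  shows "\<exists>u. s < u \<and> u < t \<and> (curves D ! i) u = v \<and> cut_arc D {v} (i, s, t) = [(i, s, u), (i, u, t)]"
proof -
  have i: "i < length (curves D)" "s < t" "(curves D ! i) s = x1" "(curves D ! i) ` {s<..<t} \<subseteq> ball c r"
    and j: "j < length (curves D)" "a < b" "(curves D ! j) a = x2" "(curves D ! j) ` {a<..<b} \<subseteq> ball c r"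
    using q1 q2 by (auto simp: arc_inside_def start_def open_arc_def)
  have ball_i: "(curves D ! i) x \<in> ball c r" if "s < x" "x < t" for x
    using i(4) that by (meson greaterThanLessThan_iff image_subset_iff)
  have ball_j: "(curves D ! j) x \<in> ball c r" if "a < x" "x < b" for x
    using j(4) that by (meson greaterThanLessThan_iff image_subset_iff)
  note shift = regular_closed_curve_shift[OF regular_curve[OF D i(1)]]
  have ts: "t \<le> s + 1"
  proof (rule ccontr)
    assume "\<not> t \<le> s + 1"
    then have "(curves D ! i) (s + of_int 1) \<in> ball c r" by (intro ball_i) simp_all
    then show False using i(3) ends(1) shift[of s 1] by simp
  qed
  obtain u where u: "s < u" "u < t" "(curves D ! i) u = v" using v(1) by (auto simp: open_arc_def)
  obtain w where w: "a < w" "w < b" "(curves D ! j) w = v" using v(2) by (auto simp: open_arc_def)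
  have no_overlap: "(i, frac u') \<noteq> (j, frac w)" if u': "s < u'" "u' < t" for u'
  proof
    assume eq: "(i, frac u') = (j, frac w)"
    define k where "k = \<lfloor>u'\<rfloor> - \<lfloor>w\<rfloor>"
    have k: "u' = w + of_int k" using eq by (simp add: k_def frac_def)
    have ij: "i = j" using eq by simp
    have "\<not> s < a + of_int k"
    proof
      assume "s < a + of_int k"
      then have "(curves D ! i) (a + of_int k) \<in> ball c r" using u' w k by (intro ball_i) simp_all
      then show False using shift[of a k] j(3) ends(2) ij by metis
    qed
    moreover have "\<not> a + of_int k < s"
    proof
      assume "a + of_int k < s"
      then have "(curves D ! i) (s - of_int k) \<in> ball c r" using u' w k ij ball_j[of "s - of_int k"] by simp
      then show False using shift[of s "- k"] i(3) ends(1) by (simp del: mem_ball)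
    qed
    ultimately have "s = a + of_int k" by simp
    then show False using shift[of a k] i(3) j(3) ends(3) ij by simp
  qed
  have unique: "u' = u" if u': "s < u'" "u' < t" "(curves D ! i) u' = v" for u'
  proof -
    have pos: "position D (i, frac u) = v" "position D (i, frac u') = v" "position D (j, frac w) = v"
      using position_frac(1)[OF D] i(1) j(1) u(3) w(3) u'(3) by simp_all
    note sp = strand_point_frac[OF i(1), of u] strand_point_frac[OF i(1), of u'] strand_point_frac[OF j(1), of w]
    have "{p \<in> strand_points D. position D p = v} = {(i, frac u), (j, frac w)}"
      using transverse_strands(2)[OF D sp(1,3) no_overlap[OF u(1,2)]] pos by simp
    then have "(i, frac u') = (i, frac u)" using sp(2) pos(2) no_overlap[OF u'(1,2)] by blast
    then have "u' - u = of_int (\<lfloor>u'\<rfloor> - \<lfloor>u\<rfloor>)" by (simp add: frac_def)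
    moreover have "\<bar>u' - u\<bar> < 1" using u u' ts by auto
    ultimately have "\<bar>\<lfloor>u'\<rfloor> - \<lfloor>u\<rfloor>\<bar> < 1" by linarith
    with \<open>u' - u = _\<close> show ?thesis by simp
  qed
  have "{u'. s < u' \<and> u' < t \<and> (curves D ! i) u' \<in> {v}} = {u}"
  proof (intro subset_antisym subsetI)
    fix u' assume "u' \<in> {u'. s < u' \<and> u' < t \<and> (curves D ! i) u' \<in> {v}}"
    then show "u' \<in> {u}" using unique[of u'] by simp
  qed (use u in simp)
  then have "cut_arc D {v} (i, s, t) = [(i, s, u), (i, u, t)]"
    unfolding cut_arc_def Let_def case_prod_conv by (simp only:) simp
  then show ?thesis using u by (intro exI[of _ u]) simp
qed

section \<open>Words in four pieces, and edges of interlacement graphs\<close>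

lemma adjacent_pairs_fst: "x \<in> set xs \<Longrightarrow> x = last xs \<or> (\<exists>y. (x, y) \<in> adjacent_pairs xs)"
  by (induction xs) (auto simp: adjacent_pairs_Cons)

definition straight_within :: "complex \<Rightarrow> ((complex \<times> complex) \<times> (complex \<times> complex)) list \<Rightarrow> bool" where
  "straight_within x gs \<longleftrightarrow> (\<forall>gg\<in>adjacent_pairs gs. fst (snd (fst gg)) = x \<longrightarrow> snd (fst gg) = fst (snd gg))"

lemma cyclic_pairs_append4:
  assumes "A \<noteq> []" "B \<noteq> []" "E \<noteq> []" "F \<noteq> []"
  shows "cyclic_pairs (A @ B @ E @ F) = adjacent_pairs A \<union> adjacent_pairs E \<union>
      (adjacent_pairs B \<union> adjacent_pairs F \<union> {(last A, hd B), (last B, hd E), (last E, hd F), (last F, hd A)})"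
  using assms by (auto simp: cyclic_pairs_def adjacent_pairs_append)

text \<open>No junction at a seam or inside \<open>B\<close> or \<open>F\<close> lies at
  \<open>x\<close>. The lemma is applied to the main circuits of both diagrams, with the outer parts
  as \<open>A\<close> and \<open>E\<close>.\<close>

lemma straight_append4:
  assumes ne: "A \<noteq> []" "B \<noteq> []" "E \<noteq> []" "F \<noteq> []"
    and x: "\<And>g. g \<in> set B \<union> set F \<Longrightarrow> fst (snd g) \<noteq> x"
      "fst (snd (last A)) \<noteq> x" "fst (snd (last E)) \<noteq> x"
  shows "straight x (A @ B @ E @ F) \<longleftrightarrow> straight_within x A \<and> straight_within x E"
proof -
  have "fst (snd (fst gg)) \<noteq> x"
    if "gg \<in> adjacent_pairs B \<union> adjacent_pairs F \<union> {(last A, hd B), (last B, hd E), (last E, hd F), (last F, hd A)}" for gg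
  proof -
    have "fst gg \<in> set B \<union> set F \<or> fst gg = last A \<or> fst gg = last E"
      using that adjacent_pairs_mem[of "fst gg" "snd gg"] last_in_set[OF ne(2)] last_in_set[OF ne(4)] by auto
    then show ?thesis using x by metis
  qed
  then show ?thesis
    unfolding straight_def straight_within_def cyclic_pairs_append4[OF ne] by blast
qed

lemma germ_simps [simp]:
  "fst (fst (germ D e)) = start D e" "fst (snd (germ D e)) = finish D e"
  by (cases e; simp add: germ_def)+

lemma image_of_iff: "x \<in> image_of D \<longleftrightarrow> (\<exists>u. (x, u) \<in> line_elements D)"
  by (auto simp: image_of_def line_elements_def)

lemma universe_arc_ends:
  assumes "e \<in> arcs (universe D)"
  shows "start D e \<in> classical D" "finish D e \<in> classical D"
  using assms by (simp_all add: universe_def)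

lemma interlaced_iff_alternate: "interlaced D C x y \<longleftrightarrow> x \<noteq> y \<and> (\<exists>p\<in>C. alternate x y (map (start D) p))"
  by (simp add: interlaced_def alternate_def)

lemma interlaced_sym: "interlaced D C x y \<longleftrightarrow> interlaced D C y x"
  unfolding interlaced_iff_alternate alternate_sym[of x y] by blast

text \<open>Finiteness matters because \<open>mset_set\<close> of an infinite set is empty. Symmetry
  of interlacement removes the choice of order of the two ends.\<close>

lemma edges_interlacement_graph:
  assumes "finite (classical D)"
  shows "{x, y} \<in># edges (interlacement_graph D C \<alpha> \<beta>) \<longleftrightarrow>
    (x = y \<and> negative_crossing D x) \<or> (x \<in> classical D \<and> y \<in> classical D \<and> interlaced D C x y)"
proof -
  let ?E = "{{v} | v. negative_crossing D v} \<union>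
        {{v, w} | v w. v \<in> classical D \<and> w \<in> classical D \<and> interlaced D C v w}"
  have "?E \<subseteq> Pow (classical D)" by (auto simp: negative_crossing_def)
  then have fin: "finite ?E" using assms finite_subset by blast
  have "{x, y} \<in> ?E \<longleftrightarrow> (x = y \<and> negative_crossing D x) \<or>
      (x \<in> classical D \<and> y \<in> classical D \<and> (interlaced D C x y \<or> interlaced D C y x))"
    by (auto simp: doubleton_eq_iff)
  then show ?thesis
    using fin interlaced_sym[of D C x y] by (simp add: interlacement_graph_def)
qed

lemma alternate_absent:
  assumes "alternate v w xs"
  shows "v \<in> set xs" "w \<in> set xs"
proof -
  obtain k where "subseq [v, w, v, w] (rotate k xs)" using assms by (auto simp: alternate_def)
  then have "z \<in> set xs" if "z \<in> set [v, w, v, w]" for z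
    using list_emb_set[OF _ that, of "(=)" "rotate k xs"] by auto
  then show "v \<in> set xs" "w \<in> set xs" by simp_all
qed

section \<open>Replacing the tangle by a crossing\<close>

text \<open>The sign of the new crossing is left open, so both replacements are instances.\<close>

locale tangle_replacement =
  fixes D D' :: diagram and C C' :: "oriented_arc list set" and c :: complex and r :: real
    and C11 C12 C13 C14 :: "oriented_arc list" and p1 p2 p3 p4 :: complex
    and q1 q2 :: oriented_arc and v :: complex
  assumes D: "link_diagram D" and tangle: "tangle D c r" and C: "euler_system D C"
    and through: "circuit_through_tangle D C c r C11 p1 C12 p2 C13 p3 C14 p4"
    and replaced: "tangle_replaced D c r p1 p2 p3 p4 D' q1 q2 v"
    and system_replaced: "euler_system_replaced D C c r C11 C13 D' q1 q2 v C'"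
begin

abbreviation "X \<equiv> sphere c r"

abbreviation "exterior \<equiv> classical D - cball c r"

abbreviation "main \<equiv> C11 @ C12 @ C13 @ C14"

definition "avoids_tangle p \<longleftrightarrow> (\<forall>e\<in>set p. open_arc D e \<inter> cball c r = {})" for p :: "oriented_arc list"

declare mem_sphere [simp del] mem_ball [simp del] mem_cball [simp del]

lemma cball_iff: "x \<in> cball c r \<longleftrightarrow> x \<in> ball c r \<or> x \<in> X"
  by (auto simp: mem_ball mem_cball mem_sphere)

lemma X_not_ball: "x \<in> X \<Longrightarrow> x \<notin> ball c r"
  by (simp add: mem_ball mem_sphere)

lemma D': "link_diagram D'"
  and le: "line_elements D' \<inter> (- ball c r) \<times> UNIV = line_elements D \<inter> (- ball c r) \<times> UNIV"
  and q1: "arc_inside D' c r p1 p2 q1" and q2: "arc_inside D' c r p3 p4 q2"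
  and image_ball: "image_of D' \<inter> ball c r = open_arc D' q1 \<union> open_arc D' q2"
  using replaced by (simp_all add: tangle_replaced_def)

lemma C': "euler_system D' C'"
  using system_replaced by (simp add: euler_system_replaced_def)

lemma r: "r > 0" and X_crossings: "X \<inter> crossings D = {}" and card_X: "card (X \<inter> image_of D) = 4"
  using tangle by (simp_all add: tangle_def)

lemma finite_X: "finite (X \<inter> image_of D)"
  using card_X by (intro card_ge_0_finite) simp

lemma X_points: "X \<inter> image_of D = {p1, p2, p3, p4}"
  using through by (simp add: circuit_through_tangle_def)

lemma p1_neq_p3: "p1 \<noteq> p3"
  using card_X unfolding X_points by (auto simp: card_insert_if split: if_splits)

lemma p_mem: "p1 \<in> X" "p2 \<in> X" "p3 \<in> X" "p4 \<in> X"
  using X_points by blast+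

lemma X_classical: "X \<inter> classical D = {}"
  using X_crossings classical_subset_crossings[OF D] by blast

lemma crossings_outside:
  assumes "x \<notin> ball c r"
  shows "x \<in> crossings D' \<longleftrightarrow> x \<in> crossings D"
  unfolding crossing_iff_line_elements[OF D] crossing_iff_line_elements[OF D'] line_elements_outside[OF le assms] ..

lemma X_image': "X \<inter> image_of D' = X \<inter> image_of D"
proof -
  have "x \<in> image_of D' \<longleftrightarrow> x \<in> image_of D" if "x \<in> X" for x
    using line_elements_outside[OF le X_not_ball[OF that]] by (simp only: image_of_iff)
  then show ?thesis by blast
qed

lemma finite_X': "finite (X \<inter> image_of D')"
  unfolding X_image' by (rule finite_X)

lemma X_crossings': "X \<inter> crossings D' = {}"
  using X_crossings crossings_outside X_not_ball by blast

lemma v_ball: "v \<in> ball c r" and v_classical: "v \<in> classical D'"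
  using replaced by (auto simp: tangle_replaced_def)

lemma classical_off_ball: "classical D' - ball c r = classical D - ball c r"
  using replaced by (simp add: tangle_replaced_def)

lemma exterior_eq: "exterior = classical D - ball c r"
  using X_classical by (auto simp: cball_iff)

lemma classical': "classical D' = insert v exterior"
proof -
  have "classical D' \<inter> ball c r = {v}" using replaced by (simp add: tangle_replaced_def)
  then show ?thesis using classical_off_ball unfolding exterior_eq by blast
qed

lemma v_exterior: "v \<notin> exterior"
  using v_ball unfolding exterior_eq by simp

lemma exterior_not_ball: "x \<in> exterior \<Longrightarrow> x \<notin> ball c r"
  by (simp add: cball_iff)

lemma negative_crossing_exterior:
  assumes x: "x \<in> exterior"
  shows "negative_crossing D' x \<longleftrightarrow> negative_crossing D x"
proof -
  have "over D' x = over D x"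
    using replaced x unfolding exterior_eq by (simp add: tangle_replaced_def)
  moreover have "x \<in> classical D'" "x \<in> classical D" using x classical' by auto
  ultimately show ?thesis
    unfolding negative_crossing_iff line_elements_outside[OF le exterior_not_ball[OF x]] by simp
qed

lemma parts_nonempty: "C11 \<noteq> []" "C12 \<noteq> []" "C13 \<noteq> []" "C14 \<noteq> []"
  and parts_finish: "finish D (last C11) = p1" "finish D (last C12) = p2"
    "finish D (last C13) = p3" "finish D (last C14) = p4"
  and parts_outside: "e \<in> set C11 \<union> set C13 \<Longrightarrow> open_arc D e \<inter> cball c r = {}"
  and parts_inside: "e \<in> set C12 \<union> set C14 \<Longrightarrow> open_arc D e \<subseteq> ball c r"
  using through unfolding circuit_through_tangle_def by blast+

section \<open>The circuit through the tangle\<close>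

text \<open>A circuit without classical crossings does not belong to \<open>C\<close>, which is why
  a free loop appears as a second case here and in what follows.\<close>

lemma main_cases:
  obtains (circuit) p k where "p \<in> C" "main = rotate k (concat (map (cut_arc D X) p))"
  | (free_loop) i s k where "i \<in> universe_free_loops D" "0 \<le> s" "s < 1" "main = rotate k (cut_arc D X (i, s, s + 1))"
proof -
  obtain q k where q: "q \<in> cut_circuits D C X" "rotate k q = main"
    using through by (auto simp: circuit_through_tangle_def)
  from q(1) consider p where "p \<in> C" "q = concat (map (cut_arc D X) p)"
    | i s where "i \<in> universe_free_loops D" "0 \<le> s" "s < 1" "q = cut_arc D X (i, s, s + 1)"
    unfolding cut_circuits_def by blast
  then show ?thesis
  proof cases
    case 1
    then show ?thesis using circuit[of p k] q(2) by simp
  next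
    case 2
    then show ?thesis using free_loop[of i s k] q(2) by simp
  qed
qed

lemma cut_circuit_piece:
  assumes "link_diagram E" "euler_system E K" "p \<in> K" "finite (X \<inter> image_of E)"
    and f: "f \<in> set (concat (map (cut_arc E X) p))"
  obtains i s t a b where "(i, s, t) \<in> set p" "(i, s, t) \<in> arcs (universe E)" "f = (i, a, b)" "s \<le> a" "a < b" "b \<le> t"
proof -
  obtain e where e: "e \<in> set p" "f \<in> set (cut_arc E X e)" using f by auto
  obtain i s t where e': "e = (i, s, t)" by (cases e)
  obtain j a b where f': "f = (j, a, b)" by (cases f)
  have mem: "(i, s, t) \<in> arcs (universe E)" using euler_system_arc(2)[OF assms(1-3)] e e' by auto
  have "j = i \<and> s \<le> a \<and> a < b \<and> b \<le> t"
    using cut_arc_mem[OF assms(1) arcs_universeD(1)[OF mem] arcs_universeD(4)[OF mem]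
        universe_arc_length[OF assms(1) mem] assms(4), of j a b] e(2) e' f' by simp
  then show ?thesis using that[of i s t a b] e e' f' mem by simp
qed

lemma cut_circuit_arc_of:
  assumes "link_diagram E" "euler_system E K" "p \<in> K" "finite (X \<inter> image_of E)"
    and "f \<in> set (concat (map (cut_arc E X) p))"
  shows "arc_of E f"
  using cut_circuit_piece[OF assms] by (metis arcs_universeD(1) arc_of_def case_prod_conv)

lemma free_loop_piece:
  assumes "i \<in> universe_free_loops D" "0 \<le> s" "s < 1" "f \<in> set (cut_arc D X (i, s, s + 1))"
  shows "\<exists>a b. f = (i, a, b) \<and> i < length (curves D) \<and> a < b \<and> start D f \<notin> classical D \<and> finish D f \<notin> classical D"
proof -
  obtain j a b where f: "f = (j, a, b)" by (cases f)
  have i: "i < length (curves D)" "range (curves D ! i) \<inter> classical D = {}"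
    using assms(1) by (auto simp: universe_free_loops_def)
  have "j = i \<and> s \<le> a \<and> a < b \<and> b \<le> s + 1"
    using cut_arc_mem[OF D i(1) _ _ finite_X, of s "s + 1" j a b] assms(4) f by simp
  moreover have "(curves D ! i) a \<notin> classical D" for a using i(2) by blast
  ultimately show ?thesis using i(1) f by (simp add: start_def finish_def)
qed

lemma main_arc_of:
  assumes "e \<in> set main"
  shows "arc_of D e"
proof (cases rule: main_cases)
  case (circuit p k)
  have "e \<in> set (concat (map (cut_arc D X) p))" using assms circuit(2) by (metis set_rotate)
  then show ?thesis by (rule cut_circuit_arc_of[OF D C circuit(1) finite_X])
next
  case (free_loop i s k)
  have "e \<in> set (cut_arc D X (i, s, s + 1))" using assms free_loop(4) by (metis set_rotate)
  then show ?thesis using free_loop_piece[OF free_loop(1-3)] by (auto simp: arc_of_def)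
qed

lemma parts_arc_of:
  "e \<in> set C11 \<Longrightarrow> arc_of D e" "e \<in> set C12 \<Longrightarrow> arc_of D e"
  "e \<in> set C13 \<Longrightarrow> arc_of D e" "e \<in> set C14 \<Longrightarrow> arc_of D e"
  by (auto intro: main_arc_of)

lemma parts_outside_ends:
  assumes "e \<in> set C11 \<union> set C13"
  shows "start D e \<notin> ball c r" "finish D e \<notin> ball c r"
  using arc_outside_ends[OF D _ parts_outside[OF assms]] parts_arc_of assms by blast+

lemma parts_inside_ends:
  assumes "e \<in> set C12 \<union> set C14"
  shows "start D e \<in> cball c r" "finish D e \<in> cball c r"
  using arc_inside_ends[OF D _ parts_inside[OF assms]] parts_arc_of assms by blast+

text \<open>Junctions made by cutting lie on the circle, which contains no classical crossing. So a
  junction at a classical point is one of the original circuit, and a free loop has none.\<close>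

lemma main_chain:
  assumes ee: "(e, e') \<in> cyclic_pairs main" and fin: "finish D e \<in> classical D"
  shows "start D e' = finish D e"
proof (cases rule: main_cases)
  case (circuit p k)
  note cut = cut_circuit_arc[OF D C circuit(1) finite_X]
  have "(e, e') \<in> cyclic_pairs (concat (map (cut_arc D X) p))"
    using ee unfolding circuit(2) cyclic_pairs_rotate .
  then consider e0 where "e0 \<in> set p" "(e, e') \<in> adjacent_pairs (cut_arc D X e0)"
    | e0 e1 where "(e0, e1) \<in> cyclic_pairs p" "e = last (cut_arc D X e0)" "e' = hd (cut_arc D X e1)"
    unfolding cut_circuit_pairs[OF D C circuit(1) finite_X] by (elim UnE UN_E imageE) auto
  then show ?thesis
  proof cases
    case 1
    then show ?thesis using cut(6) fin X_classical by blast
  next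
    case 2
    have mem: "e0 \<in> set p" "e1 \<in> set p" using cyclic_pairs_mem[OF 2(1)] by simp_all
    show ?thesis
      using cut(3)[OF mem(1)] cut(5)[OF mem(2)] euler_system_arc(3)[OF D C circuit(1) 2(1)] 2(2,3) by simp
  qed
next
  case (free_loop i s k)
  have "e \<in> set main" using cyclic_pairs_mem[OF ee] by simp
  then have "e \<in> set (cut_arc D X (i, s, s + 1))" using free_loop(4) by (metis set_rotate)
  then show ?thesis using free_loop_piece[OF free_loop(1-3)] fin by blast
qed

lemma main_point:
  assumes "x \<in> X \<inter> image_of D"
  obtains e where "e \<in> set main" "finish D e = x"
proof -
  from assms consider "x = p1" | "x = p2" | "x = p3" | "x = p4" unfolding X_points by blast
  then have "\<exists>e\<in>set main. finish D e = x"
  proof cases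
    case 1 then show ?thesis using parts_finish(1) last_in_set[OF parts_nonempty(1)] by auto
  next
    case 2 then show ?thesis using parts_finish(2) last_in_set[OF parts_nonempty(2)] by auto
  next
    case 3 then show ?thesis using parts_finish(3) last_in_set[OF parts_nonempty(3)] by auto
  next
    case 4 then show ?thesis using parts_finish(4) last_in_set[OF parts_nonempty(4)] by auto
  qed
  then show ?thesis using that by blast
qed

text \<open>All points of the diagram on the circle are ends of pieces of the main circuit, and none
  of them is a crossing. Hence only one strand passes there, so \<open>e\<close> overlaps an arc of
  the main circuit and equals it.\<close>

lemma crossing_sphere_is_main:
  assumes p: "p \<in> C" and e: "e \<in> set p" and meets: "open_arc D e \<inter> X \<noteq> {}"
  shows "\<exists>k. main = rotate k (concat (map (cut_arc D X) p))"
proof -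
  obtain i s t where e': "e = (i, s, t)" by (cases e)
  have mem: "(i, s, t) \<in> arcs (universe D)" using euler_system_arc(2)[OF D C p] e e' by auto
  note a = arcs_universeD[OF mem]
  obtain u where u: "s < u" "u < t" "(curves D ! i) u \<in> X" using meets by (auto simp: e' open_arc_def)
  have "(curves D ! i) u \<in> image_of D"
    using strand_point_frac[OF a(1), of u] position_frac(1)[OF D a(1), of u] unfolding image_of_def by force
  then obtain f where f: "f \<in> set main" "finish D f = (curves D ! i) u"
    using main_point[of "(curves D ! i) u"] u(3) by blast
  obtain j a' b where f': "f = (j, a', b)" by (cases f)
  have j: "j < length (curves D)" using main_arc_of[OF f(1)] by (simp add: f' arc_of_def)
  have fb: "(curves D ! i) u = (curves D ! j) b" using f(2) by (simp add: f' finish_def)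
  have "(curves D ! i) u \<notin> crossings D" using X_crossings u(3) by blast
  then have ij: "i = j" "frac u = frac b"
    using curve_strand_unique[OF D a(1) j fb] by blast+
  show ?thesis
  proof (cases rule: main_cases)
    case (circuit p' k)
    have "f \<in> set (concat (map (cut_arc D X) p'))" using f(1) circuit(2) by (metis set_rotate)
    then obtain i' s' t' a'' b' where p': "(i', s', t') \<in> set p'" "(i', s', t') \<in> arcs (universe D)"
      and f'': "f = (i', a'', b')" "s' \<le> a''" "a'' < b'" "b' \<le> t'"
      by (rule cut_circuit_piece[OF D C circuit(1) finite_X])
    have "i' = i" "b' = b" using f' f''(1) ij(1) by simp_all
    \<comment> \<open>Arcs of the universe end at classical points, so a point of the circle is
      interior to its arc.\<close>
    have "b \<noteq> t'"
    proof
      assume "b = t'"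
      then have "(curves D ! i) u \<in> classical D" using fb ij(1) arcs_universeD(6)[OF p'(2)] \<open>i' = i\<close> by simp
      then show False using u(3) X_classical by blast
    qed
    then have b: "s' < b" "b < t'" using f'' \<open>b' = b\<close> by auto
    have "s = s'" "t = t'"
      using universe_arc_overlap[OF D mem p'(2)[unfolded \<open>i' = i\<close>] u(1,2) b ij(2)] by simp_all
    then have "e \<in> set p'" using p'(1) e' \<open>i' = i\<close> by simp
    then have "p = p'" using euler_system_circuit_unique[OF D C p circuit(1) e] by simp
    then show ?thesis using circuit(2) by blast
  next
    case (free_loop i' s' k)
    have "f \<in> set (cut_arc D X (i', s', s' + 1))" using f(1) free_loop(4) by (metis set_rotate)
    then have "i' = i" using free_loop_piece[OF free_loop(1-3)] f' ij(1) by auto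
    then have "(curves D ! i) s \<notin> classical D" using free_loop(1) by (auto simp: universe_free_loops_def)
    then show ?thesis using a(5) by simp
  qed
qed

text \<open>If no arc of the circuit meets the circle, each arc stays on one side by connectedness,
  and the common ends of consecutive arcs carry the side all the way round.\<close>

lemma circuit_cases:
  assumes p: "p \<in> C"
  obtains (out) "avoids_tangle p"
  | (ins) "\<And>e. e \<in> set p \<Longrightarrow> start D e \<in> ball c r \<and> finish D e \<in> ball c r"
  | (main) k where "main = rotate k (concat (map (cut_arc D X) p))"
proof (cases "\<forall>e\<in>set p. open_arc D e \<inter> X = {}")
  case False
  then show ?thesis using crossing_sphere_is_main[OF p] main by blast
next
  case True
  have arc: "e \<in> arcs (universe D)" if "e \<in> set p" for e using euler_system_arc(2)[OF D C p] that by blast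
  have ends: "start D e \<notin> X" "finish D e \<notin> X" if "e \<in> set p" for e
    using universe_arc_ends[OF arc[OF that]] X_classical by blast+
  have avoid: "start D e \<in> ball c r \<longleftrightarrow> finish D e \<in> ball c r"
    "start D e \<notin> ball c r \<Longrightarrow> open_arc D e \<inter> cball c r = {}" if "e \<in> set p" for e
    using arc_avoiding_sphere[OF D universe_arc_of[OF arc[OF that]] r] True that ends by blast+
  have step: "start D e \<in> ball c r \<longleftrightarrow> start D e' \<in> ball c r" if "(e, e') \<in> cyclic_pairs p" for e e'
    using euler_system_arc(3)[OF D C p that] avoid(1)[of e] cyclic_pairs_mem[OF that] by simp
  show ?thesis
  proof (cases "\<exists>e\<in>set p. start D e \<in> ball c r")
    case True
    then obtain e where e: "e \<in> set p" "start D e \<in> ball c r" by blast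
    have "start D e' \<in> ball c r" if "e' \<in> set p" for e'
      using cyclic_pairs_invariant[of e p "\<lambda>e. start D e \<in> ball c r" e'] e that step by blast
    then show ?thesis using ins avoid(1) by blast
  next
    case False
    then show ?thesis using out avoid(2) unfolding avoids_tangle_def by blast
  qed
qed

section \<open>Marks and interlacement in the given diagram\<close>

lemma straight_main:
  assumes x: "x \<in> exterior"
  shows "straight x (map (germ D) main) \<longleftrightarrow>
    straight_within x (map (germ D) C11) \<and> straight_within x (map (germ D) C13)"
  unfolding map_append
proof (rule straight_append4)
  have xX: "x \<notin> X" using x X_classical by blast
  fix g assume "g \<in> set (map (germ D) C12) \<union> set (map (germ D) C14)"
  then show "fst (snd g) \<noteq> x" using parts_inside_ends(2) x by force
next
  have xX: "x \<notin> X" using x X_classical by blast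
  then show "fst (snd (last (map (germ D) C11))) \<noteq> x" "fst (snd (last (map (germ D) C13))) \<noteq> x"
    using parts_nonempty parts_finish p_mem by (auto simp: last_map)
qed (use parts_nonempty in auto)

lemma straight_vacuous:
  assumes "\<And>e. e \<in> set p \<Longrightarrow> finish E e \<noteq> x"
  shows "straight x (map (germ E) p)"
  unfolding straight_map_germ using assms cyclic_pairs_mem by (metis prod.collapse)

text \<open>Circuits inside the circle never reach \<open>x\<close>, and \<open>C12\<close> and
  \<open>C14\<close> have their ends in the closed disc, so only the outer parts and the avoiding
  circuits matter. If the main circuit is a free loop, its condition holds vacuously.\<close>

lemma follows_old:
  assumes x: "x \<in> exterior"
  shows "follows_component D C x \<longleftrightarrow>
    straight_within x (map (germ D) C11) \<and> straight_within x (map (germ D) C13) \<and>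
    (\<forall>p\<in>C. avoids_tangle p \<longrightarrow> straight x (map (germ D) p))"
proof -
  have xX: "x \<notin> X" using x X_classical by blast
  have rot: "straight x (map (germ D) main) \<longleftrightarrow> straight x (map (germ D) p)"
    if "p \<in> C" "main = rotate k (concat (map (cut_arc D X) p))" for p k
    unfolding that(2) rotate_map[symmetric] straight_rotate straight_cut_circuit[OF D C that(1) finite_X xX] ..
  have "straight x (map (germ D) main)" if *: "\<forall>p\<in>C. straight x (map (germ D) p)"
  proof (cases rule: main_cases)
    case (circuit p k)
    then show ?thesis using rot * by blast
  next
    case (free_loop i s k)
    show ?thesis
    proof (rule straight_vacuous)
      fix e assume "e \<in> set main"
      then have "e \<in> set (cut_arc D X (i, s, s + 1))" using free_loop(4) by (metis set_rotate)
      then show "finish D e \<noteq> x" using free_loop_piece[OF free_loop(1-3)] x by blast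
    qed
  qed
  moreover have "straight x (map (germ D) p)"
    if main: "straight x (map (germ D) main)" and out: "\<forall>p\<in>C. avoids_tangle p \<longrightarrow> straight x (map (germ D) p)"
      and p: "p \<in> C" for p
  proof (cases rule: circuit_cases[OF p])
    case 1
    then show ?thesis using out p by blast
  next
    case 2
    then show ?thesis using exterior_not_ball[OF x] by (intro straight_vacuous) blast
  next
    case (3 k)
    then show ?thesis using rot[OF p] main by blast
  qed
  ultimately show ?thesis
    unfolding follows_component_iff_straight[OF D C] straight_main[OF x, symmetric] conj_assoc[symmetric]
      straight_main[OF x, symmetric] by blast
qed

lemma alternate_main:
  assumes "x \<in> exterior" "y \<in> exterior"
  shows "alternate x y (map (start D) main) \<longleftrightarrow> alternate x y (map (start D) C11 @ map (start D) C13)"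
proof -
  have "filter (\<lambda>z. z = x \<or> z = y) (map (start D) C12) = []" "filter (\<lambda>z. z = x \<or> z = y) (map (start D) C14) = []"
    using parts_inside_ends(1) assms by (auto simp: filter_empty_conv)
  then have eq: "filter (\<lambda>z. z = x \<or> z = y) (map (start D) main) =
      filter (\<lambda>z. z = x \<or> z = y) (map (start D) C11 @ map (start D) C13)" by simp
  have fil: "alternate x y xs \<longleftrightarrow> alternate x y (filter (\<lambda>z. z = x \<or> z = y) xs)" for xs
    by (subst alternate_filter) simp_all
  show ?thesis
    unfolding fil[of "map (start D) main"] fil[of "map (start D) C11 @ map (start D) C13"] eq ..
qed

lemma interlaced_old:
  assumes x: "x \<in> exterior" and y: "y \<in> exterior"
  shows "interlaced D C x y \<longleftrightarrow> x \<noteq> y \<and> (alternate x y (map (start D) C11 @ map (start D) C13) \<or>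
    (\<exists>p\<in>C. avoids_tangle p \<and> alternate x y (map (start D) p)))"
proof -
  have xyX: "x \<notin> X" "y \<notin> X" using x y X_classical by blast+
  have rot: "alternate x y (map (start D) main) \<longleftrightarrow> alternate x y (map (start D) p)"
    if "p \<in> C" "main = rotate k (concat (map (cut_arc D X) p))" for p k
    unfolding that(2) rotate_map[symmetric] alternate_rotate alternate_cut_circuit[OF D C that(1) finite_X xyX] ..
  have "alternate x y (map (start D) main) \<or> (\<exists>p\<in>C. avoids_tangle p \<and> alternate x y (map (start D) p))"
    if p: "p \<in> C" and alt: "alternate x y (map (start D) p)" for p
  proof (cases rule: circuit_cases[OF p])
    case 1
    then show ?thesis using p alt by blast
  next
    case 2
    then show ?thesis using alternate_absent(1)[OF alt] exterior_not_ball[OF x] by auto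
  next
    case (3 k)
    then show ?thesis using rot[OF p] alt by blast
  qed
  moreover have "\<exists>p\<in>C. alternate x y (map (start D) p)" if alt: "alternate x y (map (start D) main)"
  proof (cases rule: main_cases)
    case (circuit p k)
    then show ?thesis using rot alt by blast
  next
    case (free_loop i s k)
    obtain e where e: "e \<in> set main" "start D e = x" using alternate_absent(1)[OF alt] by auto
    then have "e \<in> set (cut_arc D X (i, s, s + 1))" using free_loop(4) by (metis set_rotate)
    then show ?thesis using free_loop_piece[OF free_loop(1-3)] e(2) x by blast
  qed
  ultimately show ?thesis
    unfolding interlaced_iff_alternate alternate_main[OF x y, symmetric] by blast
qed

text \<open>\<open>visited\<close> counts both ends of arcs while words list only starts. A
  classical end does not belong to the last arc of the part, which ends on the circle, and so it is
  the start of the next arc.\<close>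

lemma visited_part:
  assumes A: "A \<noteq> []" "finish D (last A) \<in> X" "adjacent_pairs A \<subseteq> cyclic_pairs main" and x: "x \<in> classical D"
  shows "x \<in> visited D A \<longleftrightarrow> x \<in> set (map (start D) A)"
proof
  assume "x \<in> visited D A"
  then consider e where "e \<in> set A" "x = start D e" | e where "e \<in> set A" "x = finish D e"
    by (auto simp: visited_def)
  then show "x \<in> set (map (start D) A)"
  proof cases
    case 1
    then show ?thesis by simp
  next
    case 2
    then have "e \<noteq> last A" using A(2) x X_classical by blast
    then obtain e' where e': "(e, e') \<in> adjacent_pairs A" using adjacent_pairs_fst[OF 2(1)] by blast
    then have "x = start D e'" using main_chain[of e e'] A(3) 2 x by auto
    then show ?thesis using adjacent_pairs_mem[OF e'] by simp
  qed
qed (use x in \<open>auto simp: visited_def\<close>)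

lemma visited_parts:
  assumes "x \<in> classical D"
  shows "x \<in> visited D C11 \<longleftrightarrow> x \<in> set (map (start D) C11)"
    "x \<in> visited D C13 \<longleftrightarrow> x \<in> set (map (start D) C13)"
proof -
  have "adjacent_pairs C11 \<subseteq> cyclic_pairs main" "adjacent_pairs C13 \<subseteq> cyclic_pairs main"
    using parts_nonempty by (auto simp: cyclic_pairs_def adjacent_pairs_append)
  then show "x \<in> visited D C11 \<longleftrightarrow> x \<in> set (map (start D) C11)"
    "x \<in> visited D C13 \<longleftrightarrow> x \<in> set (map (start D) C13)"
    using visited_part[OF parts_nonempty(1) _ _ assms] visited_part[OF parts_nonempty(3) _ _ assms]
      parts_finish p_mem by simp_all
qed

lemma visited_exterior: "visited D C11 \<inter> visited D C13 \<subseteq> exterior"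
proof
  fix x assume x: "x \<in> visited D C11 \<inter> visited D C13"
  then have "x \<in> classical D" by (simp add: visited_def)
  moreover have "x \<notin> ball c r" using x parts_outside_ends unfolding visited_def by blast
  ultimately show "x \<in> exterior" unfolding exterior_eq by simp
qed


section \<open>Circuits of the new diagram\<close>

text \<open>Each of the two arcs is cut once, at \<open>v\<close>, and its halves share the tangent
  \<open>\<delta>\<close> there because they belong to one smooth curve. This is what makes
  \<open>v\<close> unmarked.\<close>

lemma cut_q1_q2:
  "\<exists>x \<delta> y. map (germ D') (cut_arc D' {v} q1) = [((p1, x), (v, \<delta>)), ((v, \<delta>), (p2, y))] \<and>
    (\<forall>e\<in>set (cut_arc D' {v} q1). arc_of D' e)" (is ?first)
  "\<exists>x \<delta> y. map (germ D') (cut_arc D' {v} q2) = [((p3, x), (v, \<delta>)), ((v, \<delta>), (p4, y))] \<and>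
    (\<forall>e\<in>set (cut_arc D' {v} q2). arc_of D' e)" (is ?second)
proof -
  obtain i s t where i: "q1 = (i, s, t)" by (cases q1)
  obtain j a b where j: "q2 = (j, a, b)" by (cases q2)
  have "v \<in> crossings D' \<inter> ball c r" using v_ball v_classical classical_subset_crossings[OF D'] by blast
  then have v: "v \<in> open_arc D' q1" "v \<in> open_arc D' q2"
    using replaced by (auto simp: tangle_replaced_def)
  have nb: "p1 \<notin> ball c r" "p3 \<notin> ball c r" using X_not_ball p_mem by blast+
  obtain u where u: "s < u" "u < t" "(curves D' ! i) u = v" "cut_arc D' {v} (i, s, t) = [(i, s, u), (i, u, t)]"
    using cut_crossing_arc[OF D' q1[unfolded i] q2[unfolded j] nb p1_neq_p3 v[unfolded i j]] by blast
  obtain w where w: "a < w" "w < b" "(curves D' ! j) w = v" "cut_arc D' {v} (j, a, b) = [(j, a, w), (j, w, b)]"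
    using cut_crossing_arc[OF D' q2[unfolded j] q1[unfolded i] nb(2,1) p1_neq_p3[symmetric] v(2,1)[unfolded i j]] by blast
  show ?first
    using u q1 by (auto simp: i germ_def start_def finish_def arc_inside_def arc_of_def)
  show ?second
    using w q2 by (auto simp: j germ_def start_def finish_def arc_inside_def arc_of_def)
qed

lemma avoiding_arcs:
  assumes "p \<in> C" "avoids_tangle p" "e \<in> set p"
  shows "arc_of D e" "start D e \<notin> ball c r" "finish D e \<notin> ball c r"
proof -
  have "e \<in> arcs (universe D)" using euler_system_arc(2)[OF D C assms(1)] assms(3) by blast
  then show arc: "arc_of D e" by (rule universe_arc_of)
  show "start D e \<notin> ball c r" "finish D e \<notin> ball c r"
    using arc_outside_ends[OF D arc] assms(2,3) unfolding avoids_tangle_def by blast+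
qed

abbreviation "exchanged_germs x1 \<delta>1 y1 x2 \<delta>2 y2 \<equiv>
  map (germ D) C11 @ [((p1, x1), (v, \<delta>1)), ((v, \<delta>1), (p2, y1))] @
  map (germ D) C13 @ [((p3, x2), (v, \<delta>2)), ((v, \<delta>2), (p4, y2))]"

abbreviation "germs_rotated p p' \<equiv> \<exists>k. map (germ D) p = rotate k (map (germ D') p')"

text \<open>From here on the new Euler system enters through germs: those of the exchanged main
  circuit, and the correspondence, up to rotation, of the remaining circuits with those avoiding the
  tangle.\<close>

lemma exchanged_circuits:
  obtains p0 k x1 \<delta>1 y1 x2 \<delta>2 y2 where "p0 \<in> C'"
    "rotate k (map (germ D') (concat (map (cut_arc D' X) p0))) =
      exchanged_germs x1 \<delta>1 y1 x2 \<delta>2 y2"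
    "\<forall>p\<in>C. avoids_tangle p \<longrightarrow> (\<exists>p'\<in>C' - {p0}. germs_rotated p p')"
    "\<forall>p'\<in>C' - {p0}. \<exists>p\<in>C. avoids_tangle p \<and> germs_rotated p p'"
proof -
  obtain x1 \<delta>1 y1 where g1: "map (germ D') (cut_arc D' {v} q1) = [((p1, x1), (v, \<delta>1)), ((v, \<delta>1), (p2, y1))]"
    "\<forall>e\<in>set (cut_arc D' {v} q1). arc_of D' e" using cut_q1_q2(1) by (elim exE conjE) (rule that)
  obtain x2 \<delta>2 y2 where g2: "map (germ D') (cut_arc D' {v} q2) = [((p3, x2), (v, \<delta>2)), ((v, \<delta>2), (p4, y2))]"
    "\<forall>e\<in>set (cut_arc D' {v} q2). arc_of D' e" using cut_q1_q2(2) by (elim exE conjE) (rule that)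
  have "\<exists>p0. p0 \<in> C' \<and> same_circuit
          (map (arc_path D) C11 @ map (arc_path D') (cut_arc D' {v} q1) @
           map (arc_path D) C13 @ map (arc_path D') (cut_arc D' {v} q2))
          (map (arc_path D') (concat (map (cut_arc D' X) p0))) \<and>
      (\<forall>p\<in>C. avoids_tangle p \<longrightarrow>
           (\<exists>p'\<in>C' - {p0}. same_circuit (map (arc_path D) p) (map (arc_path D') p'))) \<and>
      (\<forall>p'\<in>C' - {p0}. \<exists>p\<in>C. avoids_tangle p \<and> same_circuit (map (arc_path D) p) (map (arc_path D') p'))"
    using system_replaced unfolding euler_system_replaced_def avoids_tangle_def Bex_def by (rule conjunct2)
  then obtain p0 where p0: "p0 \<in> C'"
    and sc: "same_circuit
          (map (arc_path D) C11 @ map (arc_path D') (cut_arc D' {v} q1) @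
           map (arc_path D) C13 @ map (arc_path D') (cut_arc D' {v} q2))
          (map (arc_path D') (concat (map (cut_arc D' X) p0)))"
    and out: "\<forall>p\<in>C. avoids_tangle p \<longrightarrow>
           (\<exists>p'\<in>C' - {p0}. same_circuit (map (arc_path D) p) (map (arc_path D') p'))"
    and inward: "\<forall>p'\<in>C' - {p0}. \<exists>p\<in>C. avoids_tangle p \<and> same_circuit (map (arc_path D) p) (map (arc_path D') p')"
    by (elim exE conjE) (rule that)
  obtain k where k: "list_all2 same_arc
          (map (arc_path D) C11 @ map (arc_path D') (cut_arc D' {v} q1) @
           map (arc_path D) C13 @ map (arc_path D') (cut_arc D' {v} q2))
          (rotate k (map (arc_path D') (concat (map (cut_arc D' X) p0))))"
    using sc unfolding same_circuit_def by blast
  let ?zs = "map (Pair D) C11 @ map (Pair D') (cut_arc D' {v} q1) @ map (Pair D) C13 @ map (Pair D') (cut_arc D' {v} q2)"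
  let ?ws = "map (Pair D') (rotate k (concat (map (cut_arc D' X) p0)))"
  have Q0: "arc_of D' e" if "e \<in> set (concat (map (cut_arc D' X) p0))" for e
    by (rule cut_circuit_arc_of[OF D' C' p0 finite_X' that])
  have "list_all2 same_arc (map (\<lambda>z. arc_path (fst z) (snd z)) ?zs) (map (\<lambda>z. arc_path (fst z) (snd z)) ?ws)"
    using k by (simp add: rotate_map o_def)
  moreover have "\<forall>z\<in>set ?zs \<union> set ?ws. link_diagram (fst z) \<and> arc_of (fst z) (snd z)"
  proof
    fix z assume "z \<in> set ?zs \<union> set ?ws"
    then consider e where "z = (D, e)" "e \<in> set C11 \<union> set C13"
      | e where "z = (D', e)" "e \<in> set (cut_arc D' {v} q1) \<union> set (cut_arc D' {v} q2)"
      | e where "z = (D', e)" "e \<in> set (concat (map (cut_arc D' X) p0))"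
      unfolding set_append set_map set_rotate by (elim UnE imageE) blast+
    then show "link_diagram (fst z) \<and> arc_of (fst z) (snd z)"
    proof cases
      case 1
      then show ?thesis using D parts_arc_of(1,3) by (metis UnE fst_conv snd_conv)
    next
      case 2
      then show ?thesis using D' g1(2) g2(2) by (metis UnE fst_conv snd_conv)
    next
      case 3
      then show ?thesis using D' Q0 by simp
    qed
  qed
  ultimately have "map (\<lambda>z. germ (fst z) (snd z)) ?zs = map (\<lambda>z. germ (fst z) (snd z)) ?ws"
    by (rule list_all2_same_arc_germs)
  then have G: "rotate k (map (germ D') (concat (map (cut_arc D' X) p0))) =
      exchanged_germs x1 \<delta>1 y1 x2 \<delta>2 y2"
    using g1(1) g2(1) by (simp add: rotate_map o_def)
  have germs: "germs_rotated p p'"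
    if sc: "same_circuit (map (arc_path D) p) (map (arc_path D') p')" and p: "p \<in> C" "avoids_tangle p" and p': "p' \<in> C'" for p p'
  proof -
    have "arc_of D' e" if "e \<in> set p'" for e
      using euler_system_arc(2)[OF D' C' p'] that universe_arc_of by blast
    from same_circuit_germs[OF sc D D' avoiding_arcs(1)[OF p] this] show ?thesis by blast
  qed
  show ?thesis
  proof (rule that[OF p0 G]; intro ballI impI)
    fix p assume p: "p \<in> C" "avoids_tangle p"
    obtain p' where "p' \<in> C' - {p0}" "same_circuit (map (arc_path D) p) (map (arc_path D') p')"
      using out p by blast
    then show "\<exists>p'\<in>C' - {p0}. germs_rotated p p'" using germs p by blast
  next
    fix p' assume p': "p' \<in> C' - {p0}"
    obtain p where "p \<in> C" "avoids_tangle p" "same_circuit (map (arc_path D) p) (map (arc_path D') p')"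
      using inward p' by blast
    then show "\<exists>p\<in>C. avoids_tangle p \<and> germs_rotated p p'" using germs p' by blast
  qed
qed

lemma starts_of_germs:
  assumes "map (germ E) p = rotate k (map (germ E') p')"
  shows "map (start E) p = rotate k (map (start E') p')"
proof -
  have "map (\<lambda>g. fst (fst g)) (map (germ E) p) = map (\<lambda>g. fst (fst g)) (rotate k (map (germ E') p'))"
    by (simp only: assms)
  then show ?thesis by (simp add: rotate_map o_def)
qed

lemma follows_new:
  assumes x: "x \<in> exterior"
  shows "follows_component D' C' x \<longleftrightarrow> follows_component D C x"
proof -
  obtain p0 k x1 \<delta>1 y1 x2 \<delta>2 y2 where p0: "p0 \<in> C'"
    and G: "rotate k (map (germ D') (concat (map (cut_arc D' X) p0))) =
      exchanged_germs x1 \<delta>1 y1 x2 \<delta>2 y2"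
    and out: "\<forall>p\<in>C. avoids_tangle p \<longrightarrow> (\<exists>p'\<in>C' - {p0}. germs_rotated p p')"
    and inward: "\<forall>p'\<in>C' - {p0}. \<exists>p\<in>C. avoids_tangle p \<and> germs_rotated p p'"
    by (rule exchanged_circuits) (rule that)
  have xX: "x \<notin> X" using x X_classical by blast
  have xv: "x \<noteq> v" using x v_exterior by blast
  have xp: "p1 \<noteq> x" "p2 \<noteq> x" "p3 \<noteq> x" "p4 \<noteq> x" using xX p_mem by blast+
  have "straight x (map (germ D') p0) \<longleftrightarrow> straight x (rotate k (map (germ D') (concat (map (cut_arc D' X) p0))))"
    by (simp only: straight_rotate straight_cut_circuit[OF D' C' p0 finite_X' xX])
  also have "\<dots> \<longleftrightarrow> straight_within x (map (germ D) C11) \<and> straight_within x (map (germ D) C13)"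
    unfolding G by (rule straight_append4)
      (use parts_nonempty parts_finish xv xp in \<open>auto simp: last_map\<close>)
  finally have p0_iff: "straight x (map (germ D') p0) \<longleftrightarrow>
      straight_within x (map (germ D) C11) \<and> straight_within x (map (germ D) C13)" .
  have "(\<forall>p'\<in>C' - {p0}. straight x (map (germ D') p')) \<longleftrightarrow> (\<forall>p\<in>C. avoids_tangle p \<longrightarrow> straight x (map (germ D) p))"
  proof (intro iffI ballI impI)
    fix p assume *: "\<forall>p'\<in>C' - {p0}. straight x (map (germ D') p')" and p: "p \<in> C" "avoids_tangle p"
    obtain p' k where "p' \<in> C' - {p0}" "map (germ D) p = rotate k (map (germ D') p')" using out[rule_format, OF p] by blast
    then show "straight x (map (germ D) p)" using * by (metis straight_rotate)
  next
    fix p' assume *: "\<forall>p\<in>C. avoids_tangle p \<longrightarrow> straight x (map (germ D) p)" and p': "p' \<in> C' - {p0}"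
    obtain p k where "p \<in> C" "avoids_tangle p" "map (germ D) p = rotate k (map (germ D') p')" using inward[rule_format, OF p'] by blast
    then show "straight x (map (germ D') p')" using * by (metis straight_rotate)
  qed
  then show ?thesis
    unfolding follows_old[OF x] follows_component_iff_straight[OF D' C'] using p0 p0_iff by blast
qed

text \<open>\<open>v\<close> is reached only by the first halves of \<open>q1\<close> and
  \<open>q2\<close>, and each is continued by its own second half. All other circuits are copies of
  circuits that never enter the disc.\<close>

lemma follows_new_crossing: "follows_component D' C' v"
proof -
  obtain p0 k x1 \<delta>1 y1 x2 \<delta>2 y2 where p0: "p0 \<in> C'"
    and G: "rotate k (map (germ D') (concat (map (cut_arc D' X) p0))) =
      exchanged_germs x1 \<delta>1 y1 x2 \<delta>2 y2"
    and inward: "\<forall>p'\<in>C' - {p0}. \<exists>p\<in>C. avoids_tangle p \<and> germs_rotated p p'"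
    by (rule exchanged_circuits) (rule that)
  have vX: "v \<notin> X" using v_ball X_not_ball by blast
  have vp: "p1 \<noteq> v" "p2 \<noteq> v" "p3 \<noteq> v" "p4 \<noteq> v" using vX p_mem by blast+
  let ?A = "map (germ D) C11" and ?E = "map (germ D) C13"
  have AE: "fst (snd g) \<noteq> v" if "g \<in> set ?A \<union> set ?E" for g
  proof -
    have "g \<in> germ D ` (set C11 \<union> set C13)" using that by (simp only: set_map image_Un)
    then obtain e where "g = germ D e" "e \<in> set C11 \<union> set C13" by (rule imageE)
    then show ?thesis using parts_outside_ends(2)[of e] v_ball by auto
  qed
  have ne: "?A \<noteq> []" "?E \<noteq> []" using parts_nonempty by simp_all
  have "straight v (?A @ [((p1, x1), (v, \<delta>1)), ((v, \<delta>1), (p2, y1))] @ ?E @ [((p3, x2), (v, \<delta>2)), ((v, \<delta>2), (p4, y2))])"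
    unfolding straight_def
  proof (intro ballI impI)
    fix gg assume gg: "gg \<in> cyclic_pairs (?A @ [((p1, x1), (v, \<delta>1)), ((v, \<delta>1), (p2, y1))] @ ?E @
        [((p3, x2), (v, \<delta>2)), ((v, \<delta>2), (p4, y2))])" and fin: "fst (snd (fst gg)) = v"
    have "fst gg \<notin> set ?A \<union> set ?E" using AE fin by blast
    then have notin: "fst gg \<notin> set ?A" "fst gg \<notin> set ?E" by (metis UnI1, metis UnI2)
    have "gg \<notin> adjacent_pairs ?A" "gg \<notin> adjacent_pairs ?E"
      using adjacent_pairs_mem[of "fst gg" "snd gg" ?A] adjacent_pairs_mem[of "fst gg" "snd gg" ?E] notin
      unfolding prod.collapse by metis+
    moreover have "fst gg \<noteq> last ?A" "fst gg \<noteq> last ?E"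
      using last_in_set[OF ne(1)] last_in_set[OF ne(2)] notin by metis+
    then have "gg \<noteq> (last ?A, h)" "gg \<noteq> (last ?E, h)" for h by (metis fst_conv)+
    \<comment> \<open>Pairs that begin in an outer part cannot have \<open>v\<close> as their
      junction, which leaves the two junctions inside the new arcs and the two at their far
      ends.\<close>
    ultimately have "gg = (((p1, x1), (v, \<delta>1)), ((v, \<delta>1), (p2, y1))) \<or> gg = (((v, \<delta>1), (p2, y1)), hd ?E) \<or>
        gg = (((p3, x2), (v, \<delta>2)), ((v, \<delta>2), (p4, y2))) \<or> gg = (((v, \<delta>2), (p4, y2)), hd ?A)"
      using gg unfolding cyclic_pairs_append4[OF ne(1) list.distinct(2) ne(2) list.distinct(2)] by simp blast
    then show "snd (fst gg) = fst (snd gg)"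
      using fin vp by (elim disjE) simp_all
  qed
  then have "straight v (rotate k (map (germ D') (concat (map (cut_arc D' X) p0))))" by (simp only: G)
  then have "straight v (map (germ D') p0)"
    by (simp only: straight_rotate straight_cut_circuit[OF D' C' p0 finite_X' vX])
  moreover have "straight v (map (germ D') p')" if p': "p' \<in> C' - {p0}" for p'
  proof -
    obtain p k where p: "p \<in> C" "avoids_tangle p" "map (germ D) p = rotate k (map (germ D') p')" using inward[rule_format, OF p'] by blast
    have "straight v (map (germ D) p)"
      using avoiding_arcs(3)[OF p(1,2)] v_ball by (intro straight_vacuous) blast
    then show ?thesis using p(3) by (metis straight_rotate)
  qed
  ultimately show ?thesis
    unfolding follows_component_iff_straight[OF D' C'] by blast
qed

text \<open>The word lists starts, so \<open>q1\<close> and \<open>q2\<close> contribute a point of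
  the circle and \<open>v\<close> each; \<open>p2\<close> and \<open>p4\<close> belong to the pieces
  that follow.\<close>

lemma alternate_new:
  fixes x y :: complex and p0 :: "oriented_arc list"
  assumes p0: "p0 \<in> C'"
    and G: "rotate k (map (germ D') (concat (map (cut_arc D' X) p0))) =
      exchanged_germs x1 \<delta>1 y1 x2 \<delta>2 y2"
    and xy: "x \<notin> X" "y \<notin> X"
  shows "alternate x y (map (start D') p0) \<longleftrightarrow>
    alternate x y (map (start D) C11 @ [p1, v] @ map (start D) C13 @ [p3, v])"
proof -
  have "map (\<lambda>g. fst (fst g)) (rotate k (map (germ D') (concat (map (cut_arc D' X) p0)))) =
      map (start D) C11 @ [p1, v] @ map (start D) C13 @ [p3, v]"
    unfolding G by (simp add: o_def)
  then have "rotate k (map (start D') (concat (map (cut_arc D' X) p0))) =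
      map (start D) C11 @ [p1, v] @ map (start D) C13 @ [p3, v]"
    by (simp add: rotate_map o_def)
  then show ?thesis
    using alternate_cut_circuit[OF D' C' p0 finite_X' xy] by (metis alternate_rotate)
qed

lemma interlaced_new:
  assumes x: "x \<in> exterior" and y: "y \<in> exterior"
  shows "interlaced D' C' x y \<longleftrightarrow> interlaced D C x y"
proof -
  obtain p0 k x1 \<delta>1 y1 x2 \<delta>2 y2 where p0: "p0 \<in> C'"
    and G: "rotate k (map (germ D') (concat (map (cut_arc D' X) p0))) =
      exchanged_germs x1 \<delta>1 y1 x2 \<delta>2 y2"
    and out: "\<forall>p\<in>C. avoids_tangle p \<longrightarrow> (\<exists>p'\<in>C' - {p0}. germs_rotated p p')"
    and inward: "\<forall>p'\<in>C' - {p0}. \<exists>p\<in>C. avoids_tangle p \<and> germs_rotated p p'"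
    by (rule exchanged_circuits) (rule that)
  have xyX: "x \<notin> X" "y \<notin> X" using x y X_classical by blast+
  have ne: "p1 \<noteq> x" "p1 \<noteq> y" "p3 \<noteq> x" "p3 \<noteq> y" "v \<noteq> x" "v \<noteq> y"
    using xyX p_mem x y v_exterior by blast+
  have fil: "alternate x y xs \<longleftrightarrow> alternate x y (filter (\<lambda>z. z = x \<or> z = y) xs)" for xs
    by (subst alternate_filter) simp_all
  have "alternate x y (map (start D') p0) \<longleftrightarrow> alternate x y (map (start D) C11 @ map (start D) C13)"
    unfolding alternate_new[OF p0 G xyX]
    by (subst (1 2) fil) (use ne in simp)
  moreover have "(\<exists>p'\<in>C' - {p0}. alternate x y (map (start D') p')) \<longleftrightarrow>
      (\<exists>p\<in>C. avoids_tangle p \<and> alternate x y (map (start D) p))"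
  proof
    assume "\<exists>p'\<in>C' - {p0}. alternate x y (map (start D') p')"
    then obtain p' where p': "p' \<in> C' - {p0}" "alternate x y (map (start D') p')" by blast
    obtain p k where p: "p \<in> C" "avoids_tangle p" "map (germ D) p = rotate k (map (germ D') p')" using inward[rule_format, OF p'(1)] by blast
    have "alternate x y (map (start D) p)" using p'(2) unfolding starts_of_germs[OF p(3)] alternate_rotate .
    then show "\<exists>p\<in>C. avoids_tangle p \<and> alternate x y (map (start D) p)" using p by blast
  next
    assume "\<exists>p\<in>C. avoids_tangle p \<and> alternate x y (map (start D) p)"
    then obtain p where p: "p \<in> C" "avoids_tangle p" "alternate x y (map (start D) p)" by blast
    obtain p' k where p': "p' \<in> C' - {p0}" "map (germ D) p = rotate k (map (germ D') p')" using out[rule_format, OF p(1,2)] by blast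
    have "alternate x y (map (start D') p')" using p(3) unfolding starts_of_germs[OF p'(2)] alternate_rotate .
    then show "\<exists>p'\<in>C' - {p0}. alternate x y (map (start D') p')" using p' by blast
  qed
  ultimately show ?thesis
    unfolding interlaced_old[OF x y] interlaced_iff_alternate[of D'] using p0 by blast
qed

text \<open>The two occurrences of \<open>v\<close> in the main word separate the starts of
  \<open>C11\<close> from those of \<open>C13\<close>, and no other circuit passes through
  \<open>v\<close>.\<close>

lemma interlaced_new_crossing:
  assumes x: "x \<in> exterior"
  shows "interlaced D' C' v x \<longleftrightarrow> x \<in> visited D C11 \<inter> visited D C13"
proof -
  obtain p0 k x1 \<delta>1 y1 x2 \<delta>2 y2 where p0: "p0 \<in> C'"
    and G: "rotate k (map (germ D') (concat (map (cut_arc D' X) p0))) =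
      exchanged_germs x1 \<delta>1 y1 x2 \<delta>2 y2"
    and inward: "\<forall>p'\<in>C' - {p0}. \<exists>p\<in>C. avoids_tangle p \<and> germs_rotated p p'"
    by (rule exchanged_circuits) (rule that)
  have vX: "v \<notin> X" "x \<notin> X" using v_ball X_not_ball x X_classical by blast+
  have ne: "p1 \<noteq> x" "p3 \<noteq> x" "p1 \<noteq> v" "p3 \<noteq> v" "v \<noteq> x"
    using vX p_mem x v_exterior by blast+
  have absent: "v \<notin> set (map (start D) C11 @ [p1])" "v \<notin> set (map (start D) C13 @ [p3])"
    using parts_outside_ends(1) v_ball ne by auto
  have "alternate v x (map (start D') p0) \<longleftrightarrow>
      alternate v x ((map (start D) C11 @ [p1]) @ v # (map (start D) C13 @ [p3]) @ v # [])"
    unfolding alternate_new[OF p0 G vX] by simp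
  also have "\<dots> \<longleftrightarrow> x \<in> set (map (start D) C13 @ [p3]) \<and> x \<in> set (map (start D) C11 @ [p1]) \<union> set []"
    by (rule alternate_two_occurrences) (use absent ne in auto)
  also have "\<dots> \<longleftrightarrow> x \<in> visited D C11 \<inter> visited D C13"
    using visited_parts[of x] x ne by auto
  finally have p0_iff: "alternate v x (map (start D') p0) \<longleftrightarrow> x \<in> visited D C11 \<inter> visited D C13" .
  have "\<not> alternate v x (map (start D') p')" if p': "p' \<in> C' - {p0}" for p'
  proof
    assume alt: "alternate v x (map (start D') p')"
    obtain p k where p: "p \<in> C" "avoids_tangle p" "map (germ D) p = rotate k (map (germ D') p')" using inward[rule_format, OF p'] by blast
    have "alternate v x (map (start D) p)" using alt unfolding starts_of_germs[OF p(3)] alternate_rotate .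
    then have "v \<in> set (map (start D) p)" by (rule alternate_absent)
    then show False using avoiding_arcs(2)[OF p(1,2)] v_ball by auto
  qed
  then show ?thesis
    unfolding interlaced_iff_alternate using p0 p0_iff ne(5) by blast
qed

end

section \<open>Counting components and free loops\<close>

lemma curve_elements_inject:
  assumes "link_diagram D" "i < length (curves D)" "j < length (curves D)"
    and "curve_elements D i = curve_elements D j"
  shows "i = j"
proof -
  have "((curves D ! i) 0, direction D (i, 0)) \<in> curve_elements D i"
    unfolding curve_elements_def by (rule rangeI)
  then show ?thesis using curve_elements_disjoint[OF assms(1-3)] unfolding assms(4) by simp
qed

text \<open>A germ determines its arc and an arc its circuit, so distinct circuits have different
  sets of germs.\<close>

lemma euler_system_germs_unique:
  assumes E: "link_diagram E" "euler_system E K" and p: "p \<in> K" "p' \<in> K"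
    and g: "germ E ` set p = germ E ` set p'"
  shows "p = p'"
proof -
  have "hd p \<in> set p" using euler_system_arc(1)[OF E p(1)] by simp
  then have "germ E (hd p) \<in> germ E ` set p'" unfolding g[symmetric] by (rule imageI)
  then obtain e where e: "germ E (hd p) = germ E e" "e \<in> set p'" by (rule imageE)
  have "hd p \<in> arcs (universe E)" "e \<in> arcs (universe E)"
    using euler_system_arc(2)[OF E p(1)] euler_system_arc(2)[OF E p(2)] \<open>hd p \<in> set p\<close> e(2) by blast+
  then have "hd p = e" using universe_arc_germ_unique[OF E(1)] e(1) by simp
  then show ?thesis using euler_system_circuit_unique[OF E p \<open>hd p \<in> set p\<close>] e(2) by simp
qed

context tangle_replacement
begin

text \<open>The successor accounts for the exchanged circuit; it cancels the subtraction of one in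
  the free loops of an interlacement graph.\<close>

lemma card_components': "card (universe_components D') = Suc (card {p \<in> C. avoids_tangle p})"
proof -
  obtain p0 where p0: "p0 \<in> C'"
    and out: "\<forall>p\<in>C. avoids_tangle p \<longrightarrow> (\<exists>p'\<in>C' - {p0}. germs_rotated p p')"
    and inward: "\<forall>p'\<in>C' - {p0}. \<exists>p\<in>C. avoids_tangle p \<and> germs_rotated p p'"
    by (rule exchanged_circuits) (rule that)
  have cards: "card (universe_components D') = card C'"
    using euler_system_card[OF D' C', of "\<lambda>_. True"] by simp
  have "universe_components D' \<subseteq> Pow (classical D')" using universe_component_classical(2)[of _ D'] by blast
  then have "finite (universe_components D')" by (rule finite_subset) (simp add: finite_classical[OF D'])
  moreover have "universe_components D' \<noteq> {}" using euler_system_component[OF C' p0] by blast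
  \<comment> \<open>Infinite sets have cardinality 0, so positivity yields that \<open>C'\<close> is
    finite.\<close>
  ultimately have "card C' > 0" unfolding cards[symmetric] by (simp add: card_gt_0_iff)
  then have fin: "finite C'" by (rule card_ge_0_finite)
  have "\<forall>p\<in>{p \<in> C. avoids_tangle p}. \<exists>p'. p' \<in> C' - {p0} \<and> germs_rotated p p'"
    using out by blast
  then obtain f where f: "\<forall>p\<in>{p \<in> C. avoids_tangle p}. f p \<in> C' - {p0} \<and>
      (\<exists>k. map (germ D) p = rotate k (map (germ D') (f p)))"
    by (rule bchoice[THEN exE])
  have same_germs: "germ D ` set p = germ D' ` set p'" if "germs_rotated p p'" for p p'
    using that by (metis list.set_map set_rotate)
  have f_germs: "f p \<in> C' - {p0}" "germ D ` set p = germ D' ` set (f p)" if "p \<in> C" "avoids_tangle p" for p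
    using f that same_germs by blast+
  have "bij_betw f {p \<in> C. avoids_tangle p} (C' - {p0})"
    unfolding bij_betw_def
  proof
    show "inj_on f {p \<in> C. avoids_tangle p}"
    proof (rule inj_onI)
      fix a b assume ab: "a \<in> {p \<in> C. avoids_tangle p}" "b \<in> {p \<in> C. avoids_tangle p}" "f a = f b"
      then show "a = b" using euler_system_germs_unique[OF D C, of a b] f_germs(2)[of a] f_germs(2)[of b] by simp
    qed
    show "f ` {p \<in> C. avoids_tangle p} = C' - {p0}"
    proof (intro subset_antisym subsetI)
      fix p' assume "p' \<in> f ` {p \<in> C. avoids_tangle p}"
      then show "p' \<in> C' - {p0}" using f_germs(1) by blast
    next
      fix p' assume p': "p' \<in> C' - {p0}"
      obtain p where p: "p \<in> C" "avoids_tangle p" "germs_rotated p p'"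
        using inward[rule_format, OF p'] by blast
      have "germ D' ` set p' = germ D' ` set (f p)" using same_germs[OF p(3)] f_germs(2)[OF p(1,2)] by simp
      then have "p' = f p" using euler_system_germs_unique[OF D' C', of p' "f p"] p' f_germs(1)[OF p(1,2)] by blast
      then show "p' \<in> f ` {p \<in> C. avoids_tangle p}" using p(1,2) by blast
    qed
  qed
  then have "card {p \<in> C. avoids_tangle p} = card (C' - {p0})" by (rule bij_betw_same_card)
  then show ?thesis
    unfolding cards using card_Suc_Diff1[OF fin p0] by simp
qed

text \<open>\<open>components_outside\<close> tests closed arcs and \<open>avoids_tangle\<close>
  open ones. They agree since arcs end at classical points, none of which lies on the
  circle.\<close>

lemma card_components_avoiding:
  "card {K \<in> universe_components D. \<forall>e\<in>arcs (universe D \<restriction> K). arc_path D e ` {0..1} \<inter> cball c r = {}} =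
    card {p \<in> C. avoids_tangle p}"
proof -
  have "arc_path D e ` {0..1} \<inter> cball c r = {} \<longleftrightarrow> open_arc D e \<inter> cball c r = {}"
    if e: "e \<in> arcs (universe D)" for e
  proof -
    obtain i s t where e': "e = (i, s, t)" by (cases e)
    have arc: "arc_of D e" using e by (rule universe_arc_of)
    have st: "s < t" using arc by (simp add: arc_of_def e')
    have "{0..1::real} = {0<..<1} \<union> {0, 1}" by auto
    then have im: "arc_path D e ` {0..1} = open_arc D e \<union> {start D e, finish D e}"
      using open_arc_arc_path[OF st, of D i]
      by (simp add: e' image_Un arc_path_def subpath_def start_def finish_def)
    have outer: "start D e \<notin> cball c r \<and> finish D e \<notin> cball c r" if "open_arc D e \<inter> cball c r = {}"
      using arc_outside_ends[OF D arc that] universe_arc_ends[OF e] X_classical unfolding cball_iff by blast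
    show ?thesis
      unfolding im Int_Un_distrib2 Un_empty
      by (cases "open_arc D e \<inter> cball c r = {}") (use outer in \<open>simp_all add: Int_insert_left\<close>)
  qed
  then have "(\<forall>e\<in>set p. arc_path D e ` {0..1} \<inter> cball c r = {}) \<longleftrightarrow> avoids_tangle p" if "p \<in> C" for p
    unfolding avoids_tangle_def
    by (intro ball_cong refl) (use subsetD[OF euler_system_arc(2)[OF D C that]] in simp)
  then have "{p \<in> C. \<forall>e\<in>set p. arc_path D e ` {0..1} \<inter> cball c r = {}} = {p \<in> C. avoids_tangle p}"
    by (intro Collect_cong conj_cong refl)
  then show ?thesis
    using euler_system_card[OF D C, of "\<lambda>e. arc_path D e ` {0..1} \<inter> cball c r = {}"] by simp
qed

text \<open>A free loop misses \<open>v\<close>, so it differs from the curves carrying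
  \<open>q1\<close> and \<open>q2\<close>. As these contain everything of \<open>D'\<close> in the
  closed disc, every point of the loop there would be a crossing. On the circle there are none, and
  in the open disc a whole interval of parameters would give crossings.\<close>

lemma new_free_loop_outside:
  assumes "j \<in> universe_free_loops D'"
  shows "range (curves D' ! j) \<inter> cball c r = {}"
proof (rule ccontr)
  have j: "j < length (curves D')" "range (curves D' ! j) \<inter> classical D' = {}"
    using assms by (auto simp: universe_free_loops_def)
  assume "range (curves D' ! j) \<inter> cball c r \<noteq> {}"
  then obtain t where t: "(curves D' ! j) t \<in> cball c r" by blast
  obtain i1 s1 t1 where i1: "q1 = (i1, s1, t1)" by (cases q1)
  obtain i2 s2 t2 where i2: "q2 = (i2, s2, t2)" by (cases q2)
  have a1: "i1 < length (curves D')" "(curves D' ! i1) s1 = p1" "(curves D' ! i1) t1 = p2"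
    using q1 by (simp_all add: i1 arc_inside_def start_def finish_def)
  have a2: "i2 < length (curves D')" "(curves D' ! i2) s2 = p3" "(curves D' ! i2) t2 = p4"
    using q2 by (simp_all add: i2 arc_inside_def start_def finish_def)
  have "v \<in> crossings D' \<inter> ball c r" using v_ball v_classical classical_subset_crossings[OF D'] by blast
  then have "v \<in> open_arc D' q1" "v \<in> open_arc D' q2"
    using replaced by (auto simp: tangle_replaced_def)
  then have "v \<in> range (curves D' ! i1)" "v \<in> range (curves D' ! i2)"
    unfolding i1 i2 open_arc_def case_prod_conv by blast+
  then have ne: "j \<noteq> i1" "j \<noteq> i2" using j(2) v_classical by blast+
  have img: "(curves D' ! j) u \<in> image_of D'" for u
    using strand_point_frac[OF j(1), of u] position_frac(1)[OF D' j(1), of u] unfolding image_of_def by force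
  have crossing: "(curves D' ! j) u \<in> crossings D'" if u: "(curves D' ! j) u \<in> cball c r" for u
  proof (rule ccontr)
    assume nc: "(curves D' ! j) u \<notin> crossings D'"
    have no1: "(curves D' ! j) u \<noteq> (curves D' ! i1) w" for w
      using curve_strand_unique[OF D' j(1) a1(1), of u w] nc ne(1) by blast
    have no2: "(curves D' ! j) u \<noteq> (curves D' ! i2) w" for w
      using curve_strand_unique[OF D' j(1) a2(1), of u w] nc ne(2) by blast
    from u consider "(curves D' ! j) u \<in> ball c r" | "(curves D' ! j) u \<in> X" unfolding cball_iff by blast
    then show False
    proof cases
      case 1
      then have "(curves D' ! j) u \<in> open_arc D' q1 \<union> open_arc D' q2" using img[of u] image_ball by blast
      then show False using no1 no2 unfolding i1 i2 open_arc_def case_prod_conv by blast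
    next
      case 2
      then have "(curves D' ! j) u \<in> {p1, p2, p3, p4}" using img[of u] X_image' X_points by blast
      then show False using no1[of s1] no1[of t1] no2[of s2] no2[of t2] a1 a2 by simp
    qed
  qed
  have "(curves D' ! j) t \<notin> X" using crossing[OF t] X_crossings' by blast
  then have "(curves D' ! j) t \<in> ball c r" using t unfolding cball_iff by blast
  moreover have "open ((curves D' ! j) -` ball c r)"
    using regular_closed_curve_continuous(1)[OF regular_curve[OF D' j(1)], of UNIV]
    by (intro open_vimage open_ball)
  ultimately obtain e where e: "e > 0" "ball t e \<subseteq> (curves D' ! j) -` ball c r"
    by (meson open_contains_ball vimageI)
  \<comment> \<open>Crossing parameters are known to be finite in number only on intervals of length
    at most 1, hence the bound \<open>min e 1\<close>.\<close>
  have "finite {u. t < u \<and> u < t + min e 1 \<and> (curves D' ! j) u \<in> crossings D'}"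
    by (rule finite_parameters[OF D' j(1)]) (use D' in \<open>auto simp: link_diagram_def\<close>)
  moreover have "{t<..<t + min e 1} \<subseteq> {u. t < u \<and> u < t + min e 1 \<and> (curves D' ! j) u \<in> crossings D'}"
  proof
    fix u assume u: "u \<in> {t<..<t + min e 1}"
    then have "u \<in> ball t e" by (simp add: mem_ball dist_real_def min_def split: if_splits)
    then have "(curves D' ! j) u \<in> cball c r" using e(2) cball_iff by blast
    then show "u \<in> {u. t < u \<and> u < t + min e 1 \<and> (curves D' ! j) u \<in> crossings D'}"
      using u crossing by simp
  qed
  ultimately have "finite {t<..<t + min e 1}" by (rule finite_subset[rotated])
  then show False using e(1) infinite_Ioo[of t "t + min e 1"] by simp
qed

text \<open>Free loops of either diagram that miss the closed disc correspond by equality of their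
  line elements; by \<open>new_free_loop_outside\<close> these are all the free loops of
  \<open>D'\<close>.\<close>

lemma card_new_free_loops:
  "card (universe_free_loops D') = card {i \<in> universe_free_loops D. range (curves D ! i) \<inter> cball c r = {}}"
proof -
  let ?A = "{i \<in> universe_free_loops D. range (curves D ! i) \<inter> cball c r = {}}"
  have A: "i < length (curves D)" "range (curves D ! i) \<inter> cball c r = {}" "range (curves D ! i) \<inter> classical D = {}"
    if "i \<in> ?A" for i using that by (auto simp: universe_free_loops_def)
  have range_eq: "range (curves D' ! j) = range (curves D ! i)" if "curve_elements D' j = curve_elements D i" for i j
    using that by (metis fst_curve_elements)
  have "\<forall>i\<in>?A. \<exists>j. j < length (curves D') \<and> curve_elements D' j = curve_elements D i"
    using outside_curve_correspondence[OF D D' le A(1,2)] by blast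
  then obtain f where f: "\<forall>i\<in>?A. f i < length (curves D') \<and> curve_elements D' (f i) = curve_elements D i"
    by (rule bchoice[THEN exE])
  have v_cball: "v \<in> cball c r" using v_ball cball_iff by blast
  have f_free: "f i \<in> universe_free_loops D'" if i: "i \<in> ?A" for i
  proof -
    have fi: "f i < length (curves D')" "curve_elements D' (f i) = curve_elements D i" using f i by blast+
    have "range (curves D' ! f i) \<inter> classical D' = {}"
      unfolding range_eq[OF fi(2)] classical' using A(2,3)[OF i] v_cball by blast
    then show ?thesis using fi(1) by (simp add: universe_free_loops_def)
  qed
  have "bij_betw f ?A (universe_free_loops D')"
    unfolding bij_betw_def
  proof
    show "inj_on f ?A"
    proof (rule inj_onI)
      fix i k assume ik: "i \<in> ?A" "k \<in> ?A" "f i = f k"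
      note e = conjunct2[OF bspec[OF f ik(1)]] conjunct2[OF bspec[OF f ik(2)]]
      show "i = k"
        by (rule curve_elements_inject[OF D A(1)[OF ik(1)] A(1)[OF ik(2)]])
          (simp only: e[symmetric] ik(3))
    qed
    show "f ` ?A = universe_free_loops D'"
    proof (intro subset_antisym subsetI)
      fix j assume "j \<in> f ` ?A"
      then show "j \<in> universe_free_loops D'" using f_free by blast
    next
      fix j assume free: "j \<in> universe_free_loops D'"
      then have j: "j < length (curves D')" "range (curves D' ! j) \<inter> classical D' = {}"
        by (auto simp: universe_free_loops_def)
      have out: "range (curves D' ! j) \<inter> cball c r = {}" by (rule new_free_loop_outside[OF free])
      obtain i where i: "i < length (curves D)" "curve_elements D i = curve_elements D' j"
        using outside_curve_correspondence[OF D' D le[symmetric] j(1) out] by blast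
      note rg = range_eq[OF i(2)[symmetric]]
      have "range (curves D ! i) \<inter> classical D = {}"
      proof -
        have "classical D \<subseteq> classical D' \<union> cball c r" unfolding classical' by blast
        then show ?thesis using j(2) out unfolding rg by blast
      qed
      then have iA: "i \<in> ?A" using i(1) out unfolding rg by (simp add: universe_free_loops_def)
      have "f i < length (curves D')" "curve_elements D' (f i) = curve_elements D' j"
        using bspec[OF f iA] i(2) by simp_all
      then have "f i = j" by (intro curve_elements_inject[OF D' _ j(1)])
      then show "j \<in> f ` ?A" using iA by blast
    qed
  qed
  then show ?thesis by (rule bij_betw_same_card[symmetric])
qed

lemma free_loops_new:
  "card (universe_components D') + card (universe_free_loops D') - 1 = components_outside D c r"
  unfolding components_outside_def card_components' card_components_avoiding card_new_free_loops by simp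

lemma finite_exterior: "finite exterior"
  using finite_classical[OF D] by simp

section \<open>The new interlacement graph as a composition\<close>

context
  fixes A B :: "'r::comm_ring_1" and \<alpha> \<beta> :: "complex \<Rightarrow> 'r" and a :: complex
  assumes a: "a \<notin> exterior"
begin

definition "ext_graph = exterior_graph A B D C \<alpha> \<beta> c r C11 C13 a"

abbreviation "common \<equiv> visited D C11 \<inter> visited D C13"

lemma ext_graph_simps:
  "vertices ext_graph = insert a exterior"
  "marks ext_graph = {x \<in> exterior. \<not> follows_component D C x}"
  "alpha ext_graph = \<alpha>(a := A)" "beta ext_graph = \<beta>(a := B)"
  "free_loops ext_graph = components_outside D c r"
  by (auto simp: ext_graph_def exterior_graph_def Let_def induced_def interlacement_graph_def marked_crossing_def)

lemma ext_graph_edges: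
  "e \<in># edges ext_graph \<longleftrightarrow>
    (e \<in># edges (interlacement_graph D C \<alpha> \<beta>) \<and> e \<subseteq> - cball c r) \<or> (\<exists>x\<in>common. e = {a, x})"
proof -
  have "finite ((\<lambda>x. {a, x}) ` common)"
    using finite_subset[OF visited_exterior finite_exterior] by blast
  then show ?thesis
    by (auto simp: ext_graph_def exterior_graph_def Let_def induced_def)
qed

lemma interlacement_edge_classical:
  assumes "e \<in># edges (interlacement_graph D C \<alpha> \<beta>)"
  shows "\<exists>x\<in>classical D. \<exists>y\<in>classical D. e = {x, y}" "e \<subseteq> classical D"
proof -
  let ?E = "{{v} | v. negative_crossing D v} \<union>
        {{v, w} | v w. v \<in> classical D \<and> w \<in> classical D \<and> interlaced D C v w}"
  have "?E \<subseteq> Pow (classical D)" by (auto simp: negative_crossing_def)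
  then have fin: "finite ?E" using finite_classical[OF D] finite_subset by blast
  have "edges (interlacement_graph D C \<alpha> \<beta>) = mset_set ?E" by (simp add: interlacement_graph_def)
  then have "e \<in> ?E" using assms elem_mset_set[OF fin, of e] by (simp only:)
  then consider v where "e = {v}" "negative_crossing D v"
    | v w where "e = {v, w}" "v \<in> classical D" "w \<in> classical D" by blast
  then show ex: "\<exists>x\<in>classical D. \<exists>y\<in>classical D. e = {x, y}"
  proof cases
    case 1
    then have "v \<in> classical D" "e = {v, v}" by (simp_all add: negative_crossing_def)
    then show ?thesis by blast
  qed blast
  then show "e \<subseteq> classical D" by blast
qed

lemma ext_graph_edge_exterior:
  assumes "x \<in> exterior" "y \<in> exterior"
  shows "{x, y} \<in># edges ext_graph \<longleftrightarrow> (x = y \<and> negative_crossing D x) \<or> interlaced D C x y"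
proof -
  have "a \<notin> {x, y}" using assms a by blast
  then have "\<not> (\<exists>z\<in>common. {x, y} = {a, z})" by (metis insertI1)
  moreover have "{x, y} \<subseteq> - cball c r" "x \<in> classical D" "y \<in> classical D" using assms by blast+
  ultimately show ?thesis
    unfolding ext_graph_edges edges_interlacement_graph[OF finite_classical[OF D]] by simp
qed

lemma ext_graph_edge_a: "{x, a} \<in># edges ext_graph \<longleftrightarrow> x \<in> common"
proof
  assume "{x, a} \<in># edges ext_graph"
  then consider "{x, a} \<in># edges (interlacement_graph D C \<alpha> \<beta>)" "{x, a} \<subseteq> - cball c r" | z where "z \<in> common" "{x, a} = {a, z}"
    unfolding ext_graph_edges by blast
  then show "x \<in> common"
  proof cases
    case 1
    then have "a \<in> exterior" using interlacement_edge_classical(2)[OF 1(1)] by blast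
    then show ?thesis using a by simp
  next
    case 2
    then have "x = z \<or> (x = a \<and> a = z)" by (auto simp: doubleton_eq_iff)
    then show ?thesis using 2(1) by blast
  qed
next
  assume "x \<in> common"
  then show "{x, a} \<in># edges ext_graph" unfolding ext_graph_edges by (auto simp: insert_commute)
qed

lemma wf_ext_graph: "wf_wgraph ext_graph"
proof -
  have "\<exists>v\<in>insert a exterior. \<exists>w\<in>insert a exterior. e = {v, w}" if "e \<in># edges ext_graph" for e
    using that unfolding ext_graph_edges
  proof (elim disjE conjE bexE)
    assume "e \<in># edges (interlacement_graph D C \<alpha> \<beta>)" "e \<subseteq> - cball c r"
    then obtain x y where "x \<in> classical D" "y \<in> classical D" "e = {x, y}" "{x, y} \<subseteq> - cball c r"
      using interlacement_edge_classical(1)[of e] by metis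
    then show ?thesis by blast
  next
    fix x assume "x \<in> common" "e = {a, x}"
    then show ?thesis using visited_exterior by blast
  qed
  then show ?thesis
    unfolding wf_wgraph_def ext_graph_simps using finite_exterior by auto
qed

lemma standard_ext_graph: "standard_vertex A B ext_graph a"
proof -
  have "a \<notin> common" using visited_exterior a by blast
  then have "{a} \<notin># edges ext_graph" using ext_graph_edge_a[of a] by simp
  then show ?thesis using a by (simp add: standard_vertex_def ext_graph_simps)
qed

lemma compose_dipole_edges:
  assumes w: "w \<notin> insert a exterior"
  shows "e \<in># edges (compose ext_graph (dipole A B a w l) a) \<longleftrightarrow>
    (e \<in># edges ext_graph \<and> a \<notin> e) \<or> (l \<and> e = {w}) \<or> (\<exists>x\<in>common. e = {x, w})"
proof -
  have dip: "{a, z} \<in># edges (dipole A B a w l) \<longleftrightarrow> z = w" for z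
    using w by (auto simp: dipole_def doubleton_eq_iff)
  have set: "{{x, z} | x z. {x, a} \<in># edges ext_graph \<and> {a, z} \<in># edges (dipole A B a w l)} = (\<lambda>x. {x, w}) ` common"
    unfolding ext_graph_edge_a dip by blast
  have "finite common" using finite_subset[OF visited_exterior finite_exterior] .
  then show ?thesis
    using w unfolding compose_def set
    by (auto simp: delete_vertex_def induced_def dipole_def)
qed

text \<open>The point \<open>a\<close> is only required not to be an exterior crossing and may
  coincide with \<open>v\<close>, so \<open>v\<close> itself cannot serve as second vertex of the
  dipole. A fresh \<open>w\<close> is used and then renamed.\<close>

lemma graph_iso_replacement:
  assumes w: "w \<notin> insert a exterior"
  shows "graph_iso (\<lambda>x. if x = w then v else x)
    (compose ext_graph (dipole A B a w (negative_crossing D' v)) a)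
    (interlacement_graph D' C' (\<alpha>(v := A)) (\<beta>(v := B)))"
    (is "graph_iso ?f ?G ?H")
proof -
  have VG: "vertices ?G = insert w exterior"
    using w a by (auto simp: compose_def ext_graph_simps dipole_def)
  have VH: "vertices ?H = insert v exterior" by (simp add: interlacement_graph_def classical')
  have neq: "x \<noteq> w" "x \<noteq> v" "x \<noteq> a" if "x \<in> exterior" for x using that w a v_exterior by blast+
  have fx: "?f x = x" if "x \<in> exterior" for x using neq[OF that] by simp
  have "bij_betw ?f (vertices ?G) (vertices ?H)"
    unfolding VG VH bij_betw_def
  proof
    show "inj_on ?f (insert w exterior)"
      unfolding inj_on_def using neq by (simp split: if_split) blast
    show "?f ` insert w exterior = insert v exterior"
    proof -
      have "?f ` exterior = (\<lambda>x. x) ` exterior" by (rule image_cong[OF refl fx])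
      then show ?thesis by (simp only: image_insert image_ident simp_thms if_True)
    qed
  qed
  moreover have "{x, y} \<in># edges ?G \<longleftrightarrow> {?f x, ?f y} \<in># edges ?H" if xy: "x \<in> vertices ?G" "y \<in> vertices ?G" for x y
  proof -
    note G = compose_dipole_edges[OF w]
    note H = edges_interlacement_graph[OF finite_classical[OF D']]
    have notw: "w \<notin> e" if e: "e \<in># edges ext_graph" for e
    proof -
      have "\<exists>s\<in>insert a exterior. \<exists>t\<in>insert a exterior. e = {s, t}"
        using wf_ext_graph e unfolding wf_wgraph_def ext_graph_simps by simp
      then show ?thesis using w by blast
    qed
    have sub: "common \<subseteq> exterior" by (rule visited_exterior)
    have ww: "{w, w} \<in># edges ?G \<longleftrightarrow> {?f w, ?f w} \<in># edges ?H"
    proof -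
      have "\<not> interlaced D' C' v v" by (simp add: interlaced_def)
      moreover have "{w, w} \<noteq> {x, w}" if "x \<in> common" for x using that sub neq by blast
      ultimately show ?thesis unfolding G H using notw[of "{w, w}"] by auto
    qed
    have wx: "{w, x} \<in># edges ?G \<longleftrightarrow> {?f w, ?f x} \<in># edges ?H" if x: "x \<in> exterior" for x
    proof -
      have "{w, x} \<in># edges ?G \<longleftrightarrow> x \<in> common"
      proof -
        have "{w, x} \<noteq> {w}" using neq[OF x] by blast
        moreover have "{w, x} = {y, w} \<longleftrightarrow> x = y" for y using neq[OF x] by (auto simp: doubleton_eq_iff)
        moreover have "\<not> ({w, x} \<in># edges ext_graph \<and> a \<notin> {w, x})" using notw by blast
        ultimately show ?thesis unfolding G by blast
      qed
      also have "\<dots> \<longleftrightarrow> {?f w, ?f x} \<in># edges ?H"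
        using interlaced_new_crossing[OF x] x neq[OF x] classical' unfolding fx[OF x] H by auto
      finally show ?thesis .
    qed
    have xx: "{x, y} \<in># edges ?G \<longleftrightarrow> {?f x, ?f y} \<in># edges ?H" if x: "x \<in> exterior" and y: "y \<in> exterior" for x y
    proof -
      have "{x, y} \<in># edges ?G \<longleftrightarrow> {x, y} \<in># edges ext_graph"
      proof -
        have "a \<notin> {x, y}" "w \<notin> {x, y}" using neq[OF x] neq[OF y] by blast+
        then have "{x, y} \<noteq> {w}" "{x, y} \<noteq> {z, w}" for z by blast+
        then show ?thesis unfolding G using \<open>a \<notin> {x, y}\<close> by metis
      qed
      then show ?thesis
        unfolding ext_graph_edge_exterior[OF x y] fx[OF x] fx[OF y] H
        using negative_crossing_exterior[OF x] interlaced_new[OF x y] x y classical' by blast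
    qed
    show ?thesis
    proof (cases "x = w"; cases "y = w")
      assume "x = w" "y = w" then show ?thesis using ww by simp
    next
      assume "x = w" "y \<noteq> w" then show ?thesis using wx[of y] xy VG by simp
    next
      assume "x \<noteq> w" "y = w" then show ?thesis using wx[of x] xy VG by (simp add: insert_commute)
    next
      assume "x \<noteq> w" "y \<noteq> w" then show ?thesis using xx[of x y] xy VG by simp
    qed
  qed
  moreover have "(x \<in> marks ?G \<longleftrightarrow> ?f x \<in> marks ?H) \<and> alpha ?G x = alpha ?H (?f x) \<and> beta ?G x = beta ?H (?f x)"
    if x: "x \<in> vertices ?G" for x
  proof (cases "x = w")
    case True
    then show ?thesis
      using w follows_new_crossing
      by (auto simp: compose_def ext_graph_simps dipole_def interlacement_graph_def marked_crossing_def)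
  next
    case False
    then have x: "x \<in> exterior" using x VG by simp
    then show ?thesis
      using neq[OF x] follows_new[OF x] classical'
      by (auto simp: compose_def ext_graph_simps dipole_def interlacement_graph_def marked_crossing_def)
  qed
  moreover have "free_loops ?G = free_loops ?H"
    using free_loops_new by (simp add: compose_def ext_graph_simps dipole_def interlacement_graph_def)
  ultimately show ?thesis unfolding graph_iso_def by blast
qed

lemma bracket_replacement:
  assumes "w \<notin> insert a exterior"
  shows "bracket d (interlacement_graph D' C' (\<alpha>(v := A)) (\<beta>(v := B))) =
    bracket d (compose ext_graph (dipole A B a w (negative_crossing D' v)) a)"
  by (rule bracket_graph_iso[OF graph_iso_replacement[OF assms], symmetric])
    (simp add: compose_def ext_graph_simps dipole_def finite_exterior)

end

end

section \<open>The equations for both signs of the new crossing\<close>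

theorem corollary11:
  fixes A B d :: "'r::comm_ring_1"
    and \<iota> :: "'r \<Rightarrow> 's::comm_ring_1"
    and D Dp Dm :: diagram
    and C Cp Cm :: "oriented_arc list set"
    and C11 C12 C13 C14 :: "oriented_arc list"
    and qp1 qp2 qm1 qm2 :: oriented_arc
    and \<alpha> \<beta> :: "complex \<Rightarrow> 'r"
    and c a p1 p2 p3 p4 vp vm :: complex
    and r :: real
    and F Fp Fm :: "(complex, 'r) wgraph"
    and \<alpha>a \<beta>a \<alpha>m :: 'r
  assumes "independent_variables A B d"
    and "non_zero_divisor (A\<^sup>2 - B\<^sup>2)"
    and "is_localization \<iota> (A\<^sup>2 - B\<^sup>2)"
    and "link_diagram D"
    and "tangle D c r"
    and "euler_system D C"
    and "circuit_through_tangle D C c r C11 p1 C12 p2 C13 p3 C14 p4"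
    and "a \<notin> classical D - cball c r"
    and "F = exterior_graph A B D C \<alpha> \<beta> c r C11 C13 a"
    and "tangle_replaced D c r p1 p2 p3 p4 Dp qp1 qp2 vp"
    and "positive_crossing Dp vp"
    and "euler_system_replaced D C c r C11 C13 Dp qp1 qp2 vp Cp"
    and "Fp = interlacement_graph Dp Cp (\<alpha>(vp := A)) (\<beta>(vp := B))"
    and "tangle_replaced D c r p1 p2 p3 p4 Dm qm1 qm2 vm"
    and "negative_crossing Dm vm"
    and "euler_system_replaced D C c r C11 C13 Dm qm1 qm2 vm Cm"
    and "Fm = interlacement_graph Dm Cm (\<alpha>(vm := A)) (\<beta>(vm := B))"
    and "universal_weights A B d F a \<alpha>a \<beta>a \<alpha>m"
  shows
    "(2 - \<iota> d - (\<iota> d)\<^sup>2) * \<iota> \<alpha>a =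
       - (\<iota> d + 1) * \<iota> (bracket d (delete_vertex F a)) +
       quot (\<iota> (bracket d Fp) + \<iota> (bracket d Fm)) (\<iota> A + \<iota> B) \<and>
     (2 - \<iota> d - (\<iota> d)\<^sup>2) * \<iota> \<beta>a =
       \<iota> (bracket d (delete_vertex F a)) +
       quot ((\<iota> A + \<iota> B + \<iota> B * \<iota> d) * \<iota> (bracket d Fp) - (\<iota> A + \<iota> A * \<iota> d + \<iota> B) * \<iota> (bracket d Fm))
         ((\<iota> A)\<^sup>2 - (\<iota> B)\<^sup>2) \<and>
     (2 - \<iota> d - (\<iota> d)\<^sup>2) * \<iota> \<alpha>m =
       \<iota> (bracket d (delete_vertex F a)) +
       quot ((\<iota> A + \<iota> B + \<iota> B * \<iota> d) * \<iota> (bracket d Fm) - (\<iota> A + \<iota> A * \<iota> d + \<iota> B) * \<iota> (bracket d Fp))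
         ((\<iota> A)\<^sup>2 - (\<iota> B)\<^sup>2)"
proof -
  interpret plus: tangle_replacement D Dp C Cp c r C11 C12 C13 C14 p1 p2 p3 p4 qp1 qp2 vp
    by (rule tangle_replacement.intro) fact+
  interpret minus: tangle_replacement D Dm C Cm c r C11 C12 C13 C14 p1 p2 p3 p4 qm1 qm2 vm
    by (rule tangle_replacement.intro) fact+
  note a = \<open>a \<notin> classical D - cball c r\<close>
  note F = \<open>F = exterior_graph A B D C \<alpha> \<beta> c r C11 C13 a\<close>
  have F_plus: "F = plus.ext_graph A B \<alpha> \<beta> a" unfolding F by (rule plus.ext_graph_def[OF a, symmetric])
  have F_minus: "F = minus.ext_graph A B \<alpha> \<beta> a" unfolding F by (rule minus.ext_graph_def[OF a, symmetric])
  have wf: "wf_wgraph F" and std: "standard_vertex A B F a"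
    unfolding F_plus by (rule plus.wf_ext_graph[OF a], rule plus.standard_ext_graph[OF a])
  have VF: "vertices F = insert a (classical D - cball c r)"
    unfolding F_plus by (rule plus.ext_graph_simps(1)[OF a])
  \<comment> \<open>One point \<open>w\<close> outside this finite set serves for both
    signs.\<close>
  have "finite (insert a (classical D - cball c r))" using plus.finite_exterior by simp
  then obtain w where w: "w \<notin> insert a (classical D - cball c r)"
    using ex_new_if_finite[OF infinite_UNIV_char_0] by blast
  \<comment> \<open>The replacement result loops \<open>w\<close> exactly at a negative crossing; a
    positive one must be shown not to count as negative as well.\<close>
  have "\<not> negative_crossing Dp vp"
    using positive_not_negative_crossing[OF plus.D'] \<open>positive_crossing Dp vp\<close> .
  then have Fp: "bracket d Fp = bracket d (compose F (dipole A B a w False) a)"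
    using plus.bracket_replacement[OF a w, where d = d and A = A and B = B and \<alpha> = \<alpha> and \<beta> = \<beta>] unfolding \<open>Fp = _\<close> F_plus by simp
  have Fm: "bracket d Fm = bracket d (compose F (dipole A B a w True) a)"
    using minus.bracket_replacement[OF a w, where d = d and A = A and B = B and \<alpha> = \<alpha> and \<beta> = \<beta>] \<open>negative_crossing Dm vm\<close>
    unfolding \<open>Fm = _\<close> F_minus by simp
  note U = \<open>universal_weights A B d F a \<alpha>a \<beta>a \<alpha>m\<close>
  have eqs: "bracket d (delete_vertex F a) = d * \<alpha>a + \<beta>a + \<alpha>m"
    "bracket d Fp = (A + B) * \<alpha>a + (A + B * d) * \<beta>a + (A * d + B) * \<alpha>m"
    "bracket d Fm = (A + B) * \<alpha>a + (A * d + B) * \<beta>a + (A + B * d) * \<alpha>m"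
    unfolding Fp Fm using delete_vertex_equation[OF U wf std] dipole_equations[OF U wf std w[folded VF]] by blast+
  show ?thesis
    using solve_equations[OF \<open>is_localization \<iota> (A\<^sup>2 - B\<^sup>2)\<close> eqs] by blast
qed

end
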